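(* There is a polynomial time algorithm for Max Ext-Domination achieving approximation ratio $\frac{6e-5}{6e+5}$. Specifically, the following algorithm does so: given an undirected graph $G=(V,E)$ and integer $p$, compute a spanning forest of $G$, root each tree $T$, and let $\widehat{G}$ be the union of the outputs of \textsc{Decomposition}$(T,1,1)$; compute $A_p$ by \textsc{Greedy} on $G$ and $\widehat{A}_p$ by \textsc{Greedy} on $\widehat{G}$ (with the tie-breaking rule that centers of components are preferred and non-dominated vertices are preferred over dominated ones); output whichever of $A_p, \widehat{A}_p$ has the larger value of $ext$ in $G$. The output $D$ satisfies $ext(D) \geq \frac{6e-5}{6e+5}\max_{A\subseteq V, |A|=p} ext(A)$.
   Context: Max Ext-Domination: given an undirected graph $G=(V,E)$ and integer $p$, find $A\subseteq V$ with $|A|=p$ maximizing $ext(A) = dom(A) - |A|$, where $dom(A)$ is the number of vertices that are in $A$ or adjacent to a vertex of $A$ (i.e. the number of vertices outside $A$ adjacent to some vertex of $A$). For a graph $H$, \textsc{Greedy} on $H$ produces $A_0=\emptyset$, $A_{i+1} = A_i\cup\{\arg\max_{v\notin A_i} dom_H(A_i\cup\{v\})\}$ for $i<p$ and returns $A_p$, with $dom_H$ computed in $H$. \textsc{Decomposition}$(T,1,1)$, for a rooted tree $T$: if $|V(T)| < 3$, return $T$. Otherwise, while $T$ is nonempty: choose a vertex $u_i$ such that the subtree of $u_i$ and all its descendants has at least $3$ vertices and each subtree rooted at a child of $u_i$ has at most $2$ vertices; let $\widehat{G}_i$ be this subtree; if $0 < |V(T\setminus\widehat{G}_i)| < 3$,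 replace $\widehat{G}_i$ by the whole current tree $T$; remove $\widehat{G}_i$ from $T$. Return $\bigcup_i\widehat{G}_i$. For integers $a,b\ge0$, $S_{a,b}$ is the family of trees with vertices $u_0,\dots,u_{a+b},v_1,\dots,v_b$ and edges $\{u_0,u_j\}$ ($1\le j\le a+b$), $\{u_{a+j},v_j\}$ ($1\le j\le b$); each component of the decomposition lies in such a family. The center of a component in $S_{a,b}$ is $u_0$, unless the component is in $S_{0,2}$ (a 5-vertex path), in which case it is one of the two neighbors of $u_0$. *)

theory Defs
  imports Complex_Main "HOL-Computational_Algebra.Polynomial"
begin

definition ugraph :: "'a set \<Rightarrow> 'a set set \<Rightarrow> bool" where
  "ugraph V E \<longleftrightarrow> finite V \<and> E \<subseteq> {{x, y} |x y. x \<in> V \<and> y \<in> V \<and> x \<noteq> y}"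

definition dominated :: "'a set \<Rightarrow> 'a set set \<Rightarrow> 'a set \<Rightarrow> 'a set" where
  "dominated V E A = {x \<in> V. x \<in> A \<or> (\<exists>y\<in>A. {x, y} \<in> E)}"

definition dom_count :: "'a set \<Rightarrow> 'a set set \<Rightarrow> 'a set \<Rightarrow> nat" where
  "dom_count V E A = card (dominated V E A)"

definition ext :: "'a set \<Rightarrow> 'a set set \<Rightarrow> 'a set \<Rightarrow> int" where
  "ext V E A = int (dom_count V E A) - int (card A)"

definition approx_solution ::
  "real \<Rightarrow> 'a set \<Rightarrow> 'a set set \<Rightarrow> nat \<Rightarrow> 'a set \<Rightarrow> bool" where
  "approx_solution \<rho> V E p D \<longleftrightarrow>
     D \<subseteq> V \<and> card D = p \<and>
     real_of_int (ext V E D) \<ge> \<rho> * real_of_int (Max {ext V E A |A. A \<subseteq> V \<and> card A = p})"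

definition path :: "'a set set \<Rightarrow> 'a \<Rightarrow> 'a list \<Rightarrow> 'a \<Rightarrow> bool" where
  "path E x xs y \<longleftrightarrow> xs \<noteq> [] \<and> hd xs = x \<and> last xs = y \<and> distinct xs \<and>
     successively (\<lambda>a b. {a, b} \<in> E) xs"

definition cycle :: "'a set set \<Rightarrow> 'a list \<Rightarrow> bool" where
  "cycle E xs \<longleftrightarrow> length xs \<ge> 3 \<and> distinct xs \<and>
     successively (\<lambda>a b. {a, b} \<in> E) xs \<and> {last xs, hd xs} \<in> E"

definition connects :: "'a set set \<Rightarrow> 'a \<Rightarrow> 'a \<Rightarrow> bool" where
  "connects E x y \<longleftrightarrow> (\<exists>xs. path E x xs y)"

definition components :: "'a set \<Rightarrow> 'a set set \<Rightarrow> 'a set set" where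
  "components V E = {{y \<in> V. connects E x y} |x. x \<in> V}"

text \<open>A spanning forest contains a spanning tree of every connected component.\<close>

definition spanning_forest :: "'a set \<Rightarrow> 'a set set \<Rightarrow> 'a set set \<Rightarrow> bool" where
  "spanning_forest V E F \<longleftrightarrow> F \<subseteq> E \<and> (\<nexists>xs. cycle F xs) \<and> components V F = components V E"

definition induced_edges :: "'a set set \<Rightarrow> 'a set \<Rightarrow> 'a set set" where
  "induced_edges F W = {e \<in> F. e \<subseteq> W}"

text \<open>
  A rooted tree is given by its vertex set \<open>W\<close>, a forest \<open>F\<close> whose edges inside \<open>W\<close> are the tree
  edges, and the root \<open>r\<close>. A vertex is a descendant of \<open>u\<close> if \<open>u\<close> lies on the path from \<open>r\<close> to it;
  the subtree of \<open>u\<close> includes \<open>u\<close> itself.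
\<close>

definition subtree :: "'a set set \<Rightarrow> 'a \<Rightarrow> 'a set \<Rightarrow> 'a \<Rightarrow> 'a set" where
  "subtree F r W u = {w \<in> W. \<exists>xs. path (induced_edges F W) r xs w \<and> u \<in> set xs}"

definition children :: "'a set set \<Rightarrow> 'a \<Rightarrow> 'a set \<Rightarrow> 'a \<Rightarrow> 'a set" where
  "children F r W u = {w \<in> subtree F r W u. {u, w} \<in> F}"

text \<open>
  The pieces are represented by their vertex sets; the edges of a piece \<open>X\<close> are
  \<open>induced_edges F X\<close>.
\<close>

inductive decomposition_loop :: "'a set set \<Rightarrow> 'a \<Rightarrow> 'a set \<Rightarrow> 'a set set \<Rightarrow> bool"
  for F :: "'a set set" and r :: 'a where
  empty: "decomposition_loop F r {} {}"
| step: "\<lbrakk> u \<in> W; S = subtree F r W u; card S \<ge> 3;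
          \<forall>c \<in> children F r W u. card (subtree F r W c) \<le> 2;
          X = (if 0 < card (W - S) \<and> card (W - S) < 3 then W else S);
          decomposition_loop F r (W - X) P \<rbrakk>
        \<Longrightarrow> decomposition_loop F r W (insert X P)"

definition decomposition :: "'a set set \<Rightarrow> 'a \<Rightarrow> 'a set \<Rightarrow> 'a set set \<Rightarrow> bool" where
  "decomposition F r W P \<longleftrightarrow> (if card W < 3 then P = {W} else decomposition_loop F r W P)"

definition in_S :: "nat \<Rightarrow> nat \<Rightarrow> (nat \<Rightarrow> 'a) \<Rightarrow> (nat \<Rightarrow> 'a) \<Rightarrow> 'a set \<Rightarrow> 'a set set \<Rightarrow> bool" where
  "in_S a b u v X H \<longleftrightarrow>
     inj_on u {0..a+b} \<and> inj_on v {1..b} \<and> u ` {0..a+b} \<inter> v ` {1..b} = {} \<and>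
     X = u ` {0..a+b} \<union> v ` {1..b} \<and>
     H = {{u 0, u j} |j. 1 \<le> j \<and> j \<le> a+b} \<union> {{u (a+j), v j} |j. 1 \<le> j \<and> j \<le> b}"

definition is_center :: "'a set \<Rightarrow> 'a set set \<Rightarrow> 'a \<Rightarrow> bool" where
  "is_center X H c \<longleftrightarrow> (\<exists>a b u v. in_S a b u v X H \<and>
     (if a = 0 \<and> b = 2 then c \<in> {u 1, u 2} else c = u 0))"

text \<open>
  \<open>better A w v\<close> states that, for the current set \<open>A\<close>, the tie-breaking rule
  forbids choosing \<open>v\<close> when \<open>w\<close> is also a maximizer.
\<close>

inductive greedy ::
  "'a set \<Rightarrow> 'a set set \<Rightarrow> ('a set \<Rightarrow> 'a \<Rightarrow> 'a \<Rightarrow> bool) \<Rightarrow> nat \<Rightarrow> 'a set \<Rightarrow> bool"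
  for V :: "'a set" and E :: "'a set set" and better :: "'a set \<Rightarrow> 'a \<Rightarrow> 'a \<Rightarrow> bool" where
  start: "greedy V E better 0 {}"
| pick: "\<lbrakk> greedy V E better i A;
          is_arg_max (\<lambda>x. dom_count V E (insert x A)) (\<lambda>x. x \<in> V - A) v;
          \<forall>w. is_arg_max (\<lambda>x. dom_count V E (insert x A)) (\<lambda>x. x \<in> V - A) w
                \<longrightarrow> \<not> better A w v \<rbrakk>
        \<Longrightarrow> greedy V E better (Suc i) (insert v A)"

definition no_preference :: "'a set \<Rightarrow> 'a \<Rightarrow> 'a \<Rightarrow> bool" where
  "no_preference A w v \<longleftrightarrow> False"

text \<open>
  Centers (the set \<open>C\<close>) are preferred over other vertices and non-dominated vertices over dominated
  ones. No order between the two criteria is imposed: \<open>w\<close> is preferred to \<open>v\<close> if it is at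
  least as good in both respects and better in one of them. Every implementation of the rule, with
  either criterion taking precedence, obeys this.
\<close>

definition center_preference :: "'a set \<Rightarrow> 'a set set \<Rightarrow> 'a set \<Rightarrow> 'a set \<Rightarrow> 'a \<Rightarrow> 'a \<Rightarrow> bool" where
  "center_preference V H C A w v \<longleftrightarrow>
     (v \<in> C \<longrightarrow> w \<in> C) \<and>
     (v \<notin> dominated V H A \<longrightarrow> w \<notin> dominated V H A) \<and>
     (w \<in> C \<and> v \<notin> C \<or> w \<notin> dominated V H A \<and> v \<in> dominated V H A)"

text \<open>
  \<open>algorithm_output V E p D\<close>: some run of the algorithm on \<open>(V, E)\<close> and \<open>p\<close> outputs \<open>D\<close>. The
  choices left open are the spanning forest \<open>F\<close>, the root \<open>r T\<close> of each tree \<open>T\<close>, the choices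
  inside the decomposition \<open>P T\<close> of \<open>T\<close>, the center \<open>c X\<close> of each piece \<open>X\<close> (when it is not
  unique) and the remaining ties in the two greedy runs and in the final comparison.
\<close>

definition algorithm_output :: "'a set \<Rightarrow> 'a set set \<Rightarrow> nat \<Rightarrow> 'a set \<Rightarrow> bool" where
  "algorithm_output V E p D \<longleftrightarrow>
     (\<exists>F r P c \<P> H A A'.
        spanning_forest V E F \<and>
        (\<forall>T \<in> components V F. r T \<in> T \<and> decomposition F (r T) T (P T)) \<and>
        \<P> = (\<Union>T \<in> components V F. P T) \<and>
        H = (\<Union>X \<in> \<P>. induced_edges F X) \<and>
        (\<forall>X \<in> \<P>. is_center X (induced_edges F X) (c X)) \<and>
        greedy V E no_preference p A \<and>
        greedy V H (center_preference V H (c ` \<P>)) p A' \<and>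
        D \<in> {A, A'} \<and> ext V E D = max (ext V E A) (ext V E A'))"

text \<open>
  The model of computation is the language WHILE of N. D. Jones (Computability and Complexity from
  a Programming Perspective): imperative programs with finitely many variables ranging over binary
  trees, where every elementary operation (building a cell, projection, copying a variable,
  testing for the empty tree) has unit cost. It is polynomially equivalent to Turing machines.
\<close>

datatype val = Nl | Cell val val

datatype texp = Var nat | NlE | CellE texp texp | Hd texp | Tl texp

fun hd_val :: "val \<Rightarrow> val" where
  "hd_val Nl = Nl"
| "hd_val (Cell x y) = x"

fun tl_val :: "val \<Rightarrow> val" where
  "tl_val Nl = Nl"
| "tl_val (Cell x y) = y"

type_synonym store = "nat \<Rightarrow> val"

fun teval :: "texp \<Rightarrow> store \<Rightarrow> val" where
  "teval (Var i) s = s i"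
| "teval NlE s = Nl"
| "teval (CellE e f) s = Cell (teval e s) (teval f s)"
| "teval (Hd e) s = hd_val (teval e s)"
| "teval (Tl e) s = tl_val (teval e s)"

fun tcost :: "texp \<Rightarrow> nat" where
  "tcost (Var i) = 1"
| "tcost NlE = 1"
| "tcost (CellE e f) = tcost e + tcost f + 1"
| "tcost (Hd e) = tcost e + 1"
| "tcost (Tl e) = tcost e + 1"

datatype com = Assign nat texp | Seq com com | Cond texp com com | While texp com

text \<open>\<open>exec c s t s'\<close>: started in store \<open>s\<close>, program \<open>c\<close> stops after \<open>t\<close> steps in store \<open>s'\<close>.\<close>

inductive exec :: "com \<Rightarrow> store \<Rightarrow> nat \<Rightarrow> store \<Rightarrow> bool" where
  Assign: "exec (Assign i e) s (tcost e + 1) (s(i := teval e s))"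
| Seq: "\<lbrakk> exec c s t s'; exec d s' t' s'' \<rbrakk> \<Longrightarrow> exec (Seq c d) s (t + t') s''"
| CondTrue: "\<lbrakk> teval e s \<noteq> Nl; exec c s t s' \<rbrakk> \<Longrightarrow> exec (Cond e c d) s (tcost e + 1 + t) s'"
| CondFalse: "\<lbrakk> teval e s = Nl; exec d s t s' \<rbrakk> \<Longrightarrow> exec (Cond e c d) s (tcost e + 1 + t) s'"
| WhileFalse: "teval e s = Nl \<Longrightarrow> exec (While e c) s (tcost e + 1) s"
| WhileTrue: "\<lbrakk> teval e s \<noteq> Nl; exec c s t s'; exec (While e c) s' t' s'' \<rbrakk>
    \<Longrightarrow> exec (While e c) s (tcost e + 1 + t + t') s''"

definition computes_in :: "com \<Rightarrow> val \<Rightarrow> nat \<Rightarrow> val \<Rightarrow> bool" where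
  "computes_in c x t y \<longleftrightarrow> (\<exists>s. exec c ((\<lambda>_. Nl)(0 := x)) t s \<and> s 0 = y)"

fun enc_list :: "val list \<Rightarrow> val" where
  "enc_list [] = Nl"
| "enc_list (x # xs) = Cell x (enc_list xs)"

definition enc_bool :: "bool \<Rightarrow> val" where
  "enc_bool b = (if b then Cell Nl Nl else Nl)"

text \<open>
  The number \<open>p\<close> is given in unary (it is at most the number of vertices), a graph on
  \<open>{0, ..., n - 1}\<close> by its adjacency matrix, and a vertex set by its characteristic vector.
\<close>

definition enc_nat :: "nat \<Rightarrow> val" where
  "enc_nat k = enc_list (replicate k Nl)"

definition enc_set :: "nat \<Rightarrow> nat set \<Rightarrow> val" where
  "enc_set n D = enc_list (map (\<lambda>i. enc_bool (i \<in> D)) [0..<n])"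

definition enc_graph :: "nat \<Rightarrow> nat set set \<Rightarrow> val" where
  "enc_graph n E = enc_list (map (\<lambda>i. enc_set n {j. {i, j} \<in> E}) [0..<n])"

definition enc_instance :: "nat \<Rightarrow> nat set set \<Rightarrow> nat \<Rightarrow> val" where
  "enc_instance n E p = Cell (enc_nat p) (enc_graph n E)"

end

theory Submission
  imports Defs
begin

text \<open>
  Write \<open>n'\<close> for the number of vertices in components with at least three vertices. For the
  optimum, let \<open>q\<close> be the number of its vertices in such components, \<open>d\<close> the number of vertices they
  dominate, and \<open>j\<close> the number of two-vertex components that it meets; its value is at most
  \<open>y = d - q + j\<close>, with \<open>q + j \<le> p\<close> and \<open>d \<le> n'\<close>. The usual greedy argument, refined so that the
  small components cost nothing, gives \<open>ext A \<ge> y - d / e\<close> for the greedy set \<open>A\<close> of \<open>G\<close>. The greedy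
  set \<open>A'\<close> of the decomposition satisfies one of \<open>ext A' \<ge> 2 p\<close>, \<open>5 ext A' \<ge> n' + 5 p\<close> and
  \<open>7 ext A' \<ge> 3 n'\<close>, depending on whether the last gain was at least three, two or one; the tie-breaking
  rule matters only for pieces that are paths with five vertices. The ratio comes from the convex
  combination of the two bounds with weights \<open>6 e\<close> and \<open>5\<close>. If a greedy set dominates everything, it is
  optimal.

  For the polynomial time bound, the functions computable by WHILE programs in polynomial time are shown
  to be closed under composition, case distinction and list iteration with polynomially bounded
  accumulators, and the algorithm is written as such a function on lists of numbers.
\<close>

subsection \<open>Connected components\<close>

text \<open>The loss by the factor 1 - 1/e must hit \<open>d\<close> only and not \<open>j\<close>,
  although greedy interleaves steps in large components with steps in small ones. The order of gains
  makes this possible: a pair is taken only when every gain is at most 2, an isolated vertex only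
  when every gain is at most 1. From then on a further step in a large component could add at most
  1, respectively 0, to \<open>ext\<close>, so diverted steps can be charged.

  The constants for the decomposition come from tight first picks: in a piece with s vertices the
  pick dominates at least (s + 10)/5 vertices, with equality for the five-vertex path, and at least
  (3s + 7)/7, with equality for seven vertices and four dominated. The five-vertex path alone can
  miss the second bound, with 3 in place of 22/7. A second pick of gain 2 repairs this; it exists
  after choosing a neighbour of the middle vertex, but not after choosing the middle vertex.

  The ratio is proved for every run of the algorithm, so the program only has to be shown to produce
  one of these runs.\<close>

lemma path_imp_rtrancl: "path E x xs y \<Longrightarrow> (x, y) \<in> {(a, b). {a, b} \<in> E}\<^sup>*"
proof (induction xs arbitrary: x)
  case (Cons z zs)
  show ?case
  proof (cases zs)
    case Nil
    then show ?thesis using Cons.prems by (auto simp: path_def)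
  next
    case (Cons w ws)
    then have "path E w zs y" "{x, w} \<in> E"
      using Cons.prems by (auto simp: path_def)
    then show ?thesis
      using Cons.IH[of w] by (auto intro: converse_rtrancl_into_rtrancl)
  qed
qed (simp add: path_def)

text \<open>A \<open>path\<close> repeats no vertex, so appending the next vertex \<open>z\<close>
  may fail. If \<open>z\<close> already lies on the path, the prefix ending at \<open>z\<close> is
  taken instead.\<close>

lemma rtrancl_imp_connects: "(x, y) \<in> {(a, b). {a, b} \<in> E}\<^sup>* \<Longrightarrow> connects E x y"
proof (induction rule: rtrancl_induct)
  case base
  have "path E x [x] x" by (simp add: path_def)
  then show ?case unfolding connects_def by blast
next
  case (step y z)
  then obtain xs where xs: "path E x xs y" unfolding connects_def by blast
  show ?case
  proof (cases "z \<in> set xs")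
    case True
    then obtain as bs where "xs = as @ z # bs" by (meson split_list)
    then have eq: "xs = (as @ [z]) @ bs" by simp
    have "successively (\<lambda>a b. {a, b} \<in> E) ((as @ [z]) @ bs)"
      using xs unfolding path_def eq by blast
    then have "successively (\<lambda>a b. {a, b} \<in> E) (as @ [z])"
      by (simp only: successively_append_iff)
    moreover have "hd (as @ [z]) = x"
      using xs eq by (cases as) (auto simp: path_def)
    ultimately have "path E x (as @ [z]) z"
      using xs eq by (auto simp: path_def)
    then show ?thesis unfolding connects_def by blast
  next
    case False
    then have "path E x (xs @ [z]) z"
      using xs step(2) by (auto simp: path_def successively_append_iff)
    then show ?thesis unfolding connects_def by blast
  qed
qed

lemma connects_iff_rtrancl: "connects E x y \<longleftrightarrow> (x, y) \<in> {(a, b). {a, b} \<in> E}\<^sup>*"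
proof
  assume "connects E x y"
  then obtain xs where "path E x xs y" unfolding connects_def ..
  then show "(x, y) \<in> {(a, b). {a, b} \<in> E}\<^sup>*" by (rule path_imp_rtrancl)
qed (rule rtrancl_imp_connects)

lemma connects_refl: "connects E x x"
  by (simp add: connects_iff_rtrancl)

lemma connects_sym: "connects E x y \<Longrightarrow> connects E y x"
proof -
  have "sym {(a, b). {a, b} \<in> E}" by (auto simp: sym_def insert_commute)
  then show "connects E x y \<Longrightarrow> connects E y x"
    unfolding connects_iff_rtrancl by (meson sym_rtrancl symD)
qed

lemma connects_trans: "connects E x y \<Longrightarrow> connects E y z \<Longrightarrow> connects E x z"
  unfolding connects_iff_rtrancl by (rule rtrancl_trans)

lemma connects_edge: "{x, y} \<in> E \<Longrightarrow> connects E x y"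
  unfolding connects_iff_rtrancl by auto

lemma connects_mono: "connects E x y \<Longrightarrow> E \<subseteq> E' \<Longrightarrow> connects E' x y"
  unfolding connects_iff_rtrancl using rtrancl_mono[of "{(a, b). {a, b} \<in> E}" "{(a, b). {a, b} \<in> E'}"]
  by blast

lemma component_eq:
  assumes "T \<in> components V E" "x \<in> T"
  shows "T = {y \<in> V. connects E x y}"
proof -
  obtain z where "T = {y \<in> V. connects E z y}"
    using assms(1) unfolding components_def by blast
  then show ?thesis
    using assms(2) connects_sym connects_trans by (smt (verit) Collect_cong mem_Collect_eq)
qed

lemma component_subset: "T \<in> components V E \<Longrightarrow> T \<subseteq> V"
  unfolding components_def by blast

lemma component_nonempty:
  assumes "T \<in> components V E"
  shows "T \<noteq> {}"
proof -
  obtain x where "x \<in> V" "T = {y \<in> V. connects E x y}"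
    using assms unfolding components_def by blast
  then have "x \<in> T" by (simp add: connects_refl)
  then show ?thesis by blast
qed

lemma component_of:
  assumes "x \<in> V"
  shows "{y \<in> V. connects E x y} \<in> components V E" "x \<in> {y \<in> V. connects E x y}"
  using assms connects_refl unfolding components_def by auto

lemma Union_components: "\<Union> (components V E) = V"
proof
  show "\<Union> (components V E) \<subseteq> V" using component_subset by blast
  show "V \<subseteq> \<Union> (components V E)"
  proof
    fix x assume "x \<in> V"
    from component_of[OF this] show "x \<in> \<Union> (components V E)" by (rule UnionI)
  qed
qed

lemma components_disjoint:
  "T \<in> components V E \<Longrightarrow> T' \<in> components V E \<Longrightarrow> x \<in> T \<Longrightarrow> x \<in> T' \<Longrightarrow> T = T'"
  by (rule trans[OF component_eq component_eq[symmetric]])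

lemma component_edge:
  "T \<in> components V E \<Longrightarrow> x \<in> T \<Longrightarrow> {x, y} \<in> E \<Longrightarrow> y \<in> V \<Longrightarrow> y \<in> T"
  using component_eq connects_edge by fastforce

lemma path_snd:
  assumes "path E x xs y" "x \<noteq> y"
  obtains z where "{x, z} \<in> E" "z \<noteq> x"
proof -
  obtain w ws where "xs = x # w # ws"
    using assms by (cases xs; cases "tl xs") (auto simp: path_def)
  then have "{x, w} \<in> E" "w \<noteq> x" using assms by (auto simp: path_def)
  then show thesis by (rule that)
qed

text \<open>The first edge of a path from \<open>x\<close> to \<open>y\<close> stays inside the
  component, where \<open>y\<close> is the only other vertex.\<close>

lemma component_pair_edge:
  assumes "ugraph V E" "{x, y} \<in> components V E" "x \<noteq> y"
  shows "{x, y} \<in> E"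
proof -
  have "connects E x y"
    using component_eq[OF assms(2), of x] by blast
  then obtain xs where "path E x xs y" unfolding connects_def by blast
  then obtain z where z: "{x, z} \<in> E" "z \<noteq> x" using path_snd assms(3) by metis
  then have "z \<in> V" using assms(1) unfolding ugraph_def by (auto simp: doubleton_eq_iff)
  then have "z = y" using component_edge[OF assms(2) _ z(1)] z(2) by auto
  with z show ?thesis by simp
qed

subsection \<open>Greedy coverage\<close>

definition gain :: "'a set \<Rightarrow> 'a set set \<Rightarrow> 'a set \<Rightarrow> 'a \<Rightarrow> nat" where
  "gain V E A v = card (dominated V E {v} - dominated V E A)"

lemma dominated_subset: "dominated V E A \<subseteq> V"
  unfolding dominated_def by blast

lemma finite_dominated: "finite V \<Longrightarrow> finite (dominated V E A)"
  using dominated_subset finite_subset by metis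

lemma dominated_empty [simp]: "dominated V E {} = {}"
  unfolding dominated_def by blast

lemma dominated_Un: "dominated V E (A \<union> B) = dominated V E A \<union> dominated V E B"
  unfolding dominated_def by blast

lemma dominated_insert: "dominated V E (insert v A) = dominated V E {v} \<union> dominated V E A"
  unfolding dominated_def by blast

lemma dominated_UN: "dominated V E A = (\<Union>v\<in>A. dominated V E {v})"
  unfolding dominated_def by blast

lemma dominated_self: "A \<subseteq> V \<Longrightarrow> A \<subseteq> dominated V E A"
  unfolding dominated_def by blast

lemma dominated_mono: "A \<subseteq> B \<Longrightarrow> E \<subseteq> E' \<Longrightarrow> dominated V E A \<subseteq> dominated V E' B"
  unfolding dominated_def by blast

lemma dom_count_insert:
  "finite V \<Longrightarrow> dom_count V E (insert v A) = dom_count V E A + gain V E A v"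
proof -
  assume "finite V"
  have "dominated V E (insert v A) = dominated V E A \<union> (dominated V E {v} - dominated V E A)"
    using dominated_insert[of V E v A] by auto
  then show ?thesis
    unfolding dom_count_def gain_def using \<open>finite V\<close>
      card_Un_disjoint[of "dominated V E A" "dominated V E {v} - dominated V E A"]
    by (simp add: finite_dominated del: Un_Diff_cancel)
qed

lemma gain_antimono: "finite V \<Longrightarrow> A \<subseteq> B \<Longrightarrow> gain V E B v \<le> gain V E A v"
  unfolding gain_def using dominated_mono[of A B E E V] by (intro card_mono finite_Diff finite_dominated) auto

lemma gain_in: "v \<in> A \<Longrightarrow> gain V E A v = 0"
  unfolding gain_def using dominated_mono[of "{v}" A E E V] by (simp add: Diff_eq_empty_iff[THEN iffD2])

text \<open>Every vertex dominates itself, so an undominated vertex would have positive gain. Hence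
  both greedy analyses may assume gain at least 1 until everything is dominated.\<close>

lemma gain_0_imp_all:
  assumes "finite V" "\<And>w. w \<in> V \<Longrightarrow> gain V E A w = 0"
  shows "dominated V E A = V"
proof -
  have "w \<in> dominated V E A" if "w \<in> V" for w
  proof -
    have "dominated V E {w} - dominated V E A = {}"
      using assms(2)[OF that] finite_dominated[OF assms(1), of E "{w}"] unfolding gain_def by simp
    moreover have "w \<in> dominated V E {w}"
      using dominated_self[of "{w}" V E] that by simp
    ultimately show ?thesis by blast
  qed
  then show ?thesis using dominated_subset[of V E A] by blast
qed

lemma greedy_step:
  assumes "finite V" "is_arg_max (\<lambda>x. dom_count V E (insert x A)) (\<lambda>x. x \<in> V - A) v"
  shows "v \<in> V" "v \<notin> A" "w \<in> V \<Longrightarrow> gain V E A w \<le> gain V E A v"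
proof -
  show "v \<in> V" "v \<notin> A" using assms(2) by (auto simp: is_arg_max_def)
  show "gain V E A w \<le> gain V E A v" if "w \<in> V"
  proof (cases "w \<in> A")
    case True
    then show ?thesis using gain_in[of w A V E] by simp
  next
    case False
    with that assms(2) have "\<not> dom_count V E (insert v A) < dom_count V E (insert w A)"
      unfolding is_arg_max_def by blast
    then show ?thesis using dom_count_insert[OF assms(1), of E _ A] by simp
  qed
qed

text \<open>Rephrases maximal domination as maximal gain. It is parametric in the edge set and the
  preference, so that the runs on \<open>E\<close> and on \<open>H\<close> can share it.\<close>

lemma greedy_induct [consumes 2, case_names empty step]:
  assumes "greedy V E better p A" "finite V"
    and "P {}"
    and "\<And>A v. \<lbrakk> A \<subseteq> V; finite A; P A; v \<in> V; v \<notin> A; \<And>w. w \<in> V \<Longrightarrow> gain V E A w \<le> gain V E A v;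
      \<And>w. \<lbrakk> w \<in> V; w \<notin> A; gain V E A w = gain V E A v \<rbrakk> \<Longrightarrow> \<not> better A w v \<rbrakk> \<Longrightarrow> P (insert v A)"
  shows "P A"
proof -
  have "P A \<and> A \<subseteq> V"
    using assms(1)
  proof (induction rule: greedy.induct)
    case (pick i A v)
    note st = greedy_step[OF assms(2) pick(2)]
    have "\<not> better A w v" if "w \<in> V" "w \<notin> A" "gain V E A w = gain V E A v" for w
    proof -
      have "is_arg_max (\<lambda>x. dom_count V E (insert x A)) (\<lambda>x. x \<in> V - A) w"
        using that st by (auto simp: is_arg_max_def dom_count_insert assms(2) not_less)
      with pick(3) show ?thesis by blast
    qed
    then have "P (insert v A)"
      using pick st assms(2) by (intro assms(4)) (auto intro: finite_subset)
    then show ?case using pick st by simp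
  qed (use assms(3) in simp)
  then show ?thesis ..
qed

lemma greedy_subset_card:
  assumes "greedy V E better p A"
  shows "A \<subseteq> V \<and> finite A \<and> card A = p"
  using assms by (induction rule: greedy.induct) (auto simp: is_arg_max_def)

section \<open>Greedy coverage in the presence of components with one or two vertices\<close>

lemma one_minus_inverse_power_le:
  assumes "q > 0"
  shows "(1 - 1 / real q) ^ q \<le> exp (- 1)"
proof -
  have "1 - 1 / real q \<le> exp (- (1 / real q))"
    using exp_ge_add_one_self[of "- (1 / real q)"] by simp
  then have "(1 - 1 / real q) ^ q \<le> exp (- (1 / real q)) ^ q"
    using assms by (intro power_mono) auto
  also have "\<dots> = exp (- 1)"
    using assms by (simp flip: exp_of_nat_mult)
  finally show ?thesis .
qed

text \<open>The vertices in \<open>B\<close> lie in components with at least three vertices, \<open>\<Q>\<close> is the set of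
  two-vertex components and \<open>I\<close> the set of isolated vertices.\<close>

locale graph_parts =
  fixes V :: "'a set" and E :: "'a set set" and B I :: "'a set" and \<Q> :: "'a set set"
  assumes fin: "finite V"
    and V_eq: "V = B \<union> \<Union>\<Q> \<union> I"
    and disj: "B \<inter> \<Union>\<Q> = {}" "B \<inter> I = {}" "\<Union>\<Q> \<inter> I = {}"
    and \<Q>_disj: "\<And>Q Q' x. \<lbrakk> Q \<in> \<Q>; Q' \<in> \<Q>; x \<in> Q; x \<in> Q' \<rbrakk> \<Longrightarrow> Q = Q'"
    and card_\<Q>: "\<And>Q. Q \<in> \<Q> \<Longrightarrow> card Q = 2"
    and nb_B: "\<And>v. v \<in> B \<Longrightarrow> dominated V E {v} \<subseteq> B"
    and nb_\<Q>: "\<And>Q v. Q \<in> \<Q> \<Longrightarrow> v \<in> Q \<Longrightarrow> dominated V E {v} = Q"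
    and nb_I: "\<And>v. v \<in> I \<Longrightarrow> dominated V E {v} = {v}"
begin

definition hit :: "'a set \<Rightarrow> 'a set set" where
  "hit A = {Q \<in> \<Q>. Q \<inter> A \<noteq> {}}"

lemma finite_parts: "finite B" "finite I" "finite \<Q>"
  using fin V_eq by (auto intro: finite_UnionD)

lemma finite_hit: "finite (hit A)"
  unfolding hit_def using finite_parts by auto

lemma dominated_parts:
  assumes "A \<subseteq> V"
  shows "dominated V E A = dominated V E (A \<inter> B) \<union> \<Union>(hit A) \<union> (A \<inter> I)"
proof -
  have "A = (A \<inter> B) \<union> (A \<inter> \<Union>\<Q>) \<union> (A \<inter> I)" using assms V_eq by blast
  then have "dominated V E A = dominated V E (A \<inter> B) \<union> dominated V E (A \<inter> \<Union>\<Q>) \<union> dominated V E (A \<inter> I)"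
    using dominated_Un by metis
  moreover have "dominated V E (A \<inter> \<Union>\<Q>) = \<Union>(hit A)"
  proof -
    have "dominated V E (A \<inter> \<Union>\<Q>) = (\<Union>v\<in>A \<inter> \<Union>\<Q>. dominated V E {v})" by (rule dominated_UN)
    also have "\<dots> = (\<Union>Q\<in>\<Q>. \<Union>v\<in>A \<inter> Q. dominated V E {v})" by blast
    also have "\<dots> = (\<Union>Q\<in>\<Q>. \<Union>v\<in>A \<inter> Q. Q)" using nb_\<Q> by (intro SUP_cong) auto
    also have "\<dots> = \<Union>(hit A)" unfolding hit_def by blast
    finally show ?thesis .
  qed
  moreover have "dominated V E (A \<inter> I) = A \<inter> I"
    by (subst dominated_UN) (use nb_I in auto)
  ultimately show ?thesis by simp
qed

lemma dominated_B: "dominated V E (A \<inter> B) \<subseteq> B"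
  by (subst dominated_UN) (use nb_B in auto)

lemma dom_count_parts:
  assumes "A \<subseteq> V"
  shows "dom_count V E A = card (dominated V E (A \<inter> B)) + 2 * card (hit A) + card (A \<inter> I)"
proof -
  have "card (\<Union>(hit A)) = (\<Sum>Q\<in>hit A. card Q)"
    using \<Q>_disj card_\<Q> unfolding hit_def
    by (intro card_Union_disjoint) (auto simp: pairwise_def disjnt_def card_ge_0_finite)
  also have "\<dots> = 2 * card (hit A)"
    using card_\<Q> by (simp add: hit_def)
  finally have h: "card (\<Union>(hit A)) = 2 * card (hit A)" .
  have sub: "\<Union>(hit A) \<subseteq> \<Union>\<Q>" unfolding hit_def by blast
  have "finite (\<Union>\<Q>)" using fin V_eq by auto
  then have f: "finite (\<Union>(hit A))" using sub finite_subset by blast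
  have "card (dominated V E A) = card (dominated V E (A \<inter> B)) + card (\<Union>(hit A)) + card (A \<inter> I)"
  proof -
    have "dominated V E (A \<inter> B) \<inter> \<Union>(hit A) = {}"
      using dominated_B[of A] sub disj(1) by blast
    moreover have "(dominated V E (A \<inter> B) \<union> \<Union>(hit A)) \<inter> (A \<inter> I) = {}"
      using dominated_B[of A] sub disj(2,3) by blast
    ultimately show ?thesis
      unfolding dominated_parts[OF assms] using f finite_parts(2) finite_dominated[OF fin]
      by (simp add: card_Un_disjoint)
  qed
  then show ?thesis unfolding dom_count_def h .
qed

text \<open>Only an inequality because \<open>A\<close> may contain both vertices of a pair; one
  vertex per hit pair is selected injectively. For a greedy set that does not yet dominate
  everything it is an equality, the first clause of \<open>greedy_inv\<close>.\<close>

lemma card_ge_parts: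
  assumes "A \<subseteq> V"
  shows "card (A \<inter> B) + card (hit A) + card (A \<inter> I) \<le> card A"
proof -
  have fA: "finite A" using assms fin finite_subset by blast
  have "card (hit A) \<le> card (A \<inter> \<Union>\<Q>)"
  proof -
    have "\<forall>Q\<in>hit A. \<exists>x. x \<in> Q \<inter> A" unfolding hit_def by blast
    then obtain f where f: "\<forall>Q\<in>hit A. f Q \<in> Q \<inter> A" by metis
    then have "inj_on f (hit A)" using \<Q>_disj unfolding inj_on_def hit_def by (metis (no_types, lifting) IntD1 mem_Collect_eq)
    moreover have "f ` hit A \<subseteq> A \<inter> \<Union>\<Q>" using f unfolding hit_def by blast
    ultimately show ?thesis using fA by (meson card_inj_on_le finite_Int)
  qed
  moreover have "card A = card (A \<inter> B) + card (A \<inter> \<Union>\<Q>) + card (A \<inter> I)"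
  proof -
    have "A = (A \<inter> B) \<union> (A \<inter> \<Union>\<Q>) \<union> (A \<inter> I)" using assms V_eq by blast
    then have "card A = card ((A \<inter> B) \<union> (A \<inter> \<Union>\<Q>) \<union> (A \<inter> I))" by simp
    also have "\<dots> = card (A \<inter> B) + card (A \<inter> \<Union>\<Q>) + card (A \<inter> I)"
    proof -
      have "(A \<inter> B) \<inter> (A \<inter> \<Union>\<Q>) = {}" using disj(1) by blast
      moreover have "((A \<inter> B) \<union> (A \<inter> \<Union>\<Q>)) \<inter> (A \<inter> I) = {}" using disj(2,3) by blast
      ultimately show ?thesis using fA by (simp add: card_Un_disjoint)
    qed
    finally show ?thesis .
  qed
  ultimately show ?thesis by simp
qed

text \<open>Neither vertex of an unhit pair is dominated, so choosing one gains both. Consequently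
  greedy gains at least 2 per step until all pairs are hit.\<close>

lemma gain_untouched_pair:
  assumes "A \<subseteq> V" "Q \<in> \<Q>" "Q \<notin> hit A"
  obtains v where "v \<in> V" "gain V E A v = 2"
proof -
  obtain v where v: "v \<in> Q" using card_\<Q>[OF assms(2)] by fastforce
  have "Q \<inter> dominated V E A = {}"
  proof -
    have "Q \<subseteq> \<Union>\<Q>" "Q \<inter> A = {}" using assms(2,3) unfolding hit_def by blast+
    moreover have "Q \<inter> \<Union>(hit A) = {}"
    proof -
      have "Q \<inter> Q' = {}" if "Q' \<in> hit A" for Q'
        using that assms(2,3) \<Q>_disj[of Q Q'] unfolding hit_def by blast
      then show ?thesis by blast
    qed
    ultimately show ?thesis
      unfolding dominated_parts[OF assms(1)] using dominated_B[of A] disj(1) by blast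
  qed
  then have "gain V E A v = 2"
    unfolding gain_def nb_\<Q>[OF assms(2) v] using card_\<Q>[OF assms(2)] by (simp add: Diff_triv)
  moreover have "v \<in> V" using v assms(2) V_eq by blast
  ultimately show thesis using that by blast
qed

text \<open>Submodularity: each vertex of \<open>P\<close> in \<open>B\<close> can still add at most
  \<open>m\<close> vertices. The estimate stays inside \<open>B\<close> because neighbourhoods of
  vertices of \<open>B\<close> do.\<close>

lemma gain_average:
  assumes "\<And>w. w \<in> V \<Longrightarrow> gain V E A w \<le> m" "P \<subseteq> V" "A \<subseteq> V"
  shows "card (dominated V E (P \<inter> B)) \<le> card (dominated V E (A \<inter> B)) + card (P \<inter> B) * m"
proof -
  have fP: "finite (P \<inter> B)" using finite_parts by simp
  have *: "x \<in> dominated V E (A \<inter> B)" if "x \<in> dominated V E A" "x \<in> B" for x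
  proof -
    have "x \<in> dominated V E (A \<inter> B) \<or> x \<in> \<Union>\<Q> \<or> x \<in> I"
      using that(1) unfolding dominated_parts[OF assms(3)] hit_def by blast
    then show ?thesis using that(2) disj by blast
  qed
  have "dominated V E (P \<inter> B) \<subseteq> dominated V E (A \<inter> B) \<union> (\<Union>v\<in>P \<inter> B. dominated V E {v} - dominated V E A)"
  proof
    fix x assume "x \<in> dominated V E (P \<inter> B)"
    then obtain v where v: "v \<in> P \<inter> B" "x \<in> dominated V E {v}"
      using dominated_UN[of V E "P \<inter> B"] by blast
    then have "x \<in> B" using nb_B[of v] by blast
    with v *[of x] show "x \<in> dominated V E (A \<inter> B) \<union> (\<Union>v\<in>P \<inter> B. dominated V E {v} - dominated V E A)"
      by blast
  qed
  then have "card (dominated V E (P \<inter> B)) \<le>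
      card (dominated V E (A \<inter> B) \<union> (\<Union>v\<in>P \<inter> B. dominated V E {v} - dominated V E A))"
    using fP finite_dominated[OF fin] by (intro card_mono) auto
  also have "\<dots> \<le> card (dominated V E (A \<inter> B)) + card (\<Union>v\<in>P \<inter> B. dominated V E {v} - dominated V E A)"
    by (rule card_Un_le)
  also have "card (\<Union>v\<in>P \<inter> B. dominated V E {v} - dominated V E A) \<le> (\<Sum>v\<in>P \<inter> B. gain V E A v)"
    unfolding gain_def by (rule card_UN_le[OF fP])
  also have "\<dots> \<le> card (P \<inter> B) * m"
    using sum_bounded_above[of "P \<inter> B" "gain V E A" m] assms by (simp add: subset_iff)
  finally show ?thesis by simp
qed

text \<open>Only steps in \<open>B\<close> count in the exponent of the decay, so steps in small
  components do not disturb it. The third clause starts after \<open>q\<close> steps in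
  \<open>B\<close>: while some pair is unhit, each surplus step gains at least 2 and thus adds a net
  1. The last two clauses record how small the gains are once greedy has turned to pairs or to
  isolated vertices. For \<open>q = 0\<close> the quotient is 0 in HOL, and \<open>d\<close> is then
  0 in all uses.\<close>

definition greedy_inv :: "nat \<Rightarrow> nat \<Rightarrow> 'a set \<Rightarrow> bool" where
  "greedy_inv d q A \<longleftrightarrow>
     card A = card (A \<inter> B) + card (hit A) + card (A \<inter> I) \<and>
     real d - card (dominated V E (A \<inter> B)) \<le> d * (1 - 1 / real q) ^ card (A \<inter> B) \<and>
     (q \<le> card (A \<inter> B) \<longrightarrow> real (card (dominated V E (A \<inter> B))) - card (A \<inter> B) \<ge>
        (1 - exp (- 1)) * d - q + (if card (hit A) < card \<Q> then real (card (A \<inter> B)) - q else 0)) \<and>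
     (hit A \<noteq> {} \<longrightarrow> (\<forall>w\<in>V. gain V E A w \<le> 2)) \<and>
     (A \<inter> I \<noteq> {} \<longrightarrow> (\<forall>w\<in>V. gain V E A w \<le> 1))"

lemma greedy_inv_step_B:
  assumes "greedy_inv d q A" "A \<subseteq> V" "finite A" "v \<in> B" "v \<notin> A" "\<And>w. w \<in> V \<Longrightarrow> gain V E A w \<le> gain V E A v"
    "gain V E A v \<ge> 1" and P: "P \<subseteq> V" "q = card (P \<inter> B)" "d = card (dominated V E (P \<inter> B))"
  shows "greedy_inv d q (insert v A)"
proof -
  let ?A = "insert v A" and ?r = "1 - 1 / real q"
  let ?b = "card (A \<inter> B)" and ?g = "card (dominated V E (A \<inter> B))" and ?G = "gain V E A v"
  note inv = assms(1)[unfolded greedy_inv_def]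
  have vV: "v \<in> V" using assms(4) V_eq by blast
  have vI: "v \<notin> I" "v \<notin> \<Union>\<Q>" using assms(4) disj by auto
  have hit: "hit ?A = hit A" using vI unfolding hit_def by blast
  have I: "?A \<inter> I = A \<inter> I" using vI by blast
  have b: "card (?A \<inter> B) = ?b + 1" using assms(3-5) by (simp add: Int_insert_left)
  have "dom_count V E ?A = dom_count V E A + ?G"
    by (rule dom_count_insert[OF fin])
  then have g: "card (dominated V E (?A \<inter> B)) = ?g + ?G"
    using dom_count_parts[of ?A] dom_count_parts[of A] assms(2) vV hit I by simp
  \<comment> \<open>The \<open>q\<close> vertices of \<open>P\<close> in \<open>B\<close> together
    add at most \<open>q\<close> times the best gain, so this gain is at least the fraction 1/q of
    the missing coverage.\<close>
  have "d \<le> ?g + q * ?G"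
    using gain_average[OF assms(6) P(1) assms(2)] P(2,3) by simp
  then have avg: "real d - ?g \<le> q * real ?G"
    by (simp flip: of_nat_mult of_nat_add)
  have ii: "real d - (?g + ?G) \<le> d * ?r ^ (?b + 1)"
  proof (cases "q = 0")
    case True
    then have "P \<inter> B = {}" using P(2) finite_parts(1) by simp
    then have "d = 0" using P(3) by simp
    then show ?thesis by simp
  next
    case False
    have "real d - (?g + ?G) \<le> (real d - ?g) * ?r"
      using avg False by (simp add: field_simps)
    also have "\<dots> \<le> (d * ?r ^ ?b) * ?r"
      using inv False by (intro mult_right_mono) auto
    finally show ?thesis by (simp add: mult.assoc power_Suc2[symmetric] del: power_Suc)
  qed
  have iii: "real (?g + ?G) - (?b + 1) \<ge> (1 - exp (- 1)) * d - q +
      (if card (hit A) < card \<Q> then real (?b + 1) - q else 0)" if q: "q \<le> ?b + 1"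
  proof (cases "q \<le> ?b")
    case True
    have "2 \<le> ?G" if "card (hit A) < card \<Q>"
    proof -
      from that have "hit A \<noteq> \<Q>" by auto
      then obtain Q where "Q \<in> \<Q>" "Q \<notin> hit A" unfolding hit_def by blast
      then obtain w where "w \<in> V" "gain V E A w = 2" using gain_untouched_pair[OF assms(2)] by blast
      with assms(6)[of w] show ?thesis by simp
    qed
    then show ?thesis using inv True assms(7) by (auto split: if_splits)
  next
    case False
    \<comment> \<open>This is the \<open>q\<close>-th step in \<open>B\<close>: the geometric decay
      is evaluated here, once, and becomes 1/e, while the surplus term is 0.\<close>
    then have q: "q = ?b + 1" using q by simp
    have "d * ?r ^ (?b + 1) \<le> d * exp (- 1)"
      using one_minus_inverse_power_le[of q] q by (intro mult_left_mono) auto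
    with ii have "real d - (?g + ?G) \<le> d * exp (- 1)" by linarith
    then show ?thesis using q by (simp add: algebra_simps)
  qed
  have mono: "gain V E ?A w \<le> gain V E A w" for w
    using gain_antimono[OF fin, of A ?A] by blast
  have gA: "\<forall>w\<in>V. gain V E ?A w \<le> m" if "\<forall>w\<in>V. gain V E A w \<le> m" for m
    using that mono le_trans by blast
  show ?thesis
    unfolding greedy_inv_def hit I b g
  proof (intro conjI impI)
    show "card ?A = ?b + 1 + card (hit A) + card (A \<inter> I)" using inv assms(3,5) by simp
    show "real d - real (?g + ?G) \<le> real d * ?r ^ (?b + 1)" using ii by simp
    show "(1 - exp (- 1)) * real d - real q + (if card (hit A) < card \<Q> then real (?b + 1) - real q else 0)
        \<le> real (?g + ?G) - real (?b + 1)" if "q \<le> ?b + 1"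
      using iii[OF that] by simp
  qed (use inv gA in blast)+
qed

text \<open>Positive gain forces a pair that was not yet hit, and the size of the pair bounds this
  gain, hence by maximality every gain, by 2. When the last pair is hit, the nonnegative surplus
  term of the third clause is dropped.\<close>

lemma greedy_inv_step_\<Q>:
  assumes "greedy_inv d q A" "A \<subseteq> V" "finite A" "Q \<in> \<Q>" "v \<in> Q" "v \<notin> A"
    "\<And>w. w \<in> V \<Longrightarrow> gain V E A w \<le> gain V E A v" "gain V E A v \<ge> 1"
  shows "greedy_inv d q (insert v A)"
proof -
  let ?A = "insert v A"
  note inv = assms(1)[unfolded greedy_inv_def]
  have v: "v \<notin> I" "v \<notin> B" using assms(4,5) disj by auto
  have "Q \<notin> hit A"
  proof
    assume "Q \<in> hit A"
    then have "Q \<subseteq> dominated V E A" using dominated_parts[OF assms(2)] by blast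
    then show False using assms(8) unfolding gain_def nb_\<Q>[OF assms(4,5)]
      by (simp add: Diff_eq_empty_iff[THEN iffD2])
  qed
  moreover have "hit ?A = insert Q (hit A)"
    using assms(4,5) \<Q>_disj unfolding hit_def by blast
  ultimately have c: "card (hit ?A) = card (hit A) + 1" and ne: "hit ?A \<noteq> {}"
    using finite_hit by auto
  have le2: "gain V E A w \<le> 2" if "w \<in> V" for w
  proof -
    have "gain V E A v \<le> card Q" unfolding gain_def nb_\<Q>[OF assms(4,5)]
      using card_\<Q>[OF assms(4)] by (intro card_mono) (auto simp: card_ge_0_finite)
    then show ?thesis using assms(7)[OF that] card_\<Q>[OF assms(4)] by simp
  qed
  have I: "?A \<inter> I = A \<inter> I" "?A \<inter> B = A \<inter> B" using v by auto
  have mono: "gain V E ?A w \<le> gain V E A w" for w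
    using gain_antimono[OF fin, of A ?A] by blast
  have gA: "\<forall>w\<in>V. gain V E ?A w \<le> m" if "\<forall>w\<in>V. gain V E A w \<le> m" for m
    using that mono le_trans by blast
  show ?thesis
    unfolding greedy_inv_def I c
  proof (intro conjI impI)
    show "card ?A = card (A \<inter> B) + (card (hit A) + 1) + card (A \<inter> I)" using inv assms(3,6) by simp
    show "(1 - exp (- 1)) * real d - real q +
        (if card (hit A) + 1 < card \<Q> then real (card (A \<inter> B)) - real q else 0)
        \<le> real (card (dominated V E (A \<inter> B))) - real (card (A \<inter> B))" if "q \<le> card (A \<inter> B)"
      using inv that by (simp split: if_splits)
  qed (use inv gA le2 in blast)+
qed

lemma greedy_inv_step_I:
  assumes "greedy_inv d q A" "A \<subseteq> V" "finite A" "v \<in> I" "v \<notin> A"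
    "\<And>w. w \<in> V \<Longrightarrow> gain V E A w \<le> gain V E A v"
  shows "greedy_inv d q (insert v A)"
proof -
  let ?A = "insert v A"
  note inv = assms(1)[unfolded greedy_inv_def]
  have v: "v \<notin> \<Union>\<Q>" "v \<notin> B" using assms(4) disj by auto
  have hit: "hit ?A = hit A" using v unfolding hit_def by blast
  have B: "?A \<inter> B = A \<inter> B" using v by auto
  have c: "card (?A \<inter> I) = card (A \<inter> I) + 1" using assms(3-5) by (simp add: Int_insert_left)
  have "gain V E A v \<le> card {v}" unfolding gain_def nb_I[OF assms(4)] by (intro card_mono) auto
  then have le1: "gain V E A w \<le> 1" if "w \<in> V" for w
    using assms(6)[OF that] by simp
  have mono: "gain V E ?A w \<le> gain V E A w" for w
    using gain_antimono[OF fin, of A ?A] by blast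
  have gA: "\<forall>w\<in>V. gain V E ?A w \<le> m" if "\<forall>w\<in>V. gain V E A w \<le> m" for m
    using that mono le_trans by blast
  show ?thesis
    unfolding greedy_inv_def B c hit
  proof (intro conjI impI)
    show "card ?A = card (A \<inter> B) + card (hit A) + (card (A \<inter> I) + 1)" using inv assms(3,5) by simp
  qed (use inv gA le1 in blast)+
qed

text \<open>Full domination is the escape clause: afterwards all gains are 0 and steps may be
  wasted, so the cardinality clause of \<open>greedy_inv\<close> can fail.\<close>

lemma greedy_inv_run:
  assumes "greedy V E better p A" "P \<subseteq> V" "q = card (P \<inter> B)" "d = card (dominated V E (P \<inter> B))"
  shows "dominated V E A = V \<or> greedy_inv d q A"
  using assms(1) fin
proof (induction rule: greedy_induct)
  case empty
  have "d = 0" if "q = 0"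
  proof -
    have "P \<inter> B = {}" using that assms(3) finite_parts(1) by simp
    then show ?thesis using assms(4) by simp
  qed
  then show ?case by (auto simp: greedy_inv_def hit_def)
next
  case (step A v)
  show ?case
  proof (cases "dominated V E A = V \<or> gain V E A v = 0")
    case True
    then have "dominated V E A = V"
      using gain_0_imp_all[OF fin, of E A] step.hyps(5) by (metis le_zero_eq)
    then have "dominated V E (insert v A) = V"
      using dominated_insert[of V E v A] dominated_subset[of V E "{v}"] by auto
    then show ?thesis ..
  next
    case False
    then have inv: "greedy_inv d q A" and g: "gain V E A v \<ge> 1" using step.IH by auto
    consider "v \<in> B" | Q where "Q \<in> \<Q>" "v \<in> Q" | "v \<in> I" using step.hyps(3) V_eq by blast
    then have "greedy_inv d q (insert v A)"
    proof cases
      case 1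
      show ?thesis by (rule greedy_inv_step_B[OF inv step.hyps(1,2) 1 step.hyps(4,5) g assms(2-4)])
    next
      case (2 Q)
      show ?thesis by (rule greedy_inv_step_\<Q>[OF inv step.hyps(1,2) 2 step.hyps(4,5) g])
    next
      case 3
      show ?thesis by (rule greedy_inv_step_I[OF inv step.hyps(1,2) 3 step.hyps(4,5)])
    qed
    then show ?thesis ..
  qed
qed

text \<open>If the run has picked fewer than \<open>q\<close> vertices in \<open>B\<close>, then it spent the difference on small
  components, which have gain at most \<open>m \<le> 2\<close>; Bernoulli's inequality compares this with what
  \<open>q - b\<close> further steps in \<open>B\<close> could have contributed.\<close>

lemma greedy_ext_ge:
  assumes "greedy V E better p A" "P \<subseteq> V" "card P = p"
    and q: "q = card (P \<inter> B)" and d: "d = card (dominated V E (P \<inter> B))" and j: "j = card (hit P)"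
  shows "dominated V E A = V \<or> real_of_int (ext V E A) \<ge> (1 - exp (- 1)) * d - q + j"
proof (cases "dominated V E A = V")
  case False
  let ?b = "card (A \<inter> B)" and ?g = "card (dominated V E (A \<inter> B))" and ?s = "card (hit A)"
  let ?r = "1 - 1 / real q"
  from greedy_inv_run[OF assms(1,2) q d] False have inv: "greedy_inv d q A" by simp
  note inv = inv[unfolded greedy_inv_def]
  have A: "A \<subseteq> V" "card A = p" using greedy_subset_card[OF assms(1)] by auto
  have ext: "real_of_int (ext V E A) = real ?g - ?b + ?s"
    unfolding ext_def dom_count_parts[OF A(1)] using inv by simp
  have pq: "q + j \<le> p" using card_ge_parts[OF assms(2)] assms(3) q j by simp
  have j\<Q>: "j \<le> card \<Q>" unfolding j hit_def by (rule card_mono) (use finite_parts in auto)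
  have s\<Q>: "?s \<le> card \<Q>" unfolding hit_def by (rule card_mono) (use finite_parts in auto)
  \<comment> \<open>Once an isolated vertex is chosen, all gains are at most 1, which excludes an
    unhit pair.\<close>
  have full: "?s = card \<Q>" if "A \<inter> I \<noteq> {}"
  proof (rule ccontr)
    assume "?s \<noteq> card \<Q>"
    then have "hit A \<noteq> \<Q>" by auto
    then obtain Q where "Q \<in> \<Q>" "Q \<notin> hit A" unfolding hit_def by blast
    then obtain w where "w \<in> V" "gain V E A w = 2" using gain_untouched_pair[OF A(1)] by blast
    then show False using inv that by fastforce
  qed
  have I0: "card (A \<inter> I) = 0" if "A \<inter> I = {}" using that by simp
  have "(1 - exp (- 1)) * d - q + j \<le> real ?g - ?b + ?s"
  proof (cases "q \<le> ?b")
    case True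
    show ?thesis
    proof (cases "j \<le> ?s")
      case True
      then show ?thesis using inv \<open>q \<le> ?b\<close> by (auto split: if_splits)
    next
      case False
      then have "?s < card \<Q>" using j\<Q> by simp
      then have "A \<inter> I = {}" using full by auto
      then have "?b + ?s = p" using inv A I0 by simp
      \<comment> \<open>Pairs that greedy hits less often than \<open>P\<close> are paid for by
        surplus steps in \<open>B\<close>: none of the \<open>p\<close> steps went to
        \<open>I\<close>, and \<open>q + j \<le> p\<close>.\<close>
      then have "real ?b - q \<ge> real j - ?s" using pq by simp
      then show ?thesis using inv \<open>q \<le> ?b\<close> \<open>?s < card \<Q>\<close> by auto
    qed
  next
    case False
    define k where "k = q - ?b"
    have k: "k > 0" "q = ?b + k" using False by (auto simp: k_def)
    \<comment> \<open>If no isolated vertex was chosen, the pairs absorbed at least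
      \<open>k + j\<close> steps and \<open>m = 2\<close> works. Otherwise all pairs are hit, so
      \<open>j \<le> card (hit A)\<close>, and \<open>m = 1\<close> works.\<close>
    have "\<exists>m. (\<forall>w\<in>V. gain V E A w \<le> m) \<and> m * k + j \<le> k + ?s"
    proof (cases "A \<inter> I = {}")
      case True
      then have "?b + ?s = p" using inv A I0 by simp
      then have s: "?s \<ge> k + j" using pq k by simp
      then have "hit A \<noteq> {}" using k by auto
      then show ?thesis using inv s by (intro exI[of _ 2]) auto
    next
      case False
      then show ?thesis using inv full j\<Q> by (intro exI[of _ 1]) auto
    qed
    then obtain m where m: "\<And>w. w \<in> V \<Longrightarrow> gain V E A w \<le> m" "m * k + j \<le> k + ?s" by blast
    let ?\<delta> = "real d - ?g"
    have "d \<le> ?g + q * m" using gain_average[OF m(1) assms(2) A(1)] q d by simp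
    then have \<delta>: "?\<delta> \<le> q * real m" by (simp flip: of_nat_mult of_nat_add)
    \<comment> \<open>The deficit is split into its product with the \<open>k\<close>-th power of
      \<open>1 - 1/q\<close>, which completes the decay to exponent \<open>q\<close>, and the rest,
      which is at most \<open>k/q\<close> times the deficit and hence at most
      \<open>m * k\<close>.\<close>
    have "?\<delta> \<le> d * exp (- 1) + m * k"
    proof (cases "?\<delta> \<le> 0")
      case True
      then show ?thesis by (meson add_nonneg_nonneg exp_ge_zero mult_nonneg_nonneg of_nat_0_le_iff order_trans)
    next
      case False
      have r: "0 \<le> ?r" using k by simp
      have "?\<delta> * ?r ^ k \<le> (d * ?r ^ ?b) * ?r ^ k"
        using inv r by (intro mult_right_mono) auto
      also have "\<dots> = d * ?r ^ q" using k(2) by (simp add: power_add)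
      also have "\<dots> \<le> d * exp (- 1)"
        using one_minus_inverse_power_le[of q] k by (intro mult_left_mono) auto
      finally have 1: "?\<delta> * ?r ^ k \<le> d * exp (- 1)" .
      have "1 + real k * (- (1 / real q)) \<le> (1 + (- (1 / real q))) ^ k"
        using k by (intro Bernoulli_inequality) auto
      then have "1 - ?r ^ k \<le> k / real q" by simp
      then have "?\<delta> * (1 - ?r ^ k) \<le> ?\<delta> * (k / real q)"
        using False by (intro mult_left_mono) auto
      also have "\<dots> \<le> (q * real m) * (k / real q)"
        using \<delta> by (intro mult_right_mono) auto
      also have "\<dots> = m * k" using k by simp
      finally show ?thesis using 1 by (simp add: algebra_simps)
    qed
    moreover have "real (m * k) + j \<le> k + ?s" using m(2) by linarith
    ultimately show ?thesis using k(2) by (simp add: algebra_simps)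
  qed
  then show ?thesis using ext by simp
qed simp

end

subsection \<open>Greedy on the decomposition\<close>

lemma card_in_S:
  assumes "in_S a b u w X E"
  shows "card X = 1 + a + 2 * b"
proof -
  have "card X = card (u ` {0..a+b}) + card (w ` {1..b})"
    using assms unfolding in_S_def by (auto intro: card_Un_disjoint)
  then show ?thesis using assms unfolding in_S_def by (simp add: card_image)
qed

text \<open>Isolates what the greedy analysis takes from the decomposition, so that rooted trees do
  not appear in it.\<close>

locale pieces =
  fixes V :: "'a set" and \<P> :: "'a set set" and F H :: "'a set set" and c :: "'a set \<Rightarrow> 'a"
  assumes fin: "finite V"
    and Union_\<P>: "\<Union>\<P> = V"
    and \<P>_disj: "\<And>X Y x. \<lbrakk> X \<in> \<P>; Y \<in> \<P>; x \<in> X; x \<in> Y \<rbrakk> \<Longrightarrow> X = Y"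
    and H_eq: "H = (\<Union>X\<in>\<P>. induced_edges F X)"
    and center: "\<And>X. X \<in> \<P> \<Longrightarrow> is_center X (induced_edges F X) (c X)"
begin

abbreviation nb :: "'a \<Rightarrow> 'a set" where
  "nb x \<equiv> dominated V H {x}"

lemma finite_\<P>: "finite \<P>" "X \<in> \<P> \<Longrightarrow> finite X" "X \<in> \<P> \<Longrightarrow> X \<subseteq> V"
proof -
  show "finite \<P>" using fin Union_\<P> finite_UnionD by auto
  show "X \<subseteq> V" if "X \<in> \<P>" using that Union_\<P> by blast
  then show "finite X" if "X \<in> \<P>" using that fin finite_subset by blast
qed

lemma finite_nb: "finite (nb x)"
  by (rule finite_dominated[OF fin])

lemma H_edge:
  assumes "X \<in> \<P>" "x \<in> X" "{x, y} \<in> H"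
  shows "{x, y} \<in> induced_edges F X" "y \<in> X"
proof -
  obtain Y where Y: "Y \<in> \<P>" "{x, y} \<in> induced_edges F Y" using assms(3) H_eq by blast
  then have "x \<in> Y" "y \<in> Y" unfolding induced_edges_def by auto
  then have "Y = X" using \<P>_disj[OF Y(1) assms(1)] assms(2) by blast
  then show "{x, y} \<in> induced_edges F X" "y \<in> X" using Y \<open>y \<in> Y\<close> by auto
qed

lemma mem_nb:
  assumes "X \<in> \<P>" "x \<in> X"
  shows "y \<in> nb x \<longleftrightarrow> y = x \<or> {x, y} \<in> induced_edges F X"
proof -
  have "{x, y} \<in> induced_edges F X \<Longrightarrow> {x, y} \<in> H" using H_eq assms(1) by blast
  moreover have "{x, y} \<in> induced_edges F X \<Longrightarrow> y \<in> V"
    using finite_\<P>(3)[OF assms(1)] unfolding induced_edges_def by auto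
  moreover have "x \<in> V" using finite_\<P>(3)[OF assms(1)] assms(2) by blast
  moreover have "{y, x} = {x, y}" by (rule insert_commute)
  ultimately show ?thesis
    using H_edge(1)[OF assms] unfolding dominated_def by auto
qed

lemma nb_subset: "X \<in> \<P> \<Longrightarrow> x \<in> X \<Longrightarrow> nb x \<subseteq> X"
  using mem_nb unfolding induced_edges_def by fastforce

lemma dominated_piece:
  assumes "X \<in> \<P>" "A \<subseteq> V"
  shows "dominated V H A \<inter> X = dominated V H (A \<inter> X)"
proof
  show "dominated V H A \<inter> X \<subseteq> dominated V H (A \<inter> X)"
  proof
    fix y assume y: "y \<in> dominated V H A \<inter> X"
    then obtain x where x: "x \<in> A" "y \<in> nb x" using dominated_UN[of V H A] by blast
    then obtain Y where Y: "Y \<in> \<P>" "x \<in> Y" using assms(2) Union_\<P> by blast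
    then have "y \<in> Y" using nb_subset[OF Y] x by blast
    then have "Y = X" using \<P>_disj[OF Y(1) assms(1)] y by blast
    then show "y \<in> dominated V H (A \<inter> X)" using x Y dominated_UN[of V H "A \<inter> X"] by blast
  qed
  have "dominated V H (A \<inter> X) \<subseteq> X"
    using nb_subset[OF assms(1)] dominated_UN[of V H "A \<inter> X"] by blast
  moreover have "dominated V H (A \<inter> X) \<subseteq> dominated V H A"
    by (rule dominated_mono) auto
  ultimately show "dominated V H (A \<inter> X) \<subseteq> dominated V H A \<inter> X" by blast
qed

text \<open>Edges of \<open>H\<close> stay inside pieces, so for \<open>X \<in> \<P>\<close> and
  \<open>A \<subseteq> V\<close> this counts the vertices of \<open>X\<close> dominated by
  \<open>A\<close>. Its sum over the pieces is \<open>dom_count\<close>.\<close>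

definition dX :: "'a set \<Rightarrow> 'a set \<Rightarrow> nat" where
  "dX A X = card (dominated V H (A \<inter> X))"

lemma card_sum_pieces:
  assumes "A \<subseteq> V"
  shows "card A = (\<Sum>X\<in>\<P>. card (A \<inter> X))"
proof -
  have "A = (\<Union>X\<in>\<P>. A \<inter> X)" using assms Union_\<P> by blast
  then have "card A = card (\<Union>X\<in>\<P>. A \<inter> X)" by simp
  also have "\<dots> = (\<Sum>X\<in>\<P>. card (A \<inter> X))"
  proof (rule card_UN_disjoint)
    show "finite \<P>" by (rule finite_\<P>)
    show "\<forall>X\<in>\<P>. finite (A \<inter> X)" using finite_\<P>(2) by blast
    show "\<forall>X\<in>\<P>. \<forall>Y\<in>\<P>. X \<noteq> Y \<longrightarrow> A \<inter> X \<inter> (A \<inter> Y) = {}" using \<P>_disj by blast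
  qed
  finally show ?thesis .
qed

lemma dom_count_sum_pieces:
  assumes "A \<subseteq> V"
  shows "dom_count V H A = (\<Sum>X\<in>\<P>. dX A X)"
proof -
  have "card (dominated V H A) = (\<Sum>X\<in>\<P>. card (dominated V H A \<inter> X))"
    by (rule card_sum_pieces[OF dominated_subset])
  also have "\<dots> = (\<Sum>X\<in>\<P>. dX A X)"
    unfolding dX_def using dominated_piece[OF _ assms] by (intro sum.cong) auto
  finally show ?thesis unfolding dom_count_def .
qed

lemma gain_piece:
  assumes "X \<in> \<P>" "A \<subseteq> V" "v \<in> X"
  shows "gain V H A v = card (nb v - dominated V H (A \<inter> X))"
proof -
  have "nb v - dominated V H A = nb v - dominated V H A \<inter> X"
    using nb_subset[OF assms(1,3)] by blast
  then show ?thesis unfolding gain_def dominated_piece[OF assms(1,2)] by simp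
qed

lemma gain_untouched:
  "X \<in> \<P> \<Longrightarrow> A \<subseteq> V \<Longrightarrow> v \<in> X \<Longrightarrow> A \<inter> X = {} \<Longrightarrow> gain V H A v = card (nb v)"
  by (simp add: gain_piece)

lemma dX_insert:
  assumes "X \<in> \<P>" "A \<subseteq> V" "v \<in> X"
  shows "dX (insert v A) X = dX A X + gain V H A v"
proof -
  have "insert v A \<inter> X = insert v (A \<inter> X)" using assms(3) by blast
  then have "dX (insert v A) X = dom_count V H (insert v (A \<inter> X))"
    unfolding dX_def dom_count_def by simp
  also have "\<dots> = dom_count V H (A \<inter> X) + gain V H (A \<inter> X) v"
    by (rule dom_count_insert[OF fin])
  also have "dom_count V H (A \<inter> X) = dX A X"
    unfolding dX_def dom_count_def ..
  also have "gain V H (A \<inter> X) v = gain V H A v"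
    unfolding gain_piece[OF assms] unfolding gain_def ..
  finally show ?thesis .
qed

lemma nb_in_S:
  assumes "X \<in> \<P>" "in_S a b u w X (induced_edges F X)"
  shows "a + b + 1 \<le> card (nb (u 0))"
    and "j \<in> {1..b} \<Longrightarrow> {u 0, u (a + j), w j} \<subseteq> nb (u (a + j))"
    and "j \<in> {1..b} \<Longrightarrow> 3 \<le> card (nb (u (a + j)))"
proof -
  note S = assms(2)[unfolded in_S_def]
  have ed1: "{u 0, u i} \<in> induced_edges F X" if "1 \<le> i" "i \<le> a + b" for i
    using S that by blast
  have ed2: "{u (a + i), w i} \<in> induced_edges F X" if "1 \<le> i" "i \<le> b" for i
    using S that by blast
  have uX: "u i \<in> X" if "i \<le> a + b" for i using S that by auto
  have "u i \<in> nb (u 0)" if "i \<le> a + b" for i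
    using mem_nb[OF assms(1) uX[of 0]] ed1[of i] that by (cases "i = 0") auto
  then have "u ` {0..a+b} \<subseteq> nb (u 0)" by auto
  then have "card (u ` {0..a+b}) \<le> card (nb (u 0))" by (rule card_mono[OF finite_nb])
  then show "a + b + 1 \<le> card (nb (u 0))" using S by (simp add: card_image)
  show sub: "{u 0, u (a + j), w j} \<subseteq> nb (u (a + j))" if j: "j \<in> {1..b}"
    using mem_nb[OF assms(1) uX[of "a + j"]] ed1[of "a + j"] ed2[of j] j by (auto simp: insert_commute)
  show "3 \<le> card (nb (u (a + j)))" if j: "j \<in> {1..b}"
  proof -
    have iu: "inj_on u {0..a+b}" using S by blast
    have "u 0 \<noteq> u (a + j)" using j by (simp add: inj_on_eq_iff[OF iu])
    moreover have ne: "w j \<noteq> u i" if "i \<le> a + b" for i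
    proof -
      have "w j \<in> w ` {1..b}" "u i \<in> u ` {0..a+b}" using j that by auto
      then show ?thesis using S by (metis disjoint_iff)
    qed
    moreover have "u 0 \<noteq> w j" "u (a + j) \<noteq> w j"
      using ne[of 0] ne[of "a + j"] j by (force, force)
    ultimately have "card {u 0, u (a + j), w j} = 3" by simp
    then show ?thesis using card_mono[OF finite_nb sub[OF j]] by simp
  qed
qed

text \<open>The witness is the middle \<open>u 0\<close> of a star, and otherwise the vertex between
  \<open>u 0\<close> and the leaf \<open>w 1\<close>. An untouched piece with at least three
  vertices thus offers gain 3, so once the best gain drops below 3 all such pieces have been
  touched.\<close>

lemma big_piece_gain:
  assumes "X \<in> \<P>" "3 \<le> card X"
  obtains x where "x \<in> X" "3 \<le> card (nb x)"
proof -
  obtain a b u w where S: "in_S a b u w X (induced_edges F X)"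
    using center[OF assms(1)] unfolding is_center_def by blast
  have u: "u i \<in> X" if "i \<le> a + b" for i using S that unfolding in_S_def by auto
  show thesis
  proof (cases "b = 0")
    case True
    then show thesis
      using that[of "u 0"] u nb_in_S(1)[OF assms(1) S] card_in_S[OF S] assms(2) by simp
  next
    case False
    then show thesis
      using that[of "u (a + 1)"] u[of "a + 1"] nb_in_S(3)[OF assms(1) S, of 1] by simp
  qed
qed

text \<open>The middle of a five-vertex path dominates three vertices as well, but leaves only gains
  of 1. A neighbour of the middle keeps a vertex of gain 2 available, which is the reason for the
  special center of \<open>S_{0,2}\<close>.\<close>

lemma path5_center:
  assumes "X \<in> \<P>" "in_S 0 2 u w X (induced_edges F X)" "y \<in> {u 1, u 2}"
  shows "card (nb y) = 3" "\<exists>z\<in>X. 2 \<le> card (nb z - nb y)"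
proof -
  note S = assms(2)[unfolded in_S_def]
  have iu: "inj_on u {0..2}" and iw: "inj_on w {1..2}" and d: "u ` {0..2} \<inter> w ` {1..2} = {}"
    using S unfolding add_0 by blast+
  have du: "u 0 \<noteq> u 1" "u 0 \<noteq> u 2" "u 1 \<noteq> u 2" by (simp_all add: inj_on_eq_iff[OF iu])
  have dw: "w 1 \<noteq> w 2" by (simp add: inj_on_eq_iff[OF iw])
  have duw': "w i \<noteq> u j" if "i \<in> {1..2}" "j \<in> {0..2}" for i j
    using d imageI[OF that(1), of w] imageI[OF that(2), of u] by auto
  have duw: "w 1 \<noteq> u 0" "w 1 \<noteq> u 1" "w 1 \<noteq> u 2" "w 2 \<noteq> u 0" "w 2 \<noteq> u 1" "w 2 \<noteq> u 2"
    by (simp_all add: duw')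
  note dist = du dw duw du[symmetric] dw[symmetric] duw[symmetric]
  have two: "{f j |j. 1 \<le> j \<and> j \<le> (2::nat)} = {f 1, f 2}" for f :: "nat \<Rightarrow> 'a set"
  proof -
    have "1 \<le> j \<and> j \<le> (2::nat) \<longleftrightarrow> j = 1 \<or> j = 2" for j by auto
    then show ?thesis by auto
  qed
  have E: "induced_edges F X = {{u 0, u 1}, {u 0, u 2}, {u 1, w 1}, {u 2, w 2}}"
  proof -
    have "induced_edges F X = {{u 0, u j} |j. 1 \<le> j \<and> j \<le> 2} \<union> {{u j, w j} |j. 1 \<le> j \<and> j \<le> 2}"
      using S unfolding add_0 by blast
    then show ?thesis unfolding two by (simp only: Un_insert_left Un_empty_left)
  qed
  have X: "u 1 \<in> X" "u 2 \<in> X" using S by auto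
  have n1: "nb (u 1) = {u 0, u 1, w 1}"
    unfolding set_eq_iff mem_nb[OF assms(1) X(1)] E using dist by (auto simp: doubleton_eq_iff)
  have n2: "nb (u 2) = {u 0, u 2, w 2}"
    unfolding set_eq_iff mem_nb[OF assms(1) X(2)] E using dist by (auto simp: doubleton_eq_iff)
  have "nb (u 2) - nb (u 1) = {u 2, w 2}" "nb (u 1) - nb (u 2) = {u 1, w 1}"
    unfolding n1 n2 using dist by auto
  then have cd: "card (nb (u 2) - nb (u 1)) = 2" "card (nb (u 1) - nb (u 2)) = 2"
    using dist by auto
  have y: "y = u 1 \<or> y = u 2" using assms(3) by blast
  then show "\<exists>z\<in>X. 2 \<le> card (nb z - nb y)"
  proof
    assume "y = u 1"
    then show ?thesis using X(2) cd(1) by (intro bexI[of _ "u 2"]) simp_all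
  next
    assume "y = u 2"
    then show ?thesis using X(1) cd(2) by (intro bexI[of _ "u 1"]) simp_all
  qed
  show "card (nb y) = 3" using y n1 n2 dist by (elim disjE) simp_all
qed

text \<open>With \<open>card X = 1 + a + 2 * b\<close>, the pick dominates at least
  \<open>a + b + 1\<close> vertices, which settles all but two shapes. On \<open>S_{0,1}\<close>, a
  path with three vertices, the vertex \<open>u 1\<close> dominates all three. On
  \<open>S_{0,2}\<close> the first bound is tight and the second fails by one, 22 against 21, unless
  four vertices are dominated; there the tie rule makes the pick a center.\<close>

lemma first_pick:
  assumes "X \<in> \<P>" "3 \<le> card X" "v \<in> X" "\<And>x. x \<in> X \<Longrightarrow> card (nb x) \<le> card (nb v)"
    and tie: "card (nb (c X)) = card (nb v) \<Longrightarrow> v = c X"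
  shows "10 + card X \<le> 5 * card (nb v)"
    and "7 + 3 * card X \<le> 7 * card (nb v) \<or>
      card X = 5 \<and> card (nb v) = 3 \<and> (\<exists>z\<in>X. 2 \<le> card (nb z - nb v))"
proof -
  obtain a b u w where S: "in_S a b u w X (induced_edges F X)"
    and cX: "if a = 0 \<and> b = 2 then c X \<in> {u 1, u 2} else c X = u 0"
    using center[OF assms(1)] unfolding is_center_def by blast
  note cs = card_in_S[OF S]
  have u: "u i \<in> X" if "i \<le> a + b" for i using S that unfolding in_S_def by auto
  have ge: "a + b + 1 \<le> card (nb v)"
    using nb_in_S(1)[OF assms(1) S] assms(4)[OF u[of 0]] by simp
  have "10 + card X \<le> 5 * card (nb v) \<and> (7 + 3 * card X \<le> 7 * card (nb v) \<or>
      card X = 5 \<and> card (nb v) = 3 \<and> (\<exists>z\<in>X. 2 \<le> card (nb z - nb v)))"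
  proof (cases "a = 0 \<and> b = 2")
    case True
    then have S': "in_S 0 2 u w X (induced_edges F X)" and cu: "c X \<in> {u 1, u 2}" using S cX by auto
    have "c X \<in> X" using cu u True by auto
    then have le: "3 \<le> card (nb v)" using assms(4) path5_center(1)[OF assms(1) S' cu] by metis
    show ?thesis
    proof (cases "card (nb v) = 3")
      case True
      then have "v = c X" using tie path5_center(1)[OF assms(1) S' cu] by simp
      then show ?thesis using path5_center[OF assms(1) S' cu] cs \<open>a = 0 \<and> b = 2\<close> by auto
    next
      case False
      then show ?thesis using le cs \<open>a = 0 \<and> b = 2\<close> by simp
    qed
  next
    case False
    show ?thesis
    proof (cases "a = 0 \<and> b = 1")
      case True
      then have "3 \<le> card (nb v)"
        using nb_in_S(3)[OF assms(1) S, of 1] assms(4)[OF u[of 1]] by simp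
      then show ?thesis using cs True by simp
    next
      case ab: False
      have "a \<ge> 2 \<or> a = 1 \<and> b \<ge> 1 \<or> a = 0 \<and> b \<ge> 3"
        using False ab cs assms(2) by linarith
      then show ?thesis using ge cs by linarith
    qed
  qed
  then show "10 + card X \<le> 5 * card (nb v)"
    "7 + 3 * card X \<le> 7 * card (nb v) \<or>
      card X = 5 \<and> card (nb v) = 3 \<and> (\<exists>z\<in>X. 2 \<le> card (nb z - nb v))" by auto
qed

text \<open>With the coefficient 7, every further pick of positive gain preserves the inequality.
  The last alternative is a five-vertex path after its first pick, 7 + 15 against 21; it is
  tolerated as long as a second pick in the path can gain 2.\<close>

definition late_inv :: "'a set \<Rightarrow> 'a set \<Rightarrow> bool" where
  "late_inv A X \<longleftrightarrow> A \<inter> X = {} \<or> 7 * card (A \<inter> X) + 3 * card X \<le> 7 * dX A X \<or>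
     (card X = 5 \<and> dX A X = 3 \<and> card (A \<inter> X) = 1 \<and> (\<exists>z\<in>X. 2 \<le> gain V H A z))"

definition big :: "'a set \<Rightarrow> nat" where
  "big X = (if 3 \<le> card X then card X else 0)"

text \<open>A pick of gain 2 balances exactly, 10 against 5 * 2, so the inequality persists until
  the gains drop to 1.\<close>

definition early_inv :: "'a set \<Rightarrow> 'a set \<Rightarrow> bool" where
  "early_inv A X \<longleftrightarrow> A \<inter> X = {} \<or> 10 * card (A \<inter> X) + big X \<le> 5 * dX A X"

text \<open>The alternatives follow the size of the last gain. \<open>early_inv\<close> is carried
  along already while the gains are at least 3, because it becomes the decisive bound at gain 2,
  when every large piece has been touched.\<close>

definition phase_inv :: "'a set \<Rightarrow> bool" where
  "phase_inv A \<longleftrightarrow> (\<forall>X\<in>\<P>. 3 \<le> card X \<longrightarrow> late_inv A X) \<and>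
     ((3 * card A \<le> dom_count V H A \<and> (\<forall>X\<in>\<P>. early_inv A X)) \<or>
      ((\<forall>X\<in>\<P>. 3 \<le> card X \<longrightarrow> A \<inter> X \<noteq> {}) \<and> (\<forall>X\<in>\<P>. early_inv A X)) \<or>
      (\<forall>x\<in>V. gain V H A x \<le> 1))"

lemma dX_untouched: "A \<inter> X = {} \<Longrightarrow> dX A X = 0"
  unfolding dX_def by simp

lemma card_insert_Int:
  "finite A \<Longrightarrow> v \<notin> A \<Longrightarrow> v \<in> X \<Longrightarrow> card (insert v A \<inter> X) = card (A \<inter> X) + 1"
  by (simp add: Int_insert_left)

context
  fixes A :: "'a set" and v :: 'a and X :: "'a set"
  assumes A: "A \<subseteq> V" "finite A" and v: "v \<in> V" "v \<notin> A"
    and max: "\<And>x. x \<in> V \<Longrightarrow> gain V H A x \<le> gain V H A v"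
    and tie: "\<And>x. \<lbrakk> x \<in> V; x \<notin> A; gain V H A x = gain V H A v \<rbrakk> \<Longrightarrow>
        \<not> center_preference V H (c ` \<P>) A x v"
    and X: "X \<in> \<P>"
begin

text \<open>Here the tie-breaking enters. In an untouched piece no vertex is dominated, so the
  preference for non-dominated vertices cannot oppose the center, and a pick with the same gain as
  the center must be a center itself.\<close>

lemma untouched_pick:
  assumes "v \<in> X" "A \<inter> X = {}" "3 \<le> card X"
  shows "10 + card X \<le> 5 * card (nb v)"
    and "7 + 3 * card X \<le> 7 * card (nb v) \<or>
      card X = 5 \<and> card (nb v) = 3 \<and> (\<exists>z\<in>X. 2 \<le> card (nb z - nb v))"
proof -
  have g: "gain V H A x = card (nb x)" if "x \<in> X" for x
    using gain_untouched[OF X A(1) that assms(2)] .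
  have le: "card (nb x) \<le> card (nb v)" if "x \<in> X" for x
    using max[of x] g[OF that] g[OF assms(1)] that finite_\<P>(3)[OF X] by auto
  have cX: "c Y \<in> Y" if Y: "Y \<in> \<P>" for Y
    using center[OF Y] unfolding is_center_def in_S_def by (auto split: if_splits)
  have t: "v = c X" if eq: "card (nb (c X)) = card (nb v)"
  proof -
    have x: "c X \<in> V" "c X \<notin> A" using cX[OF X] assms(2) finite_\<P>(3)[OF X] by auto
    have und: "x \<notin> dominated V H A" if "x \<in> X" for x
    proof -
      have "dominated V H A \<inter> X = {}" using dominated_piece[OF X A(1)] assms(2) by simp
      then show ?thesis using that by blast
    qed
    have "gain V H A (c X) = gain V H A v" using g cX[OF X] assms(1) eq by simp
    from tie[OF x this] have "v \<in> c ` \<P>"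
      unfolding center_preference_def using und[OF cX[OF X]] und[OF assms(1)] X by blast
    then obtain Y where Y: "Y \<in> \<P>" "v = c Y" by blast
    then have "Y = X" using \<P>_disj[OF Y(1) X, of v] cX[OF Y(1)] assms(1) by simp
    then show ?thesis using Y by simp
  qed
  show "10 + card X \<le> 5 * card (nb v)" by (rule first_pick(1)[OF X assms(3,1) le t])
  show "7 + 3 * card X \<le> 7 * card (nb v) \<or>
      card X = 5 \<and> card (nb v) = 3 \<and> (\<exists>z\<in>X. 2 \<le> card (nb z - nb v))"
    by (rule first_pick(2)[OF X assms(3,1) le t])
qed

text \<open>A pick outside \<open>X\<close> changes nothing inside it. The second pick in an
  exceptional path has globally maximal gain, hence gain at least 2, and 14 + 15 is below 7 *
  5.\<close>

lemma late_inv_step: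
  assumes "late_inv A X" "3 \<le> card X" "1 \<le> gain V H A v"
  shows "late_inv (insert v A) X"
proof (cases "v \<in> X")
  case False
  have "insert v A \<inter> X = A \<inter> X" using False by blast
  moreover have "gain V H (insert v A) z = gain V H A z" if "z \<in> X" for z
    using gain_piece[OF X _ that] A v \<open>insert v A \<inter> X = A \<inter> X\<close> by simp
  ultimately show ?thesis using assms(1) unfolding late_inv_def dX_def by auto
next
  case True
  note ci = card_insert_Int[OF A(2) v(2) True] and di = dX_insert[OF X A(1) True]
  show ?thesis
  proof (cases "A \<inter> X = {}")
    case U: True
    have d: "dX (insert v A) X = card (nb v)"
      using di dX_untouched[OF U] gain_untouched[OF X A(1) True U] by simp
    have "insert v A \<inter> X = {v}" using U True by blast
    then have g: "gain V H (insert v A) z = card (nb z - nb v)" if "z \<in> X" for z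
      using gain_piece[OF X _ that, of "insert v A"] A v by simp
    show ?thesis
      using untouched_pick(2)[OF True U assms(2)] g d ci U unfolding late_inv_def by auto
  next
    case T: False
    then consider "7 * card (A \<inter> X) + 3 * card X \<le> 7 * dX A X"
      | z where "card X = 5" "dX A X = 3" "card (A \<inter> X) = 1" "z \<in> X" "2 \<le> gain V H A z"
      using assms(1) unfolding late_inv_def by blast
    then show ?thesis
    proof cases
      case 1
      then show ?thesis unfolding late_inv_def ci di using assms(3) by simp
    next
      case (2 z)
      then have "2 \<le> gain V H A v" using max[of z] finite_\<P>(3)[OF X] by fastforce
      then show ?thesis unfolding late_inv_def ci di using 2 by simp
    qed
  qed
qed

lemma early_inv_step:
  assumes "early_inv A X" "2 \<le> gain V H A v"
  shows "early_inv (insert v A) X"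
proof (cases "v \<in> X")
  case False
  then have "insert v A \<inter> X = A \<inter> X" by blast
  then show ?thesis using assms(1) unfolding early_inv_def dX_def by simp
next
  case True
  note ci = card_insert_Int[OF A(2) v(2) True] and di = dX_insert[OF X A(1) True]
  show ?thesis
  proof (cases "A \<inter> X = {}")
    case U: True
    have d: "dX (insert v A) X = card (nb v)" "card (nb v) = gain V H A v"
      using di dX_untouched[OF U] gain_untouched[OF X A(1) True U] by simp_all
    have "10 + big X \<le> 5 * card (nb v)"
      using untouched_pick(1)[OF True U] assms(2) d(2) unfolding big_def by auto
    then show ?thesis unfolding early_inv_def ci d(1) using U by simp
  next
    case False
    then show ?thesis using assms unfolding early_inv_def ci di by auto
  qed
qed

end

lemma phase_inv_run:
  assumes "greedy V H (center_preference V H (c ` \<P>)) p A"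
  shows "dominated V H A = V \<or> phase_inv A"
  using assms fin
proof (induction rule: greedy_induct)
  case empty
  show ?case by (simp add: phase_inv_def late_inv_def early_inv_def)
next
  case (step A v)
  let ?A = "insert v A" and ?g = "gain V H A v"
  have A': "?A \<subseteq> V" using step.hyps by simp
  show ?case
  proof (cases "dominated V H A = V \<or> ?g = 0")
    case True
    then have "dominated V H A = V"
      using gain_0_imp_all[OF fin, of H A] step.hyps(5) by (metis le_zero_eq)
    then have "dominated V H ?A = V"
      using dominated_insert[of V H v A] dominated_subset[of V H "{v}"] by auto
    then show ?thesis ..
  next
    case False
    then have inv: "phase_inv A" and g: "1 \<le> ?g" using step.IH by auto
    have late: "\<forall>X\<in>\<P>. 3 \<le> card X \<longrightarrow> late_inv ?A X"
      using late_inv_step[OF step.hyps] inv g unfolding phase_inv_def by blast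
    have early: "\<forall>X\<in>\<P>. early_inv ?A X" if "\<forall>X\<in>\<P>. early_inv A X" "2 \<le> ?g"
      using early_inv_step[OF step.hyps] that by blast
    have cA: "card ?A = card A + 1" using step.hyps by simp
    have dA: "dom_count V H ?A = dom_count V H A + ?g" by (rule dom_count_insert[OF fin])
    consider "3 \<le> ?g" | "?g = 2" | "?g = 1" using g by linarith
    then have "phase_inv ?A"
    proof cases
      case 1
      then have "\<not> (\<forall>x\<in>V. gain V H A x \<le> 1)" using step.hyps(3) by fastforce
      then show ?thesis
        using inv late early 1 unfolding phase_inv_def cA dA by fastforce
    next
      case 2
      have touched: "A \<inter> X \<noteq> {}" if X: "X \<in> \<P>" "3 \<le> card X" for X
      proof
        assume U: "A \<inter> X = {}"
        obtain x where x: "x \<in> X" "3 \<le> card (nb x)" using big_piece_gain[OF X] by blast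
        then have "gain V H A x = card (nb x)" using gain_untouched[OF X(1) step.hyps(1) _ U] by blast
        then show False using x step.hyps(5)[of x] finite_\<P>(3)[OF X(1)] 2 by fastforce
      qed
      have "\<not> (\<forall>x\<in>V. gain V H A x \<le> 1)" using step.hyps(3) 2 by fastforce
      then have "\<forall>X\<in>\<P>. early_inv A X" using inv unfolding phase_inv_def by blast
      then have "\<forall>X\<in>\<P>. early_inv ?A X" using early 2 by simp
      moreover have "\<forall>X\<in>\<P>. 3 \<le> card X \<longrightarrow> ?A \<inter> X \<noteq> {}" using touched by blast
      ultimately show ?thesis using late unfolding phase_inv_def by blast
    next
      case 3
      have "gain V H ?A x \<le> 1" if "x \<in> V" for x
        using gain_antimono[OF fin, of A ?A H x] step.hyps(5)[OF that] 3 by fastforce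
      then show ?thesis using late unfolding phase_inv_def by blast
    qed
    then show ?thesis ..
  qed
qed

lemma decomposition_greedy_dom_count:
  assumes "greedy V H (center_preference V H (c ` \<P>)) p A"
  shows "dominated V H A = V \<or> 3 * p \<le> dom_count V H A \<or>
    10 * p + (\<Sum>X\<in>\<P>. big X) \<le> 5 * dom_count V H A \<or>
    7 * p + 3 * (\<Sum>X\<in>\<P>. big X) \<le> 7 * dom_count V H A"
proof (cases "dominated V H A = V")
  case False
  then have inv: "phase_inv A" using phase_inv_run[OF assms] by simp
  have A: "A \<subseteq> V" "card A = p" using greedy_subset_card[OF assms] by auto
  from inv consider "3 * card A \<le> dom_count V H A"
    | "\<forall>X\<in>\<P>. 3 \<le> card X \<longrightarrow> A \<inter> X \<noteq> {}" "\<forall>X\<in>\<P>. early_inv A X"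
    | "\<forall>x\<in>V. gain V H A x \<le> 1" unfolding phase_inv_def by blast
  then show ?thesis
  proof cases
    case 1
    then show ?thesis using A by simp
  next
    case 2
    have "10 * card (A \<inter> X) + big X \<le> 5 * dX A X" if "X \<in> \<P>" for X
      using 2 that unfolding early_inv_def big_def by (cases "A \<inter> X = {}") auto
    then have "(\<Sum>X\<in>\<P>. 10 * card (A \<inter> X) + big X) \<le> (\<Sum>X\<in>\<P>. 5 * dX A X)"
      by (rule sum_mono)
    then show ?thesis
      using card_sum_pieces[OF A(1)] dom_count_sum_pieces[OF A(1)] A(2)
      by (simp add: sum.distrib flip: sum_distrib_left)
  next
    case 3
    have "7 * card (A \<inter> X) + 3 * big X \<le> 7 * dX A X" if X: "X \<in> \<P>" for X
    proof (cases "3 \<le> card X")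
      case True
      have "A \<inter> X \<noteq> {}"
      proof
        assume U: "A \<inter> X = {}"
        obtain x where x: "x \<in> X" "3 \<le> card (nb x)" using big_piece_gain[OF X True] by blast
        then have "gain V H A x = card (nb x)" using gain_untouched[OF X A(1) _ U] by blast
        then show False using x 3 finite_\<P>(3)[OF X] by fastforce
      qed
      \<comment> \<open>With all gains at most 1, the exceptional alternative of
        \<open>late_inv\<close> is ruled out.\<close>
      moreover have "\<not> (\<exists>z\<in>X. 2 \<le> gain V H A z)" using 3 finite_\<P>(3)[OF X] by fastforce
      moreover have "late_inv A X" using inv X True unfolding phase_inv_def by blast
      ultimately show ?thesis unfolding late_inv_def big_def using True by auto
    next
      case False
      \<comment> \<open>For a piece with fewer than three vertices \<open>big\<close> is 0, so it
        suffices that the picks dominate themselves.\<close>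
      have "A \<inter> X \<subseteq> dominated V H (A \<inter> X)" using A(1) by (intro dominated_self) auto
      then have "card (A \<inter> X) \<le> dX A X"
        unfolding dX_def by (rule card_mono[OF finite_dominated[OF fin]])
      then show ?thesis using False unfolding big_def by simp
    qed
    then have "(\<Sum>X\<in>\<P>. 7 * card (A \<inter> X) + 3 * big X) \<le> (\<Sum>X\<in>\<P>. 7 * dX A X)"
      by (rule sum_mono)
    then show ?thesis
      using card_sum_pieces[OF A(1)] dom_count_sum_pieces[OF A(1)] A(2)
      by (simp add: sum.distrib flip: sum_distrib_left)
  qed
qed simp

end

subsection \<open>The approximation ratio\<close>

lemma subtree_subset: "subtree F r W u \<subseteq> W"
  unfolding subtree_def by blast

lemma decomposition_loop_partition:
  assumes "decomposition_loop F r W P" "finite W"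
  shows "\<Union>P = W \<and> (\<forall>X\<in>P. 3 \<le> card X) \<and> (\<forall>X\<in>P. \<forall>Y\<in>P. X \<noteq> Y \<longrightarrow> X \<inter> Y = {})"
  using assms
proof (induction rule: decomposition_loop.induct)
  case (step u W S X P)
  have S: "S \<subseteq> W" unfolding step(2) by (rule subtree_subset)
  have X: "X \<subseteq> W" using S step(5) by (auto split: if_splits)
  have "card S \<le> card W" using S step.prems by (rule card_mono[rotated])
  then have cX: "3 \<le> card X" using step(3,5) by (auto split: if_splits)
  have IH: "\<Union>P = W - X" "\<forall>X\<in>P. 3 \<le> card X" "\<forall>X\<in>P. \<forall>Y\<in>P. X \<noteq> Y \<longrightarrow> X \<inter> Y = {}"
    using step.IH step.prems by auto
  have "\<forall>Y\<in>P. X \<inter> Y = {}" using IH(1) by blast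
  then show ?case using IH X cX by (auto simp: Int_commute)
qed simp

lemma decomposition_partition:
  assumes "decomposition F r W P" "finite W"
  shows "\<Union>P = W" "\<And>X Y x. \<lbrakk> X \<in> P; Y \<in> P; x \<in> X; x \<in> Y \<rbrakk> \<Longrightarrow> X = Y"
    and "3 \<le> card W \<Longrightarrow> X \<in> P \<Longrightarrow> 3 \<le> card X"
    and "card W < 3 \<Longrightarrow> P = {W}"
proof -
  have "\<Union>P = W \<and> (\<forall>X\<in>P. 3 \<le> card W \<longrightarrow> 3 \<le> card X) \<and> (\<forall>X\<in>P. \<forall>Y\<in>P. X \<noteq> Y \<longrightarrow> X \<inter> Y = {})"
    using assms decomposition_loop_partition[of F r W P] unfolding decomposition_def
    by (cases "card W < 3") auto
  then show "\<Union>P = W" "\<And>X Y x. \<lbrakk> X \<in> P; Y \<in> P; x \<in> X; x \<in> Y \<rbrakk> \<Longrightarrow> X = Y"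
    "3 \<le> card W \<Longrightarrow> X \<in> P \<Longrightarrow> 3 \<le> card X" by blast+
  show "card W < 3 \<Longrightarrow> P = {W}" using assms(1) unfolding decomposition_def by simp
qed

text \<open>These are exactly the two thresholds assumed in \<open>ratio_arith\<close>. The upper
  one comes from \<open>exp (- 1 / 10) \<ge> 9 / 10\<close>, raised to the tenth power.\<close>

lemma exp_1_bounds: "5 / 2 \<le> exp (1 :: real)" "exp (1 :: real) \<le> 35 / 12"
proof -
  show "5 / 2 \<le> exp (1 :: real)" using exp_lower_Taylor_quadratic[of 1] by simp
  have "(9 / 10 :: real) \<le> exp (- 1 / 10)" using exp_ge_add_one_self[of "- 1 / 10"] by simp
  then have "(9 / 10 :: real) ^ 10 \<le> exp (- 1 / 10) ^ 10" by (rule power_mono) simp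
  also have "\<dots> = exp (- 1)" by (simp flip: exp_of_nat_mult)
  finally have "(9 / 10 :: real) ^ 10 * exp 1 \<le> 1" by (simp add: exp_minus field_simps)
  moreover have "(12 / 35 :: real) \<le> (9 / 10) ^ 10" by (simp add: power_divide)
  then have "12 / 35 * exp 1 \<le> (9 / 10 :: real) ^ 10 * exp 1" by (rule mult_right_mono) simp
  ultimately show "exp (1 :: real) \<le> 35 / 12" by linarith
qed

text \<open>Multiplying \<open>G\<close> by \<open>6 * e\<close> and adding
  \<open>5 * x \<ge> 6 * d - 5 * y\<close> gives the claim, so this inequality is the target. The
  middle alternative of \<open>H\<close> implies it outright. If it fails under the first, then
  \<open>4 * d \<le> 5 * y\<close>, and \<open>G\<close> alone suffices because
  \<open>e \<ge> 5/2\<close>. If it fails under the third, then \<open>5 * y \<le> 9 * x\<close>,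
  and the ratio is at most 5/9 because \<open>e \<le> 35/12\<close>.\<close>

lemma ratio_arith:
  fixes e x y d q j p n :: real
  assumes e: "5 / 2 \<le> e" "e \<le> 35 / 12" and y: "y = d - q + j" and pq: "q + j \<le> p" and dn: "d \<le> n"
    and nonneg: "0 \<le> q" "0 \<le> j" "0 \<le> d"
    and G: "y - d / e \<le> x" and H: "2 * p \<le> x \<or> n + 5 * p \<le> 5 * x \<or> 3 * n \<le> 7 * x"
  shows "(6 * e - 5) / (6 * e + 5) * y \<le> x"
proof -
  have G': "e * y - d \<le> e * x"
    using mult_left_mono[OF G, of e] e by (simp add: right_diff_distrib)
  have main: "(6 * e - 5) * y \<le> (6 * e + 5) * x" if "6 * d - 5 * y \<le> 5 * x"
    using that G' by (simp add: algebra_simps)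
  have "(6 * e - 5) * y \<le> (6 * e + 5) * x"
    using H
  proof (elim disjE)
    assume "n + 5 * p \<le> 5 * x"
    then show ?thesis using y pq dn nonneg by (intro main) linarith
  next
    assume x: "2 * p \<le> x"
    show ?thesis
    proof (cases "6 * d - 5 * y \<le> 5 * x")
      case False
      then have "4 * d \<le> 5 * y" using x y pq nonneg by linarith
      then have "2 * e * (4 * d) \<le> 2 * e * (5 * y)" using e by (intro mult_left_mono) auto
      moreover have "5 * d \<le> (2 * e) * d" using e nonneg by (intro mult_right_mono) auto
      ultimately have "(6 * e + 5) * d \<le> 10 * (e * y)" by (simp add: algebra_simps)
      moreover have "(6 * e + 5) * (e * y - d) \<le> (6 * e + 5) * (e * x)"
        using G' e by (intro mult_left_mono) auto
      ultimately have "e * ((6 * e - 5) * y) \<le> e * ((6 * e + 5) * x)"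
        by (simp add: algebra_simps)
      then show ?thesis using e by simp
    qed (rule main)
  next
    assume x: "3 * n \<le> 7 * x"
    show ?thesis
    proof (cases "6 * d - 5 * y \<le> 5 * x")
      case False
      then have "5 * y \<le> 9 * x" using x dn by linarith
      moreover have "0 \<le> x" using x dn nonneg by linarith
      ultimately have "(6 * e - 5) * (5 * y) \<le> (6 * e - 5) * (9 * x)" "(24 * e) * x \<le> 70 * x"
        using e by (intro mult_left_mono mult_right_mono; simp)+
      then show ?thesis by (simp add: algebra_simps)
    qed (rule main)
  qed
  then show ?thesis using e by (simp add: field_simps)
qed

lemma ext_nonneg: "finite V \<Longrightarrow> A \<subseteq> V \<Longrightarrow> 0 \<le> ext V E A"
  using card_mono[OF finite_dominated dominated_self, of V A E] unfolding ext_def dom_count_def by simp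

lemma ext_le: "finite V \<Longrightarrow> ext V E A \<le> int (card V) - int (card A)"
  using card_mono[OF _ dominated_subset, of V E A] unfolding ext_def dom_count_def by simp

lemma approx_solutionI:
  assumes "finite V" "D \<subseteq> V" "card D = p"
    and "\<And>A. A \<subseteq> V \<Longrightarrow> card A = p \<Longrightarrow> \<rho> * real_of_int (ext V E A) \<le> real_of_int (ext V E D)"
  shows "approx_solution \<rho> V E p D"
proof -
  let ?S = "{ext V E A |A. A \<subseteq> V \<and> card A = p}"
  have "?S \<subseteq> ext V E ` Pow V" by blast
  then have "finite ?S" using assms(1) finite_subset by blast
  moreover have "ext V E D \<in> ?S" using assms(2,3) by blast
  ultimately have "Max ?S \<in> ?S" by (intro Max_in) auto
  then obtain A where "Max ?S = ext V E A" "A \<subseteq> V" "card A = p" by blast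
  then show ?thesis using assms(2-4) unfolding approx_solution_def by simp
qed

lemma graph_parts_components:
  assumes "ugraph V E"
  shows "graph_parts V E (\<Union>{T \<in> components V E. 3 \<le> card T}) (\<Union>{T \<in> components V E. card T = 1})
    {T \<in> components V E. card T = 2}"
proof
  show fin: "finite V" using assms unfolding ugraph_def by blast
  have fT: "finite T" "0 < card T" if "T \<in> components V E" for T
    using that component_subset[OF that] component_nonempty[OF that] fin
    by (auto simp: finite_subset card_gt_0_iff)
  have "card T = 1 \<or> card T = 2 \<or> 3 \<le> card T" if "T \<in> components V E" for T
    using fT[OF that] by linarith
  then show "V = \<Union>{T \<in> components V E. 3 \<le> card T} \<union> \<Union>{T \<in> components V E. card T = 2} \<union>
      \<Union>{T \<in> components V E. card T = 1}"
    using Union_components[of V E] by blast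
  have dis: "\<Union>{T \<in> components V E. Q (card T)} \<inter> \<Union>{T \<in> components V E. R (card T)} = {}"
    if "\<And>m. Q m \<Longrightarrow> \<not> R m" for Q R
    using that components_disjoint[of _ V E] by blast
  show "\<Union>{T \<in> components V E. 3 \<le> card T} \<inter> \<Union>{T \<in> components V E. card T = 2} = {}"
    by (rule dis) simp
  show "\<Union>{T \<in> components V E. 3 \<le> card T} \<inter> \<Union>{T \<in> components V E. card T = 1} = {}"
    by (rule dis) simp
  show "\<Union>{T \<in> components V E. card T = 2} \<inter> \<Union>{T \<in> components V E. card T = 1} = {}"
    by (rule dis) simp
  show "Q = Q'" if "Q \<in> {T \<in> components V E. card T = 2}" "Q' \<in> {T \<in> components V E. card T = 2}"
    "x \<in> Q" "x \<in> Q'" for Q Q' x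
    using that components_disjoint[of Q V E Q' x] by blast
  show "card Q = 2" if "Q \<in> {T \<in> components V E. card T = 2}" for Q using that by blast
  have nbT: "dominated V E {v} \<subseteq> T" if T: "T \<in> components V E" "v \<in> T" for T v
    using component_edge[OF T] T(2) unfolding dominated_def by (auto simp: insert_commute)
  show "dominated V E {v} \<subseteq> \<Union>{T \<in> components V E. 3 \<le> card T}"
    if "v \<in> \<Union>{T \<in> components V E. 3 \<le> card T}" for v
    using that nbT by blast
  have self: "v \<in> dominated V E {v}" if "T \<in> components V E" "v \<in> T" for T v
    using component_subset[OF that(1)] that(2) unfolding dominated_def by auto
  show "dominated V E {v} = {v}" if v: "v \<in> \<Union>{T \<in> components V E. card T = 1}" for v
  proof -
    obtain T where T: "T \<in> components V E" "v \<in> T" "card T = 1" using v by blast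
    then have "T = {v}" by (metis card_1_singletonE singletonD)
    then show ?thesis using nbT[OF T(1,2)] self[OF T(1,2)] by blast
  qed
  show "dominated V E {v} = Q" if Q: "Q \<in> {T \<in> components V E. card T = 2}" "v \<in> Q" for Q v
  proof -
    obtain w where w: "Q = {v, w}" "v \<noteq> w"
    proof -
      obtain a b where "Q = {a, b}" "a \<noteq> b" using Q(1) by (auto simp: card_2_iff)
      then show thesis using Q(2) that[of b] that[of a] by (auto simp: insert_commute)
    qed
    then have "{v, w} \<in> E" using component_pair_edge[OF assms, of v w] Q(1) by simp
    then have "w \<in> dominated V E {v}"
      using w Q(1) component_subset[of Q V E] unfolding dominated_def by (auto simp: insert_commute)
    then show ?thesis using nbT[of Q v] self[of Q v] Q w by blast
  qed
qed

theorem algorithm_output_approx: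
  assumes "ugraph V E" "algorithm_output V E p D"
  shows "approx_solution ((6 * exp 1 - 5) / (6 * exp 1 + 5)) V E p D"
proof -
  obtain F r P c \<P> H A A' where
    F: "spanning_forest V E F" and
    P: "\<forall>T \<in> components V F. r T \<in> T \<and> decomposition F (r T) T (P T)" and
    \<P>: "\<P> = (\<Union>T \<in> components V F. P T)" and
    H: "H = (\<Union>X \<in> \<P>. induced_edges F X)" and
    c: "\<forall>X \<in> \<P>. is_center X (induced_edges F X) (c X)" and
    A: "greedy V E no_preference p A" and
    A': "greedy V H (center_preference V H (c ` \<P>)) p A'" and
    D: "D \<in> {A, A'}" "ext V E D = max (ext V E A) (ext V E A')"
    using assms(2) unfolding algorithm_output_def by (elim exE conjE) (rule that)
  have fin: "finite V" using assms(1) unfolding ugraph_def by blast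
  have comp: "components V F = components V E" and FE: "F \<subseteq> E"
    using F unfolding spanning_forest_def by auto
  have fT: "finite T" if "T \<in> components V F" for T
    using component_subset[OF that] fin finite_subset by blast
  have dec: "decomposition F (r T) T (P T)" if "T \<in> components V F" for T using P that by blast
  note part = decomposition_partition[OF dec fT]
  have sub: "X \<subseteq> T" if "T \<in> components V F" "X \<in> P T" for X T
    using part(1)[OF that(1) that(1)] that(2) by blast
  interpret pieces V \<P> F H c
  proof
    have "\<Union>\<P> = (\<Union>T\<in>components V F. \<Union>(P T))" unfolding \<P> by blast
    also have "\<dots> = V" using part(1) Union_components[of V F] by simp
    finally show "\<Union>\<P> = V" .
    show "X = Y" if XY: "X \<in> \<P>" "Y \<in> \<P>" "x \<in> X" "x \<in> Y" for X Y x
    proof -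
      obtain T T' where T: "T \<in> components V F" "X \<in> P T" "T' \<in> components V F" "Y \<in> P T'"
        using XY(1,2) unfolding \<P> by blast
      then have "T = T'" using components_disjoint[of T V F T' x] sub XY(3,4) by blast
      then show ?thesis using part(2)[OF T(1) T(1) T(2), of Y x] T XY(3,4) by blast
    qed
  qed (use fin H c in auto)
  define B where "B = \<Union>{T \<in> components V E. 3 \<le> card T}"
  define I where "I = \<Union>{T \<in> components V E. card T = 1}"
  define \<Q> where "\<Q> = {T \<in> components V E. card T = 2}"
  interpret graph_parts V E B I \<Q>
    unfolding B_def I_def \<Q>_def by (rule graph_parts_components[OF assms(1)])
  \<comment> \<open>A tree with at least three vertices is cut into pieces of at least three
    vertices and a smaller tree is kept whole, so the large pieces cover exactly
    \<open>B\<close>.\<close>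
  have big_sum: "(\<Sum>X\<in>\<P>. big X) = card B"
  proof -
    let ?big = "{X \<in> \<P>. 3 \<le> card X}"
    have B: "B = \<Union>?big"
    proof
      show "B \<subseteq> \<Union>?big"
      proof
        fix x assume "x \<in> B"
        then obtain T where T: "T \<in> components V F" "3 \<le> card T" "x \<in> T" unfolding B_def comp by blast
        then obtain X where X: "X \<in> P T" "x \<in> X" using part(1)[OF T(1) T(1)] by blast
        then have "3 \<le> card X" using part(3)[OF T(1) T(1) T(2)] by blast
        then show "x \<in> \<Union>?big" using X T(1) unfolding \<P> by blast
      qed
      show "\<Union>?big \<subseteq> B"
      proof
        fix x assume "x \<in> \<Union>?big"
        then obtain X T where X: "T \<in> components V F" "X \<in> P T" "3 \<le> card X" "x \<in> X" unfolding \<P> by blast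
        have "3 \<le> card T" using card_mono[OF fT[OF X(1)] sub[OF X(1,2)]] X(3) by linarith
        then show "x \<in> B" using X sub[OF X(1,2)] unfolding B_def comp by blast
      qed
    qed
    have "card B = (\<Sum>X\<in>?big. card X)"
    proof -
      have "pairwise disjnt ?big" using \<P>_disj unfolding pairwise_def disjnt_iff by blast
      then have "card (\<Union>?big) = sum card ?big"
        using finite_\<P>(2) by (intro card_Union_disjoint) blast+
      then show ?thesis using B by simp
    qed
    also have "\<dots> = (\<Sum>X\<in>\<P>. big X)"
      unfolding big_def using finite_\<P>(1) by (simp add: sum.inter_filter)
    finally show ?thesis by simp
  qed
  have AV: "A \<subseteq> V" "card A = p" "A' \<subseteq> V" "card A' = p"
    using greedy_subset_card[OF A] greedy_subset_card[OF A'] by auto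
  have DV: "D \<subseteq> V" "card D = p" using D(1) AV by auto
  \<comment> \<open>Coverage counted in \<open>H\<close> is therefore a lower bound for coverage in
    \<open>G\<close>.\<close>
  have "H \<subseteq> E" using H FE unfolding induced_edges_def by blast
  then have dom: "dominated V H A' \<subseteq> dominated V E A'" by (intro dominated_mono) auto
  then have "dom_count V H A' \<le> dom_count V E A'"
    unfolding dom_count_def by (rule card_mono[OF finite_dominated[OF fin]])
  then have extA': "int (dom_count V H A') - int p \<le> ext V E A'"
    unfolding ext_def AV(4) by simp
  show ?thesis
  proof (rule approx_solutionI[OF fin DV])
    fix S assume S: "S \<subseteq> V" "card S = p"
    let ?\<rho> = "(6 * exp 1 - 5) / (6 * exp 1 + 5) :: real"
    have \<rho>: "0 \<le> ?\<rho>" "?\<rho> \<le> 1" using exp_1_bounds by (auto simp: field_simps)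
    have S0: "0 \<le> ext V E S" by (rule ext_nonneg[OF fin S(1)])
    show "?\<rho> * real_of_int (ext V E S) \<le> real_of_int (ext V E D)"
    proof (cases "dominated V E A = V \<or> dominated V E A' = V")
      case True
      then have "int (card V) - int p \<le> max (ext V E A) (ext V E A')"
        unfolding ext_def dom_count_def AV by auto
      then have "ext V E S \<le> ext V E D" using ext_le[OF fin, of E S] S(2) D(2) by linarith
      moreover have "?\<rho> * real_of_int (ext V E S) \<le> 1 * real_of_int (ext V E S)"
        using \<rho> S0 by (intro mult_right_mono) auto
      ultimately show ?thesis by simp
    next
      case False
      define q where "q = card (S \<inter> B)"
      define d where "d = card (dominated V E (S \<inter> B))"
      define j where "j = card (hit S)"
      have G: "(1 - exp (- 1)) * d - q + j \<le> real_of_int (ext V E A)"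
        using greedy_ext_ge[OF A S q_def d_def j_def] False by simp
      have pq: "q + j + card (S \<inter> I) \<le> p"
        using card_ge_parts[OF S(1)] S(2) unfolding q_def j_def by simp
      have "dom_count V E S = d + 2 * j + card (S \<inter> I)"
        using dom_count_parts[OF S(1)] unfolding d_def j_def by simp
      \<comment> \<open>A hit pair contributes at most a net 1 and an isolated vertex a net 0, which
        leaves the quantity \<open>y\<close> of \<open>ratio_arith\<close>.\<close>
      then have y: "real_of_int (ext V E S) \<le> real d - q + j"
        using pq S(2) unfolding ext_def by simp
      have dn: "d \<le> card B" unfolding d_def using dominated_B finite_parts(1) by (intro card_mono)
      have "dominated V H A' \<noteq> V" using False dom dominated_subset[of V E A'] by blast
      then have "3 * p \<le> dom_count V H A' \<or> 10 * p + card B \<le> 5 * dom_count V H A' \<or>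
          7 * p + 3 * card B \<le> 7 * dom_count V H A'"
        using decomposition_greedy_dom_count[OF A'] unfolding big_sum by simp
      moreover have "real (dom_count V H A') - p \<le> real_of_int (ext V E A')"
      proof -
        have "real_of_int (int (dom_count V H A') - int p) \<le> real_of_int (ext V E A')"
          using extA' by (simp only: of_int_le_iff)
        then show ?thesis by simp
      qed
      ultimately have H': "2 * real p \<le> ext V E A' \<or> card B + 5 * real p \<le> 5 * real_of_int (ext V E A') \<or>
          3 * real (card B) \<le> 7 * real_of_int (ext V E A')"
        by linarith
      have D': "ext V E A \<le> ext V E D" "ext V E A' \<le> ext V E D" using D(2) by auto
      have "?\<rho> * (real d - q + j) \<le> real_of_int (ext V E D)"
      proof (rule ratio_arith[OF exp_1_bounds refl, where p = p and n = "card B"])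
        show "real d - q + j - d / exp 1 \<le> ext V E D"
          using G D'(1) by (simp add: exp_minus algebra_simps divide_inverse)
        show "2 * real p \<le> ext V E D \<or> real (card B) + 5 * real p \<le> 5 * real_of_int (ext V E D) \<or>
            3 * real (card B) \<le> 7 * real_of_int (ext V E D)"
          using H' D'(2) by linarith
      qed (use pq dn in auto)
      then show ?thesis using mult_left_mono[OF y \<rho>(1)] by linarith
    qed
  qed
qed

subsection \<open>Rooted forests and spiders\<close>

lemma cycle_rotate: "cycle E (xs @ ys) \<Longrightarrow> cycle E (ys @ xs)"
  by (cases "xs = []"; cases "ys = []") (auto simp: cycle_def successively_append_iff)

text \<open>\<open>u\<close> plays the role of the hub \<open>u 0\<close> in \<open>in_S\<close>.
  The vertex at which a piece is cut has this role, whereas \<open>is_center\<close> moves to a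
  neighbour on the five-vertex path.\<close>

definition spider :: "'a set set \<Rightarrow> 'a set \<Rightarrow> 'a \<Rightarrow> bool" where
  "spider F X u \<longleftrightarrow> (\<exists>a b f g. in_S a b f g X (induced_edges F X) \<and> f 0 = u)"

text \<open>Here \<open>\<pi>\<close> maps every vertex other than \<open>u\<close> to its neighbour on the way to \<open>u\<close>.\<close>

lemma spiderI:
  assumes fin: "finite X" and u: "u \<in> X"
    and \<pi>: "\<And>w. w \<in> X \<Longrightarrow> w \<noteq> u \<Longrightarrow> \<pi> w \<in> X \<and> \<pi> w \<noteq> w \<and> (\<pi> w = u \<or> \<pi> (\<pi> w) = u)"
    and inj: "\<And>w w'. \<lbrakk> w \<in> X; w' \<in> X; w \<noteq> u; w' \<noteq> u; \<pi> w = \<pi> w'; \<pi> w \<noteq> u \<rbrakk> \<Longrightarrow> w = w'"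
    and E: "induced_edges F X = {{w, \<pi> w} |w. w \<in> X \<and> w \<noteq> u}"
  shows "spider F X u"
proof -
  \<comment> \<open>\<open>C\<close> consists of the neighbours of \<open>u\<close> and
    \<open>L\<close> of the vertices at distance two. \<open>C2\<close> are the neighbours that
    carry a leaf, only one each since \<open>\<pi>\<close> is injective on \<open>L\<close>;
    \<open>C1\<close> are the bare ones.\<close>
  define C where "C = {w \<in> X. w \<noteq> u \<and> \<pi> w = u}"
  define L where "L = {w \<in> X. w \<noteq> u \<and> \<pi> w \<noteq> u}"
  define C2 where "C2 = \<pi> ` L"
  define C1 where "C1 = C - C2"
  have C2C: "C2 \<subseteq> C" using \<pi> unfolding C2_def C_def L_def by blast
  have injL: "inj_on \<pi> L" using inj unfolding inj_on_def L_def by blast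
  have finC: "finite C1" "finite C2" using fin unfolding C1_def C2_def C_def L_def by auto
  define a where "a = card C1"
  define b where "b = card C2"
  obtain h1 where h1: "bij_betw h1 {1..a} C1"
    using ex_bij_betw_nat_finite_1[OF finC(1)] unfolding a_def by blast
  obtain h2 where h2: "bij_betw h2 {1..b} C2"
    using ex_bij_betw_nat_finite_1[OF finC(2)] unfolding b_def by blast
  \<comment> \<open>Bare neighbours are numbered first because \<open>in_S\<close> attaches the leaf
    \<open>v j\<close> to \<open>u (a + j)\<close>.\<close>
  define f where "f i = (if i = 0 then u else if i \<le> a then h1 i else h2 (i - a))" for i
  have f0: "f 0 = u" by (simp add: f_def)
  define \<sigma> where "\<sigma> = inv_into L \<pi>"
  have \<sigma>: "\<sigma> v \<in> L" "\<pi> (\<sigma> v) = v" if "v \<in> C2" for v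
    using that inv_into_into[of v \<pi> L] f_inv_into_f[of v \<pi> L] unfolding \<sigma>_def C2_def by auto
  have \<sigma>': "\<sigma> (\<pi> w) = w" if "w \<in> L" for w using that injL unfolding \<sigma>_def by simp
  define g where "g j = \<sigma> (h2 j)" for j
  have f1: "f i = h1 i" if "i \<in> {1..a}" for i using that by (simp add: f_def)
  have f2: "f (a + j) = h2 j" if "j \<in> {1..b}" for j using that by (simp add: f_def)
  have im1: "f ` {1..a} = C1" using f1 h1 by (simp add: bij_betw_def)
  have im2: "f ` ((+) a ` {1..b}) = C2"
  proof -
    have "(\<lambda>j. f (a + j)) ` {1..b} = h2 ` {1..b}" by (rule image_cong[OF refl f2])
    then show ?thesis unfolding image_image using h2 by (simp add: bij_betw_def)
  qed
  have spl: "{0..a+b} = {0} \<union> {1..a} \<union> (+) a ` {1..b}" by (auto simp: image_iff)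
  have imf: "f ` {0..a+b} = insert u C" unfolding spl image_Un im1 im2 using C2C
    by (auto simp: f_def C1_def)
  have "card (f ` {0..a+b}) = card {0..a+b}"
  proof -
    have "u \<notin> C" unfolding C_def by blast
    moreover have fC: "finite C" using fin unfolding C_def by simp
    moreover have "card C = a + b" unfolding a_def b_def C1_def
      using card_Diff_subset[OF finC(2) C2C] card_mono[OF fC C2C] by simp
    ultimately show ?thesis unfolding imf by simp
  qed
  then have injf: "inj_on f {0..a+b}" by (intro eq_card_imp_inj_on) auto
  have "h2 ` {1..b} = C2" "inj_on h2 {1..b}" using h2 by (auto simp: bij_betw_def)
  then have img: "g ` {1..b} = L" and injg: "inj_on g {1..b}"
  proof -
    have "g ` {1..b} = \<sigma> ` C2" unfolding g_def \<open>h2 ` {1..b} = C2\<close>[symmetric] image_image ..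
    also have "\<dots> = L" using \<sigma>' unfolding C2_def image_image by simp
    finally show "g ` {1..b} = L" .
    have "inj_on \<sigma> C2" using \<sigma>(2) by (metis inj_onI)
    then show "inj_on g {1..b}" unfolding g_def
      using comp_inj_on[OF \<open>inj_on h2 {1..b}\<close>, of \<sigma>] \<open>h2 ` {1..b} = C2\<close> by (simp add: comp_def)
  qed
  have X: "X = insert u C \<union> L" using u unfolding C_def L_def by blast
  have disj: "insert u C \<inter> L = {}" unfolding C_def L_def by blast
  have "{{f 0, f j} |j. 1 \<le> j \<and> j \<le> a + b} = {{w, \<pi> w} |w. w \<in> C}"
  proof -
    have "{{f 0, f j} |j. 1 \<le> j \<and> j \<le> a + b} = (\<lambda>w. {u, w}) ` (f ` {1..a+b})"
      unfolding f0 by auto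
    also have "f ` {1..a+b} = C"
    proof -
      have "{0..a+b} = insert 0 {1..a+b}" by auto
      then have "insert u (f ` {1..a+b}) = insert u C" using imf f0 by (simp only: image_insert)
      moreover have "u \<notin> C" unfolding C_def by blast
      moreover have "u \<notin> f ` {1..a+b}"
      proof
        assume "u \<in> f ` {1..a+b}"
        then obtain i where "i \<in> {1..a+b}" "f i = f 0" unfolding f0 by blast
        then show False using inj_onD[OF injf, of i 0] by auto
      qed
      ultimately show ?thesis by (metis insert_ident)
    qed
    also have "(\<lambda>w. {u, w}) ` C = {{w, \<pi> w} |w. w \<in> C}"
      unfolding C_def by (auto simp: insert_commute)
    finally show ?thesis .
  qed
  moreover have "{{f (a + j), g j} |j. 1 \<le> j \<and> j \<le> b} = {{w, \<pi> w} |w. w \<in> L}"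
  proof -
    have "{{f (a + j), g j} |j. 1 \<le> j \<and> j \<le> b} = (\<lambda>j. {g j, \<pi> (g j)}) ` {1..b}"
    proof -
      have "{f (a + j), g j} = {g j, \<pi> (g j)}" if "j \<in> {1..b}" for j
        using \<sigma>(2)[of "h2 j"] f2[OF that] that \<open>h2 ` {1..b} = C2\<close> unfolding g_def by (auto simp: insert_commute)
      then have "(\<lambda>j. {f (a + j), g j}) ` {1..b} = (\<lambda>j. {g j, \<pi> (g j)}) ` {1..b}"
        by (rule image_cong[OF refl])
      moreover have "{{f (a + j), g j} |j. 1 \<le> j \<and> j \<le> b} = (\<lambda>j. {f (a + j), g j}) ` {1..b}" by auto
      ultimately show ?thesis by simp
    qed
    also have "\<dots> = (\<lambda>w. {w, \<pi> w}) ` (g ` {1..b})" by (simp add: image_image)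
    also have "\<dots> = {{w, \<pi> w} |w. w \<in> L}" unfolding img by blast
    finally show ?thesis .
  qed
  moreover have "induced_edges F X = {{w, \<pi> w} |w. w \<in> C} \<union> {{w, \<pi> w} |w. w \<in> L}"
    unfolding E C_def L_def by blast
  ultimately have "in_S a b f g X (induced_edges F X)"
    unfolding in_S_def imf img using injf injg X disj by auto
  then show ?thesis unfolding spider_def using f_def by (intro exI[of _ a] exI[of _ b] exI[of _ f] exI[of _ g]) simp
qed

text \<open>A forest is given by a parent map whose fixed points are the roots; the decreasing
  \<open>rank\<close> excludes cycles. By the bound \<open>N\<close>, exactly \<open>N\<close>
  parent steps always end at the root, so \<open>rt\<close> can be a fixed power of
  \<open>par\<close>.\<close>

locale rooted_forest =
  fixes V :: "'a set" and par :: "'a \<Rightarrow> 'a" and rank :: "'a \<Rightarrow> nat" and N :: nat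
  assumes fin: "finite V"
    and par_V: "\<And>y. y \<in> V \<Longrightarrow> par y \<in> V"
    and rank_par: "\<And>y. y \<in> V \<Longrightarrow> par y \<noteq> y \<Longrightarrow> rank (par y) < rank y"
    and rank_N: "\<And>y. y \<in> V \<Longrightarrow> rank y \<le> N"
begin

definition F :: "'a set set" where
  "F = {{y, par y} |y. y \<in> V \<and> par y \<noteq> y}"

definition rt :: "'a \<Rightarrow> 'a" where
  "rt w = (par ^^ N) w"

definition anc :: "'a \<Rightarrow> 'a \<Rightarrow> bool" where
  "anc u w \<longleftrightarrow> (\<exists>k. (par ^^ k) w = u)"

lemma F_edge: "{x, y} \<in> F \<longleftrightarrow> x \<noteq> y \<and> (x \<in> V \<and> par x = y \<or> y \<in> V \<and> par y = x)"
  unfolding F_def by (auto simp: doubleton_eq_iff)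

lemma F_edge_V: "{x, y} \<in> F \<Longrightarrow> x \<in> V \<and> y \<in> V"
  using F_edge[of x y] par_V[of x] par_V[of y] by blast

lemma F_higher: "{x, y} \<in> F \<Longrightarrow> rank y \<le> rank x \<Longrightarrow> y = par x"
  using F_edge rank_par by (metis leD)

text \<open>At a vertex of maximal rank on a cycle both cycle edges lead to its parent, yet its two
  neighbours on the cycle are distinct.\<close>

lemma acyclic: "\<not> cycle F xs"
proof
  assume c: "cycle F xs"
  then have "xs \<noteq> []" unfolding cycle_def by auto
  then have "Max (rank ` set xs) \<in> rank ` set xs" by (intro Max_in) auto
  then obtain z where z: "z \<in> set xs" "rank z = Max (rank ` set xs)" by auto
  then have zmax: "rank w \<le> rank z" if "w \<in> set xs" for w using that by simp
  obtain as bs where xs: "xs = as @ z # bs" using z(1) by (meson split_list)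
  define l where "l = bs @ as"
  have c': "cycle F (z # l)" using cycle_rotate[of F as "z # bs"] c unfolding xs l_def by simp
  have sub: "set l \<subseteq> set xs" unfolding xs l_def by auto
  have len: "2 \<le> length l" using c' unfolding cycle_def by simp
  then have l: "l \<noteq> []" by auto
  have dl: "distinct l" using c' unfolding cycle_def by simp
  have "{z, hd l} \<in> F" "{last l, z} \<in> F"
    using c' l unfolding cycle_def by (cases l; auto)+
  moreover have "hd l \<in> set xs" "last l \<in> set xs" using sub l by auto
  ultimately have "hd l = par z" "last l = par z"
    using F_higher[of z "hd l"] F_higher[of z "last l"] zmax by (simp_all add: insert_commute)
  moreover have "hd l \<noteq> last l" using len dl by (cases l) auto
  ultimately show False by simp
qed

lemma funpow_par_V: "w \<in> V \<Longrightarrow> (par ^^ k) w \<in> V"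
  by (induction k) (auto intro: par_V)

lemma funpow_par_root: "par r = r \<Longrightarrow> (par ^^ k) r = r"
  by (induction k) auto

lemma funpow_par_fix: "w \<in> V \<Longrightarrow> rank w \<le> k \<Longrightarrow> par ((par ^^ k) w) = (par ^^ k) w"
proof (induction k arbitrary: w)
  case 0
  then show ?case using rank_par[of w] by auto
next
  case (Suc k)
  show ?case
  proof (cases "par w = w")
    case True
    then show ?thesis using funpow_par_root[of w "Suc k"] by simp
  next
    case False
    then have "rank (par w) \<le> k" using rank_par[of w] Suc.prems by simp
    then show ?thesis using Suc.IH[of "par w"] par_V[of w] Suc.prems
      by (simp add: funpow_swap1)
  qed
qed

lemma rank_funpow_le: "w \<in> V \<Longrightarrow> rank ((par ^^ k) w) \<le> rank w"
proof (induction k)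
  case (Suc k)
  then show ?case using rank_par[OF funpow_par_V[OF Suc.prems, of k]]
    by (cases "par ((par ^^ k) w) = (par ^^ k) w") auto
qed simp

lemma rt_V: "w \<in> V \<Longrightarrow> rt w \<in> V"
  unfolding rt_def by (rule funpow_par_V)

lemma par_rt: "w \<in> V \<Longrightarrow> par (rt w) = rt w"
  unfolding rt_def using funpow_par_fix rank_N by blast

lemma rt_par: "w \<in> V \<Longrightarrow> rt (par w) = rt w"
  using par_rt[of w] unfolding rt_def by (simp add: funpow_swap1)

lemma rt_root: "par r = r \<Longrightarrow> rt r = r"
  unfolding rt_def by (rule funpow_par_root)

lemma rt_funpow: "w \<in> V \<Longrightarrow> rt ((par ^^ k) w) = rt w"
  by (induction k) (auto simp: rt_par funpow_par_V)

lemma anc_refl: "anc w w"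
  unfolding anc_def by (rule exI[of _ 0]) simp

lemma anc_par: "anc (par w) w"
  unfolding anc_def by (rule exI[of _ 1]) simp

lemma anc_rt: "anc (rt w) w"
  unfolding anc_def rt_def by blast

lemma anc_step: "anc u w \<Longrightarrow> u \<noteq> w \<Longrightarrow> anc u (par w)"
proof -
  assume "anc u w" "u \<noteq> w"
  then obtain k where k: "(par ^^ k) w = u" unfolding anc_def by blast
  then obtain m where "k = Suc m" using \<open>u \<noteq> w\<close> by (cases k) auto
  then have "(par ^^ m) (par w) = u" using k by (simp add: funpow_swap1)
  then show ?thesis unfolding anc_def by blast
qed

lemma anc_trans_par: "anc u (par w) \<Longrightarrow> anc u w"
  unfolding anc_def by (metis funpow_swap1 funpow.simps(2) comp_apply)

lemma anc_rank: "w \<in> V \<Longrightarrow> anc u w \<Longrightarrow> rank u \<le> rank w"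
  unfolding anc_def using rank_funpow_le by blast

lemma anc_rt_eq: "w \<in> V \<Longrightarrow> anc u w \<Longrightarrow> rt u = rt w"
  unfolding anc_def using rt_funpow by blast

lemma anc_of_root: "par w = w \<Longrightarrow> anc u w \<Longrightarrow> u = w"
  unfolding anc_def using funpow_par_root by metis

lemma anc_par_self: "w \<in> V \<Longrightarrow> par w \<noteq> w \<Longrightarrow> \<not> anc w (par w)"
  using anc_rank[OF par_V] rank_par by (metis leD)

text \<open>Beyond \<open>N\<close> steps the chain of parents stays at the root. The bound lets the
  program decide ancestry by a finite search.\<close>

lemma anc_bounded: "w \<in> V \<Longrightarrow> anc u w \<longleftrightarrow> (\<exists>k\<le>N. (par ^^ k) w = u)"
proof
  assume w: "w \<in> V" and "anc u w"
  then obtain k where k: "(par ^^ k) w = u" unfolding anc_def by blast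
  show "\<exists>k\<le>N. (par ^^ k) w = u"
  proof (cases "k \<le> N")
    case False
    have "(par ^^ k) w = (par ^^ (k - N)) (rt w)"
      using False funpow_add[of "k - N" N par] unfolding rt_def by simp
    then have "u = rt w" using funpow_par_root[OF par_rt[OF w]] k by simp
    then show ?thesis unfolding rt_def by blast
  qed (use k in blast)
qed (auto simp: anc_def)

lemma anc_child:
  "anc u w \<Longrightarrow> u \<noteq> w \<Longrightarrow> \<exists>k. (par ^^ Suc k) w = u \<and> (par ^^ k) w \<noteq> u"
proof -
  assume "anc u w" "u \<noteq> w"
  then obtain k where k: "(par ^^ k) w = u" unfolding anc_def by blast
  define m where "m = (LEAST k. (par ^^ k) w = u)"
  have m: "(par ^^ m) w = u" unfolding m_def using k by (rule LeastI)
  then obtain m' where m': "m = Suc m'" using \<open>u \<noteq> w\<close> by (cases m) auto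
  then have "(par ^^ m') w \<noteq> u" unfolding m_def using not_less_Least[of m'] by (metis lessI)
  then show ?thesis using m m' by blast
qed

lemma connects_F_rt: "connects F x y \<Longrightarrow> x \<in> V \<Longrightarrow> y \<in> V \<and> rt x = rt y"
  unfolding connects_iff_rtrancl
proof (induction rule: rtrancl_induct)
  case (step y z)
  then have "{y, z} \<in> F" by simp
  then have V: "y \<in> V" "z \<in> V" and "par y = z \<or> par z = y"
    using F_edge[of y z] F_edge_V[of y z] by blast+
  then have "rt y = rt z" using rt_par[OF V(1)] rt_par[OF V(2)] by auto
  then show ?case using step.IH[OF step.prems] V by simp
qed simp

lemma connects_rt: "w \<in> V \<Longrightarrow> connects F w (rt w)"
proof -
  assume w: "w \<in> V"
  have "connects F w ((par ^^ k) w)" for k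
  proof (induction k)
    case (Suc k)
    have "connects F ((par ^^ k) w) (par ((par ^^ k) w))"
      using F_edge[of "(par ^^ k) w" "par ((par ^^ k) w)"] funpow_par_V[OF w, of k] connects_edge connects_refl
      by metis
    with Suc show ?case using connects_trans by simp
  qed (simp add: connects_refl)
  then show ?thesis unfolding rt_def .
qed

lemma component_rt:
  assumes "T \<in> components V F" "x \<in> T"
  shows "T = {y \<in> V. rt y = rt x}"
proof -
  have x: "x \<in> V" using assms component_subset by blast
  have "connects F x y \<longleftrightarrow> rt y = rt x" if "y \<in> V" for y
    using connects_F_rt[OF _ x, of y] connects_rt[OF x] connects_rt[OF that] connects_sym connects_trans
    by metis
  then show ?thesis using component_eq[OF assms] by blast
qed

text \<open>The root is its own parent, so the first edge leads down. Afterwards an upward edge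
  would return to the previous vertex and violate distinctness.\<close>

lemma path_par:
  assumes "path (induced_edges F W) r xs w" "par r = r" "Suc i < length xs"
  shows "par (xs ! Suc i) = xs ! i"
  using assms(3)
proof (induction i)
  case 0
  have "{xs ! 0, xs ! Suc 0} \<in> F"
    using assms(1) 0 unfolding path_def induced_edges_def by (auto simp: successively_conv_nth)
  moreover have "xs ! 0 = r" using assms(1) hd_conv_nth[of xs] unfolding path_def by metis
  ultimately show ?case using F_edge assms(2) by metis
next
  case (Suc i)
  have "{xs ! Suc i, xs ! Suc (Suc i)} \<in> F"
    using assms(1) Suc.prems unfolding path_def induced_edges_def by (auto simp: successively_conv_nth)
  moreover have "xs ! i \<noteq> xs ! Suc (Suc i)"
    using assms(1) Suc.prems unfolding path_def by (auto simp: nth_eq_iff_index_eq)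
  ultimately show ?case using F_edge[of "xs ! Suc i" "xs ! Suc (Suc i)"] Suc by auto
qed

text \<open>Links the definition of \<open>subtree\<close> by paths from the root with iterated
  parents: read backwards, the path to \<open>w\<close> is its chain of parents.\<close>

lemma path_set:
  assumes "path (induced_edges F W) r xs w" "par r = r"
  shows "set xs = {u. anc u w}"
proof -
  define m where "m = length xs - 1"
  have xs: "xs \<noteq> []" "hd xs = r" "last xs = w" using assms(1) unfolding path_def by auto
  then have len: "length xs = Suc m" unfolding m_def by (cases xs) auto
  have w: "w = xs ! m" using xs by (simp add: last_conv_nth m_def)
  have r: "xs ! 0 = r" using xs by (simp add: hd_conv_nth)
  have k: "(par ^^ k) w = xs ! (m - k)" if "k \<le> m" for k
    using that
  proof (induction k)
    case (Suc k)
    then have "m - k = Suc (m - Suc k)" by simp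
    then show ?case using Suc path_par[OF assms, of "m - Suc k"] len by simp
  qed (simp add: w)
  have "(par ^^ k) w = r" if "m \<le> k" for k
  proof -
    have "(par ^^ k) w = (par ^^ (k - m)) ((par ^^ m) w)"
      using that funpow_add[of "k - m" m par] by simp
    then show ?thesis using k[of m] r funpow_par_root[OF assms(2)] by simp
  qed
  then have "(par ^^ k) w \<in> set xs" for k
    using k[of k] r len by (cases "k \<le> m") (metis diff_le_self le_imp_less_Suc nth_mem, metis nat_le_linear nth_mem zero_less_Suc)
  moreover have "anc (xs ! i) w" if "i < length xs" for i
    using k[of "m - i"] that len unfolding anc_def by (intro exI[of _ "m - i"]) simp
  ultimately show ?thesis unfolding anc_def set_eq_iff mem_Collect_eq by (metis in_set_conv_nth)
qed

lemma path_exists: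
  assumes "w \<in> W" "W \<subseteq> V" "\<forall>x\<in>W. par x \<in> W" "rt w = r"
  shows "\<exists>xs. path (induced_edges F W) r xs w"
  using assms(1,4)
proof (induction "rank w" arbitrary: w rule: less_induct)
  case less
  have wV: "w \<in> V" using less.prems assms(2) by blast
  show ?case
  proof (cases "par w = w")
    case True
    then have "w = r" using rt_root less.prems by simp
    then have "path (induced_edges F W) r [w] w" unfolding path_def by simp
    then show ?thesis by blast
  next
    case False
    then have "\<exists>xs. path (induced_edges F W) r xs (par w)"
      using less rank_par[OF wV] assms(3) rt_par[OF wV] by simp
    then obtain xs where xs: "path (induced_edges F W) r xs (par w)" by blast
    have "par r = r" using par_rt[OF wV] less.prems by simp
    then have "w \<notin> set xs" using path_set[OF xs] anc_par_self[OF wV False] by simp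
    moreover have "{par w, w} \<in> induced_edges F W"
      using less.prems assms(3) wV False F_edge[of "par w" w] unfolding induced_edges_def by auto
    ultimately have "path (induced_edges F W) r (xs @ [w]) w"
      using xs unfolding path_def by (auto simp: successively_append_iff)
    then show ?thesis by blast
  qed
qed

definition sub :: "'a set \<Rightarrow> 'a \<Rightarrow> 'a set" where
  "sub W u = {w \<in> W. anc u w}"

lemma subtree_eq:
  assumes "W \<subseteq> V" "\<forall>x\<in>W. par x \<in> W" "\<forall>x\<in>W. rt x = r" "par r = r"
  shows "subtree F r W u = sub W u"
proof -
  have "(\<exists>xs. path (induced_edges F W) r xs w \<and> u \<in> set xs) \<longleftrightarrow> anc u w" if "w \<in> W" for w
    using path_exists[OF that assms(1,2) bspec[OF assms(3) that]] path_set[OF _ assms(4)] by blast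
  then show ?thesis unfolding subtree_def sub_def by blast
qed

lemma children_eq:
  assumes "W \<subseteq> V" "\<forall>x\<in>W. par x \<in> W" "\<forall>x\<in>W. rt x = r" "par r = r"
  shows "children F r W u = {w \<in> W. par w = u \<and> w \<noteq> u}"
proof -
  have "anc u w \<and> {u, w} \<in> F \<longleftrightarrow> par w = u \<and> w \<noteq> u" if "w \<in> W" for w
  proof -
    have "w \<in> V" using that assms(1) by blast
    then show ?thesis using F_edge[of u w] anc_par[of w] anc_par_self[of u] by metis
  qed
  moreover have "subtree F r W u = sub W u" by (rule subtree_eq[OF assms])
  ultimately show ?thesis unfolding children_def sub_def by blast
qed

lemma sub_subset: "sub W u \<subseteq> W"
  unfolding sub_def by blast

text \<open>A vertex at depth three or more below \<open>u\<close>, or two children of the same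
  child of \<open>u\<close>, would give the subtree of that child three vertices.\<close>

lemma sub_spider_aux:
  assumes "W \<subseteq> V" "\<forall>x\<in>W. par x \<in> W" "u \<in> W"
    and small: "\<forall>x\<in>W. par x = u \<and> x \<noteq> u \<longrightarrow> card (sub W x) \<le> 2"
  shows "\<And>w. w \<in> sub W u \<Longrightarrow> w \<noteq> u \<Longrightarrow>
      par w \<in> sub W u \<and> par w \<noteq> w \<and> (par w = u \<or> par (par w) = u)"
    and "\<And>w w'. \<lbrakk> w \<in> sub W u; w' \<in> sub W u; w \<noteq> u; w' \<noteq> u; par w = par w'; par w \<noteq> u \<rbrakk> \<Longrightarrow> w = w'"
proof -
  have finW: "finite W" using assms(1) fin finite_subset by blast
  have three: "x = y \<or> x = z \<or> y = z"
    if "c \<in> W" "par c = u" "c \<noteq> u" "x \<in> sub W c" "y \<in> sub W c" "z \<in> sub W c" for c x y z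
  proof (rule ccontr)
    assume "\<not> ?thesis"
    then have "card {x, y, z} = 3" by auto
    moreover have "card {x, y, z} \<le> card (sub W c)"
      using that(4-6) finite_subset[OF sub_subset finW] by (intro card_mono) auto
    ultimately show False using small that(1-3) by auto
  qed
  show 1: "par w \<in> sub W u \<and> par w \<noteq> w \<and> (par w = u \<or> par (par w) = u)"
    if w: "w \<in> sub W u" "w \<noteq> u" for w
  proof -
    have wW: "w \<in> W" "anc u w" using w(1) unfolding sub_def by auto
    have ne: "par w \<noteq> w" using anc_of_root[of w u] wW w(2) by blast
    have pw: "par w \<in> sub W u"
      using bspec[OF assms(2) wW(1)] anc_step[OF wW(2)] w(2) unfolding sub_def by auto
    obtain k where k: "(par ^^ Suc k) w = u" "(par ^^ k) w \<noteq> u"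
      using anc_child[OF wW(2)] w(2) by blast
    define c where "c = (par ^^ k) w"
    have c: "par c = u" "c \<noteq> u" "anc c w" using k unfolding c_def anc_def by auto
    have cW: "c \<in> W" unfolding c_def using wW(1) assms(2) by (induction k) auto
    have "c = w \<or> c = par w"
    proof (rule ccontr)
      assume n: "\<not> ?thesis"
      then have "anc c (par w)" using anc_step[OF c(3)] by blast
      then have "w \<in> sub W c" "par w \<in> sub W c" "c \<in> sub W c"
        using c(3) wW(1) assms(2) cW anc_refl unfolding sub_def by auto
      from three[OF cW c(1,2) this] n ne show False by auto
    qed
    then show ?thesis using c(1) pw ne by auto
  qed
  show "w = w'" if w: "w \<in> sub W u" "w' \<in> sub W u" "w \<noteq> u" "w' \<noteq> u" "par w = par w'" "par w \<noteq> u" for w w'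
  proof -
    have p: "par (par w) = u" "par w \<in> W" "par w \<noteq> w" "par w \<noteq> w'"
      using 1[OF w(1,3)] 1[OF w(2,4)] w(5,6) sub_subset by auto
    have "w \<in> sub W (par w)" "w' \<in> sub W (par w)" "par w \<in> sub W (par w)"
      using w anc_par[of w] anc_par[of w'] anc_refl p(2) unfolding sub_def by auto
    from three[OF p(2,1) w(6) this] p show ?thesis by auto
  qed
qed

lemma sub_edges:
  assumes "W \<subseteq> V" "\<forall>x\<in>W. par x \<in> W" "u \<in> W"
  shows "induced_edges F (sub W u) = {{w, par w} |w. w \<in> sub W u \<and> w \<noteq> u}"
proof
  have uV: "u \<in> V" using assms by blast
  show "induced_edges F (sub W u) \<subseteq> {{w, par w} |w. w \<in> sub W u \<and> w \<noteq> u}"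
  proof
    fix e assume "e \<in> induced_edges F (sub W u)"
    then obtain y where y: "e = {y, par y}" "y \<in> V" "par y \<noteq> y" "y \<in> sub W u" "par y \<in> sub W u"
      unfolding induced_edges_def F_def by auto
    have "y \<noteq> u" using anc_par_self[OF uV] y(3,5) unfolding sub_def by blast
    then show "e \<in> {{w, par w} |w. w \<in> sub W u \<and> w \<noteq> u}" using y by blast
  qed
  show "{{w, par w} |w. w \<in> sub W u \<and> w \<noteq> u} \<subseteq> induced_edges F (sub W u)"
  proof
    fix e assume "e \<in> {{w, par w} |w. w \<in> sub W u \<and> w \<noteq> u}"
    then obtain w where w: "e = {w, par w}" "w \<in> W" "anc u w" "w \<noteq> u" unfolding sub_def by blast
    have "par w \<noteq> w" using anc_of_root[of w u] w by blast
    moreover have "par w \<in> sub W u"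
      using bspec[OF assms(2) w(2)] anc_step[OF w(3)] w(4) unfolding sub_def by auto
    moreover have "w \<in> sub W u" using w unfolding sub_def by blast
    moreover have "w \<in> V" using w(2) assms(1) by blast
    ultimately show "e \<in> induced_edges F (sub W u)" using w(1) unfolding induced_edges_def F_def by blast
  qed
qed

lemma sub_spider:
  assumes "W \<subseteq> V" "\<forall>x\<in>W. par x \<in> W" "u \<in> W"
    and "\<forall>x\<in>W. par x = u \<and> x \<noteq> u \<longrightarrow> card (sub W x) \<le> 2"
  shows "spider F (sub W u) u"
proof (rule spiderI[where \<pi> = par])
  show "finite (sub W u)" by (rule finite_subset[OF sub_subset finite_subset[OF assms(1) fin]])
  show "u \<in> sub W u" using assms(3) anc_refl unfolding sub_def by blast
qed (use sub_spider_aux[OF assms] sub_edges[OF assms(1-3)] in auto)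

text \<open>If at most two vertices remain besides the subtree of \<open>u\<close>, they form one further leg of the
  spider, which starts with the parent of \<open>u\<close>.\<close>

lemma whole_spider:
  assumes W: "W \<subseteq> V" "\<forall>x\<in>W. par x \<in> W" "u \<in> W"
    and small: "\<forall>x\<in>W. par x = u \<and> x \<noteq> u \<longrightarrow> card (sub W x) \<le> 2"
    and r: "\<forall>x\<in>W. rt x = r" "r \<in> W" and R: "0 < card (W - sub W u)" "card (W - sub W u) < 3"
  shows "spider F W u"
proof -
  let ?S = "sub W u"
  define q where "q = par u"
  have finW: "finite W" using W(1) fin finite_subset by blast
  have rr: "par r = r" using par_rt[of r] r W(1) by auto
  have uV: "u \<in> V" using W by blast
  have S: "x \<in> ?S \<longleftrightarrow> x \<in> W \<and> anc u x" for x unfolding sub_def by blast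
  have "u \<noteq> r"
  proof
    assume "u = r"
    then have "anc u x" if "x \<in> W" for x using r(1) anc_rt[of x] that by auto
    then have "W - ?S = {}" unfolding sub_def by blast
    then have "card (W - ?S) = 0" by (simp only: card.empty)
    then show False using R(1) by simp
  qed
  then have nr: "par u \<noteq> u" using rt_root[of u] bspec[OF r(1) W(3)] by auto
  have q: "q \<in> W - ?S" using W(2,3) anc_par_self[OF uV nr] S unfolding q_def by blast
  have up: "par x \<in> W - ?S" if "x \<in> W - ?S" for x
    using that W(2) anc_trans_par[of u x] S by blast
  \<comment> \<open>At most two vertices remain and they are closed under parents. If
    \<open>x\<close> and \<open>q\<close> were not adjacent, both would be their own parents, but
    \<open>r\<close> is the only root.\<close>
  have other: "par q = x \<or> par x = q" if x: "x \<in> W - ?S" "x \<noteq> q" for x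
  proof (rule ccontr)
    assume n: "\<not> ?thesis"
    have two: "y = q \<or> y = x" if "y \<in> W - ?S" for y
    proof (rule ccontr)
      assume "\<not> ?thesis"
      then have "card {y, q, x} = 3" using x(2) by auto
      moreover have "card {y, q, x} \<le> card (W - ?S)" using that x q finW by (intro card_mono) auto
      ultimately show False using R(2) by simp
    qed
    have "par q = q" using two[OF up[OF q]] n by blast
    moreover have "par x = x" using two[OF up[OF x(1)]] n by blast
    ultimately have "q = r" "x = r" using rt_root[of q] rt_root[of x] r(1) q x by auto
    then show False using x by simp
  qed
  have one: "x = y" if "x \<in> W - ?S" "x \<noteq> q" "y \<in> W - ?S" "y \<noteq> q" for x y
  proof (rule ccontr)
    assume "x \<noteq> y"
    then have "card {x, y, q} = 3" using that by auto
    moreover have "card {x, y, q} \<le> card (W - ?S)" using that q finW by (intro card_mono) auto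
    ultimately show False using R(2) by simp
  qed
  \<comment> \<open>Re-rooting at \<open>u\<close>: inside the subtree parents are kept,
    \<open>q\<close> now leads to \<open>u\<close>, and a further vertex leads to \<open>q\<close>,
    whether it was the parent or a child of \<open>q\<close>.\<close>
  define \<pi> where "\<pi> w = (if w \<in> ?S then par w else if w = q then u else q)" for w
  note aux = sub_spider_aux[OF W small]
  have uS: "u \<in> ?S" using S W(3) anc_refl by blast
  have \<pi>S: "\<pi> w = par w" if "w \<in> ?S" for w using that by (simp add: \<pi>_def)
  have \<pi>q: "\<pi> q = u" using q by (simp add: \<pi>_def)
  have \<pi>x: "\<pi> x = q" if "x \<in> W - ?S" "x \<noteq> q" for x using that by (simp add: \<pi>_def)
  have qu: "q \<noteq> u" using q uS by blast
  show ?thesis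
  proof (rule spiderI[where \<pi> = \<pi>])
    show "finite W" by (rule finW)
    show "u \<in> W" by (rule W)
    fix w assume w: "w \<in> W" "w \<noteq> u"
    show "\<pi> w \<in> W \<and> \<pi> w \<noteq> w \<and> (\<pi> w = u \<or> \<pi> (\<pi> w) = u)"
    proof (cases "w \<in> ?S")
      case True
      then show ?thesis using aux(1)[OF True w(2)] \<pi>S S by auto
    next
      case False
      then show ?thesis using w \<pi>q \<pi>x[of w] q W(3) by (cases "w = q") auto
    qed
  next
    fix w w' assume w: "w \<in> W" "w' \<in> W" "w \<noteq> u" "w' \<noteq> u" "\<pi> w = \<pi> w'" "\<pi> w \<noteq> u"
    have inS: "\<pi> y \<in> ?S" if "y \<in> ?S" "y \<noteq> u" for y using aux(1)[OF that] \<pi>S[OF that(1)] by simp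
    have notS: "y \<in> W - ?S \<and> y \<noteq> q \<and> \<pi> y = q" if "y \<in> W" "y \<notin> ?S" "\<pi> y \<noteq> u" for y
      using that \<pi>q \<pi>x[of y] by auto
    show "w = w'"
    proof (cases "w \<in> ?S")
      case True
      then have "w' \<in> ?S" using inS[OF True w(3)] notS[OF w(2)] w(5,6) q by auto
      then show ?thesis using aux(2)[OF True _ w(3,4)] w(5,6) \<pi>S True by auto
    next
      case False
      then have "w' \<notin> ?S" using inS[of w'] w notS[OF w(1)] q by auto
      then show ?thesis using one[of w w'] notS[of w] notS[of w'] False w by auto
    qed
  next
    show "induced_edges F W = {{w, \<pi> w} |w. w \<in> W \<and> w \<noteq> u}"
    proof
      show "induced_edges F W \<subseteq> {{w, \<pi> w} |w. w \<in> W \<and> w \<noteq> u}"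
      proof
        fix e assume "e \<in> induced_edges F W"
        then obtain y where y: "e = {y, par y}" "par y \<noteq> y" "y \<in> W" "par y \<in> W"
          unfolding induced_edges_def F_def by auto
        \<comment> \<open>Each edge is assigned to its end farther from \<open>u\<close>. Above
          \<open>u\<close> this end can be the parent, so the first and the third case exchange the
          two ends.\<close>
        consider "y = u" | "y \<in> ?S" "y \<noteq> u" | "y = q" | "y \<in> W - ?S" "y \<noteq> q" using y by blast
        then have "\<exists>w. e = {w, \<pi> w} \<and> w \<in> W \<and> w \<noteq> u"
        proof cases
          case 1
          then have "e = {q, \<pi> q}" using y \<pi>q unfolding q_def by (simp add: insert_commute)
          then show ?thesis using q qu by blast
        next
          case 2
          then show ?thesis using y \<pi>S by (intro exI[of _ y]) simp
        next
          case 3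
          then have p: "par q \<in> W - ?S" "par q \<noteq> q" using up[OF q] y by auto
          then have "e = {par q, \<pi> (par q)}" using y 3 \<pi>x[OF p] by (simp add: insert_commute)
          then show ?thesis using p uS by blast
        next
          case 4
          then have "par y = q"
            using one[of "par y" y] up[of y] y(2) by blast
          then have "e = {y, \<pi> y}" using y \<pi>x[OF 4] by simp
          then show ?thesis using 4 uS by blast
        qed
        then show "e \<in> {{w, \<pi> w} |w. w \<in> W \<and> w \<noteq> u}" by blast
      qed
      show "{{w, \<pi> w} |w. w \<in> W \<and> w \<noteq> u} \<subseteq> induced_edges F W"
      proof
        fix e assume "e \<in> {{w, \<pi> w} |w. w \<in> W \<and> w \<noteq> u}"
        then obtain w where w: "e = {w, \<pi> w}" "w \<in> W" "w \<noteq> u" by blast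
        have edge: "{x, par x} \<in> induced_edges F W" if "x \<in> W" "par x \<noteq> x" for x
          using that W unfolding induced_edges_def F_def by blast
        show "e \<in> induced_edges F W"
        proof (cases "w \<in> ?S")
          case True
          then show ?thesis using aux(1)[OF True w(3)] \<pi>S edge[OF w(2)] w(1) by simp
        next
          case False
          show ?thesis
          proof (cases "w = q")
            case True
            then show ?thesis using edge[OF W(3) nr] w(1) \<pi>q unfolding q_def by (simp add: insert_commute)
          next
            case ne: False
            then have "par q = w \<or> par w = q" using other[of w] w False by blast
            then show ?thesis
              using edge[of q] edge[of w] w \<pi>x[of w] False ne q by (auto simp: insert_commute)
          qed
        qed
      qed
    qed
  qed
qed

end

section \<open>Cutting all trees of a forest at once\<close>

context rooted_forest
begin

text \<open>The condition of \<open>decomposition_loop\<close> for cutting at \<open>u\<close>,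
  where \<open>W\<close> is what remains of the whole forest instead of one tree.\<close>

definition gd :: "'a set \<Rightarrow> 'a \<Rightarrow> bool" where
  "gd W u \<longleftrightarrow> u \<in> W \<and> 3 \<le> card (sub W u) \<and> (\<forall>x\<in>W. par x = u \<and> x \<noteq> u \<longrightarrow> card (sub W x) \<le> 2)"

definition pc :: "'a set \<Rightarrow> 'a \<Rightarrow> 'a set" where
  "pc W u = (if 0 < card (sub W (rt u) - sub W u) \<and> card (sub W (rt u) - sub W u) < 3
     then sub W (rt u) else sub W u)"

definition tree :: "'a set \<Rightarrow> 'a \<Rightarrow> 'a set" where
  "tree W r = {w \<in> W. rt w = r}"

text \<open>Cutting removes whole subtrees or whole trees, so this property survives and keeps every
  remaining vertex joined to its root.\<close>

definition par_closed :: "'a set \<Rightarrow> bool" where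
  "par_closed W \<longleftrightarrow> W \<subseteq> V \<and> (\<forall>x\<in>W. par x \<in> W)"

lemma finite_closed: "par_closed W \<Longrightarrow> finite W"
  unfolding par_closed_def using fin finite_subset by blast

lemma closed_rt:
  assumes "par_closed W" "w \<in> W"
  shows "rt w \<in> W"
proof -
  have "(par ^^ k) w \<in> W" for k
    by (induction k) (use assms in \<open>auto simp: par_closed_def\<close>)
  then show ?thesis unfolding rt_def .
qed

lemma closed_tree: "par_closed W \<Longrightarrow> par_closed (tree W r)"
  unfolding par_closed_def tree_def using rt_par by auto

lemma rt_rt: "w \<in> V \<Longrightarrow> rt (rt w) = rt w"
  using rt_root par_rt by blast

lemma sub_rt:
  assumes "par_closed W" "u \<in> V"
  shows "sub W (rt u) = tree W (rt u)"
proof -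
  have "anc (rt u) w \<longleftrightarrow> rt w = rt u" if "w \<in> W" for w
  proof
    have w: "w \<in> V" using that assms(1) unfolding par_closed_def by blast
    show "rt w = rt u" if "anc (rt u) w" using anc_rt_eq[OF w that] rt_rt[OF assms(2)] by simp
    show "anc (rt u) w" if "rt w = rt u" using anc_rt[of w] that by simp
  qed
  then show ?thesis unfolding sub_def tree_def by blast
qed

lemma sub_tree:
  assumes "par_closed W" "x \<in> V"
  shows "sub (tree W (rt x)) x = sub W x"
proof -
  have "rt w = rt x" if "w \<in> W" "anc x w" for w
    using anc_rt_eq[of w x] that assms unfolding par_closed_def by auto
  then show ?thesis unfolding sub_def tree_def by blast
qed

lemma sub_subset_tree:
  assumes "par_closed W" "u \<in> V"
  shows "sub W u \<subseteq> tree W (rt u)"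
  using sub_tree[OF assms] sub_subset[of "tree W (rt u)" u] by simp

lemma pc_cases:
  assumes "par_closed W" "u \<in> W"
  shows "pc W u = (if 0 < card (tree W (rt u) - sub W u) \<and> card (tree W (rt u) - sub W u) < 3
     then tree W (rt u) else sub W u)"
proof -
  have "u \<in> V" using assms unfolding par_closed_def by blast
  then show ?thesis unfolding pc_def using sub_rt[OF assms(1), of u] by simp
qed

lemma pc_props:
  assumes "par_closed W" "u \<in> W"
  shows "u \<in> pc W u" "pc W u \<subseteq> tree W (rt u)" "par_closed (W - pc W u)"
proof -
  have uV: "u \<in> V" using assms unfolding par_closed_def by blast
  have S: "sub W u \<subseteq> tree W (rt u)" by (rule sub_subset_tree[OF assms(1) uV])
  have uS: "u \<in> sub W u" using assms(2) anc_refl unfolding sub_def by blast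
  show "u \<in> pc W u" using S uS unfolding pc_cases[OF assms] by auto
  show "pc W u \<subseteq> tree W (rt u)" using S unfolding pc_cases[OF assms] by auto
  show "par_closed (W - pc W u)"
  proof -
    have "par x \<notin> tree W (rt u)" if "x \<in> W - tree W (rt u)" for x
      using that rt_par[of x] assms(1) unfolding tree_def par_closed_def by auto
    moreover have "par x \<notin> sub W u" if "x \<in> W - sub W u" for x
      using that anc_trans_par[of u x] unfolding sub_def by blast
    ultimately show ?thesis
      using assms(1) unfolding pc_cases[OF assms] par_closed_def by auto
  qed
qed

text \<open>Among the vertices whose subtree has at least three vertices, one of maximal rank works,
  since its children have larger rank.\<close>

lemma exists_gd:
  assumes "par_closed W" "3 \<le> card (tree W r)"
  shows "\<exists>u. gd W u"
proof -
  let ?Z = "{u \<in> W. 3 \<le> card (sub W u)}"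
  have "tree W r \<noteq> {}" using assms(2) by auto
  then obtain w where w: "w \<in> W" "rt w = r" unfolding tree_def by blast
  have wV: "w \<in> V" using w assms(1) unfolding par_closed_def by blast
  have "r \<in> W" using closed_rt[OF assms(1) w(1)] w(2) by simp
  moreover have "sub W r = tree W r" using sub_rt[OF assms(1) wV] w(2) by simp
  ultimately have "r \<in> ?Z" using assms(2) by simp
  then have "rank ` ?Z \<noteq> {}" by blast
  moreover have f: "finite (rank ` ?Z)" using finite_closed[OF assms(1)] by simp
  ultimately have "Max (rank ` ?Z) \<in> rank ` ?Z" by (intro Max_in)
  then obtain u where u: "u \<in> ?Z" "rank u = Max (rank ` ?Z)" by auto
  have "card (sub W x) \<le> 2" if x: "x \<in> W" "par x = u" "x \<noteq> u" for x
  proof (rule ccontr)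
    assume "\<not> ?thesis"
    then have "x \<in> ?Z" using x by simp
    then have "rank x \<in> rank ` ?Z" by (rule imageI)
    then have "rank x \<le> rank u" unfolding u(2) by (rule Max_ge[OF f])
    moreover have "x \<in> V" using x(1) assms(1) unfolding par_closed_def by blast
    ultimately show False using rank_par[of x] x by auto
  qed
  then show ?thesis using u(1) unfolding gd_def by blast
qed

text \<open>\<open>lb\<close> labels the vertices with the chosen vertex of their piece, and vertices outside the pieces
  with \<open>none\<close>.\<close>

definition dec_ok :: "'a \<Rightarrow> 'a set \<Rightarrow> ('a \<Rightarrow> 'a) \<Rightarrow> bool" where
  "dec_ok none W lb \<longleftrightarrow>
     (\<forall>w\<in>W. lb w = none \<or> lb w \<in> W \<and> rt (lb w) = rt w) \<and>
     (\<forall>r. tree W r = {} \<or> 3 \<le> card (tree W r) \<longrightarrow>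
        (\<forall>w\<in>tree W r. lb w \<noteq> none) \<and>
        decomposition_loop F r (tree W r) ((\<lambda>u. {w \<in> W. lb w = u}) ` lb ` tree W r) \<and>
        (\<forall>u\<in>lb ` tree W r. spider F {w \<in> W. lb w = u} u)) \<and>
     (\<forall>r. card (tree W r) < 3 \<longrightarrow> (\<forall>w\<in>tree W r. lb w = none))"

lemma dec_ok_stop:
  assumes "par_closed W" "\<And>u. \<not> gd W u" "\<And>w. w \<in> W \<Longrightarrow> lb w = none"
  shows "dec_ok none W lb"
proof -
  have "card (tree W r) < 3" for r using exists_gd[OF assms(1), of r] assms(2) by (meson not_le)
  then have e: "tree W r = {}" if "tree W r = {} \<or> 3 \<le> card (tree W r)" for r using that by (meson leD)
  have "\<forall>w\<in>tree W r. lb w = none" for r using assms(3) unfolding tree_def by blast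
  moreover have "(\<forall>w\<in>tree W r. lb w \<noteq> none) \<and>
        decomposition_loop F r (tree W r) ((\<lambda>u. {w \<in> W. lb w = u}) ` lb ` tree W r) \<and>
        (\<forall>u\<in>lb ` tree W r. spider F {w \<in> W. lb w = u} u)"
    if "tree W r = {} \<or> 3 \<le> card (tree W r)" for r
    unfolding e[OF that] by (simp add: decomposition_loop.empty)
  ultimately show ?thesis unfolding dec_ok_def using assms(3) by blast
qed

lemma pc_spider:
  assumes "par_closed W" "gd W u"
  shows "spider F (pc W u) u"
proof -
  have W: "W \<subseteq> V" "\<forall>x\<in>W. par x \<in> W" using assms(1) unfolding par_closed_def by auto
  have u: "u \<in> W" "\<forall>x\<in>W. par x = u \<and> x \<noteq> u \<longrightarrow> card (sub W x) \<le> 2"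
    using assms(2) unfolding gd_def by auto
  have uV: "u \<in> V" using u W by blast
  let ?T = "tree W (rt u)"
  show ?thesis
  proof (cases "0 < card (?T - sub W u) \<and> card (?T - sub W u) < 3")
    case True
    have T: "?T \<subseteq> V" "\<forall>x\<in>?T. par x \<in> ?T" using closed_tree[OF assms(1)] unfolding par_closed_def by auto
    have uT: "u \<in> ?T" using u(1) unfolding tree_def by blast
    have subT: "sub ?T x = sub W x" if "x \<in> ?T" for x
    proof -
      have "x \<in> V" "rt x = rt u" using that W unfolding tree_def by auto
      then show ?thesis using sub_tree[OF assms(1), of x] by simp
    qed
    have "spider F ?T u"
    proof (rule whole_spider[OF T uT])
      show "\<forall>x\<in>?T. par x = u \<and> x \<noteq> u \<longrightarrow> card (sub ?T x) \<le> 2"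
        using u(2) subT unfolding tree_def by auto
      show "\<forall>x\<in>?T. rt x = rt u" unfolding tree_def by blast
      show "rt u \<in> ?T" using closed_rt[OF assms(1) u(1)] rt_rt[OF uV] unfolding tree_def by simp
      show "0 < card (?T - sub ?T u)" "card (?T - sub ?T u) < 3" using True subT[OF uT] by auto
    qed
    then show ?thesis unfolding pc_cases[OF assms(1) u(1)] using True by simp
  next
    case False
    then show ?thesis unfolding pc_cases[OF assms(1) u(1)] using sub_spider[OF W u] by auto
  qed
qed

text \<open>Trees other than that of \<open>u\<close> do not change. In the tree of
  \<open>u\<close>, the rule for small remainders leaves either nothing or at least three vertices,
  so \<open>ok\<close> supplies a loop for the rest and one step is put in front of it.\<close>

lemma dec_ok_cut:
  assumes W: "par_closed W" and u: "gd W u" and ok: "dec_ok none (W - pc W u) lb"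
    and lu: "\<And>w. w \<in> pc W u \<Longrightarrow> lb w = u" and none: "none \<notin> V"
  shows "dec_ok none W lb"
proof -
  let ?X = "pc W u" and ?S = "sub W u"
  let ?W' = "W - ?X"
  have WV: "W \<subseteq> V" and uW: "u \<in> W" using W u unfolding par_closed_def gd_def by auto
  have uV: "u \<in> V" using uW WV by blast
  note X = pc_props[OF W uW]
  have XW: "?X \<subseteq> W" using X(2) unfolding tree_def by blast
  have un: "u \<noteq> none" using uV none by blast
  have SX: "?S \<subseteq> tree W (rt u)" by (rule sub_subset_tree[OF W uV])
  have ok1: "lb w = none \<or> lb w \<in> ?W' \<and> rt (lb w) = rt w" if "w \<in> ?W'" for w
    using ok that unfolding dec_ok_def by blast
  have ok2: "(\<forall>w\<in>tree ?W' r. lb w \<noteq> none) \<and>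
        decomposition_loop F r (tree ?W' r) ((\<lambda>u. {w \<in> ?W'. lb w = u}) ` lb ` tree ?W' r) \<and>
        (\<forall>u\<in>lb ` tree ?W' r. spider F {w \<in> ?W'. lb w = u} u)"
    if "tree ?W' r = {} \<or> 3 \<le> card (tree ?W' r)" for r
    using ok that unfolding dec_ok_def by blast
  have ok3: "\<forall>w\<in>tree ?W' r. lb w = none" if "card (tree ?W' r) < 3" for r
    using ok that unfolding dec_ok_def by blast
  have treeW': "tree ?W' r = tree W r" if "r \<noteq> rt u" for r
    using X(2) that unfolding tree_def by blast
  have cardT: "3 \<le> card (tree W (rt u))"
    using card_mono[OF finite_subset[OF _ finite_closed[OF W]] SX] u unfolding tree_def gd_def by auto
  have same: "{w \<in> W. lb w = v} = {w \<in> ?W'. lb w = v}" if "v \<noteq> u" for v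
    using that lu by blast
  have lu': "{w \<in> W. lb w = u} = ?X"
    using lu ok1 un X(1) XW by blast
  \<comment> \<open>A label occurring in the rest is a vertex of the rest, whereas \<open>u\<close>
    has been removed.\<close>
  have lab_ne: "v \<noteq> u" if v: "v \<in> lb ` tree ?W' r" "tree ?W' r = {} \<or> 3 \<le> card (tree ?W' r)" for v r
  proof -
    obtain w where w: "w \<in> tree ?W' r" "v = lb w" using v(1) by blast
    then have "lb w \<noteq> none" "w \<in> ?W'" using ok2[OF v(2)] unfolding tree_def by auto
    then have "lb w \<in> ?W'" using ok1 by blast
    then show ?thesis using w(2) X(1) by blast
  qed
  have big: "(\<forall>w\<in>tree W r. lb w \<noteq> none) \<and>
        decomposition_loop F r (tree W r) ((\<lambda>u. {w \<in> W. lb w = u}) ` lb ` tree W r) \<and>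
        (\<forall>u\<in>lb ` tree W r. spider F {w \<in> W. lb w = u} u)"
    if r: "tree W r = {} \<or> 3 \<le> card (tree W r)" for r
  proof (cases "r = rt u")
    case False
    have r': "tree ?W' r = {} \<or> 3 \<le> card (tree ?W' r)" using r treeW'[OF False] by simp
    have "(\<lambda>u. {w \<in> W. lb w = u}) ` lb ` tree W r = (\<lambda>u. {w \<in> ?W'. lb w = u}) ` lb ` tree ?W' r"
      unfolding treeW'[OF False, symmetric] using same lab_ne[OF _ r'] by (intro image_cong) auto
    moreover have "\<forall>u\<in>lb ` tree W r. spider F {w \<in> W. lb w = u} u"
    proof
      fix v assume "v \<in> lb ` tree W r"
      then have v: "v \<in> lb ` tree ?W' r" unfolding treeW'[OF False] .
      then show "spider F {w \<in> W. lb w = v} v"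
        unfolding same[OF lab_ne[OF v r']] using ok2[OF r'] v by blast
    qed
    ultimately show ?thesis using ok2[OF r'] unfolding treeW'[OF False] by simp
  next
    case True
    let ?T = "tree W r"
    have T': "tree ?W' r = ?T - ?X" unfolding tree_def by blast
    have XT: "?X \<subseteq> ?T" using X(2) True by simp
    \<comment> \<open>The case distinction mirrors the loop: a remainder of one or two vertices is
      swallowed by the piece.\<close>
    have r': "tree ?W' r = {} \<or> 3 \<le> card (tree ?W' r)"
    proof (cases "0 < card (?T - ?S) \<and> card (?T - ?S) < 3")
      case True
      then have "?X = ?T" unfolding pc_cases[OF W uW] using \<open>r = rt u\<close> by simp
      then show ?thesis unfolding T' by simp
    next
      case False
      then have "?X = ?S" unfolding pc_cases[OF W uW] using \<open>r = rt u\<close> by auto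
      moreover have "finite (?T - ?S)" using finite_closed[OF closed_tree[OF W]] by simp
      ultimately show ?thesis using False unfolding T' by (metis card_gt_0_iff not_le)
    qed
    have clT: "?T \<subseteq> V" "\<forall>x\<in>?T. par x \<in> ?T" using closed_tree[OF W] unfolding par_closed_def by auto
    have rr: "\<forall>x\<in>?T. rt x = r" "par r = r" using True par_rt[OF uV] unfolding tree_def by auto
    have uT: "u \<in> ?T" using uW True unfolding tree_def by blast
    have subT: "sub ?T x = sub W x" if "x \<in> ?T" for x
    proof -
      have "x \<in> V" "rt x = r" using that WV unfolding tree_def by auto
      then show ?thesis using sub_tree[OF W, of x] by simp
    qed
    have St: "subtree F r ?T u = ?S" using subtree_eq[OF clT rr] subT[OF uT] by simp
    have small: "\<forall>c\<in>children F r ?T u. card (subtree F r ?T c) \<le> 2"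
    proof
      fix c assume "c \<in> children F r ?T u"
      then have c: "c \<in> ?T" "par c = u" "c \<noteq> u" using children_eq[OF clT rr] by auto
      then have "c \<in> W" unfolding tree_def by blast
      then have "card (sub W c) \<le> 2" using u c unfolding gd_def by blast
      then show "card (subtree F r ?T c) \<le> 2" using subtree_eq[OF clT rr] subT[OF c(1)] by simp
    qed
    let ?P = "(\<lambda>u. {w \<in> ?W'. lb w = u}) ` lb ` tree ?W' r"
    have loop: "decomposition_loop F r ?T (insert ?X ?P)"
    proof (rule decomposition_loop.step[OF uT St[symmetric] _ small])
      show "3 \<le> card ?S" using u unfolding gd_def by blast
      show "?X = (if 0 < card (?T - ?S) \<and> card (?T - ?S) < 3 then ?T else ?S)"
        unfolding pc_cases[OF W uW] using True by simp
      show "decomposition_loop F r (?T - ?X) ?P" using ok2[OF r'] unfolding T' by blast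
    qed
    have lT: "lb ` ?T = insert u (lb ` tree ?W' r)"
    proof -
      have "?T = ?X \<union> tree ?W' r" unfolding T' using XT by blast
      moreover have "lb ` ?X = {u}" using lu X(1) by auto
      ultimately show ?thesis by (metis image_Un insert_is_Un)
    qed
    have sm: "{w \<in> W. lb w = v} = {w \<in> ?W'. lb w = v}" if "v \<in> lb ` tree ?W' r" for v
      using same lab_ne[OF that r'] by blast
    have "(\<lambda>u. {w \<in> W. lb w = u}) ` lb ` ?T = insert ?X ?P"
    proof -
      have "(\<lambda>u. {w \<in> W. lb w = u}) ` lb ` tree ?W' r = ?P" using sm by (intro image_cong) auto
      then show ?thesis unfolding lT by (simp add: lu')
    qed
    moreover have "\<forall>v\<in>lb ` ?T. spider F {w \<in> W. lb w = v} v"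
      unfolding lT using ok2[OF r'] sm lu' pc_spider[OF W u] by auto
    moreover have "\<forall>w\<in>?T. lb w \<noteq> none" using ok2[OF r'] lu un unfolding T' by blast
    ultimately show ?thesis using loop by simp
  qed
  have "lb w = none \<or> lb w \<in> W \<and> rt (lb w) = rt w" if "w \<in> W" for w
  proof (cases "w \<in> ?X")
    case True
    then show ?thesis using lu[OF True] uW X(2) unfolding tree_def by auto
  next
    case False
    then show ?thesis using ok1[of w] that by blast
  qed
  moreover have "\<forall>w\<in>tree W r. lb w = none" if "card (tree W r) < 3" for r
  proof -
    have "r \<noteq> rt u" using that cardT by auto
    then show ?thesis using ok3[of r] treeW'[of r] that by simp
  qed
  ultimately show ?thesis unfolding dec_ok_def using big by blast
qed

end

subsection \<open>Polynomial time computable functions\<close>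

text \<open>Encodings are attached to types, so that polynomial time can be stated for HOL functions
  between arbitrary encodable types.\<close>

class enc =
  fixes enc :: "'a \<Rightarrow> val"

instantiation bool :: enc
begin
definition enc_bool_inst: "enc b = enc_bool b"
instance ..
end

instantiation nat :: enc
begin
definition enc_nat_inst: "enc k = enc_nat k"
instance ..
end

instantiation unit :: enc
begin
definition enc_unit_inst: "enc (u :: unit) = Nl"
instance ..
end

instantiation prod :: (enc, enc) enc
begin
definition enc_prod_inst: "enc p = Cell (enc (fst p)) (enc (snd p))"
instance ..
end

instantiation list :: (enc) enc
begin
definition enc_list_inst: "enc xs = enc_list (map enc xs)"
instance ..
end

lemma enc_simps [simp]:
  "enc (a, b) = Cell (enc a) (enc b)"
  "enc ([] :: 'b::enc list) = Nl"
  "enc (x # xs) = Cell (enc x) (enc xs)"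
  "enc (0 :: nat) = Nl"
  "enc (Suc n) = Cell Nl (enc n)"
  "enc True = Cell Nl Nl"
  "enc False = Nl"
  "enc () = Nl"
  by (simp_all add: enc_prod_inst enc_list_inst enc_nat_inst enc_nat_def enc_bool_inst enc_bool_def enc_unit_inst)

lemma enc_eq_Nl_iff [simp]:
  "enc (xs :: 'a::enc list) = Nl \<longleftrightarrow> xs = []"
  "enc b = Nl \<longleftrightarrow> \<not> b"
  "enc (n :: nat) = Nl \<longleftrightarrow> n = 0"
  by (cases xs; cases b; cases n; simp)+

lemma size_enc_nat [simp]: "size (enc (n :: nat)) = n"
  by (induction n) auto

lemma size_enc_bool [simp]: "size (enc (b :: bool)) \<le> 1"
  by (cases b) auto

lemma size_enc_append: "size (enc (xs @ ys)) = size (enc xs) + size (enc ys)"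
  by (induction xs) auto

lemma size_enc_rev: "size (enc (rev xs)) = size (enc xs)"
  by (induction xs) (auto simp: size_enc_append)

lemma length_le_size_enc: "length xs \<le> size (enc xs)"
  by (induction xs) auto

lemma size_enc_elem: "x \<in> set xs \<Longrightarrow> size (enc x) \<le> size (enc xs)"
  by (induction xs) auto

lemma size_enc_list_le:
  assumes "\<And>x. x \<in> set xs \<Longrightarrow> size (enc x) \<le> b" "length xs \<le> m"
  shows "size (enc xs) \<le> m * (b + 1)"
proof -
  have "size (enc xs) \<le> length xs * (b + 1)"
    using assms(1)
  proof (induction xs)
    case (Cons a xs)
    have "size (enc a) \<le> b" "size (enc xs) \<le> length xs * (b + 1)"
      using Cons by auto
    then show ?case by simp
  qed simp
  also have "\<dots> \<le> m * (b + 1)"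
    using assms(2) by (rule mult_right_mono) simp
  finally show ?thesis .
qed

text \<open>The base \<open>n + 2\<close> is at least 2 even for \<open>n = 0\<close>, so a single
  exponent absorbs constants and sums.\<close>

definition poly_bounded :: "(nat \<Rightarrow> nat) \<Rightarrow> bool" where
  "poly_bounded f \<longleftrightarrow> (\<exists>d. \<forall>n. f n \<le> (n + 2) ^ d)"

lemma poly_boundedI: "(\<And>n. f n \<le> (n + 2) ^ d) \<Longrightarrow> poly_bounded f"
  unfolding poly_bounded_def by blast

lemma poly_bounded_const: "poly_bounded (\<lambda>_. c)"
proof (rule poly_boundedI)
  fix n :: nat
  have "c \<le> 2 ^ c" by (simp add: less_imp_le_nat)
  also have "\<dots> \<le> (n + 2) ^ c" by (intro power_mono) auto
  finally show "c \<le> (n + 2) ^ c" .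
qed

lemma poly_bounded_id: "poly_bounded (\<lambda>n. n)"
  by (rule poly_boundedI[of _ 1]) simp

lemma poly_bounded_power: "poly_bounded (\<lambda>n. (n + 2) ^ d)"
  by (rule poly_boundedI[of _ d]) simp

lemma poly_bounded_mono: "poly_bounded g \<Longrightarrow> (\<And>n. f n \<le> g n) \<Longrightarrow> poly_bounded f"
  unfolding poly_bounded_def by (meson le_trans)

lemma poly_bounded_mult:
  assumes "poly_bounded f" "poly_bounded g"
  shows "poly_bounded (\<lambda>n. f n * g n)"
proof -
  obtain a b where "\<forall>n. f n \<le> (n + 2) ^ a" "\<forall>n. g n \<le> (n + 2) ^ b"
    using assms unfolding poly_bounded_def by blast
  then have "\<And>n. f n * g n \<le> (n + 2) ^ (a + b)"
    by (simp add: power_add mult_mono)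
  then show ?thesis by (rule poly_boundedI)
qed

lemma poly_bounded_Suc: "poly_bounded f \<Longrightarrow> poly_bounded (\<lambda>n. f n + 1)"
proof -
  assume "poly_bounded f"
  then obtain a where a: "\<forall>n. f n \<le> (n + 2) ^ a"
    unfolding poly_bounded_def by blast
  have "f n + 1 \<le> (n + 2) ^ Suc a" for n
  proof -
    have "f n \<le> (n + 2) ^ a" "1 \<le> (n + 2) ^ a"
      using a by auto
    then have "f n + 1 \<le> (n + 2) ^ a + (n + 2) ^ a"
      by linarith
    also have "\<dots> \<le> (n + 2) ^ Suc a" by simp
    finally show ?thesis .
  qed
  then show ?thesis by (rule poly_boundedI)
qed

text \<open>Reduced to products by \<open>f n + g n \<le> (f n + 1) * (g n + 1)\<close>.\<close>

lemma poly_bounded_add: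
  assumes "poly_bounded f" "poly_bounded g"
  shows "poly_bounded (\<lambda>n. f n + g n)"
  by (rule poly_bounded_mono[OF poly_bounded_mult[OF assms[THEN poly_bounded_Suc]]]) simp

text \<open>\<open>f\<close> need not be monotone, but its power bound holds at every argument and
  can be evaluated at \<open>g n\<close>.\<close>

lemma poly_bounded_comp:
  assumes "poly_bounded f" "poly_bounded g"
  shows "poly_bounded (\<lambda>n. f (g n))"
proof -
  obtain a where a: "\<forall>n. f n \<le> (n + 2) ^ a"
    using assms unfolding poly_bounded_def by blast
  have "poly_bounded (\<lambda>n. (g n + 2) ^ a)"
  proof (induction a)
    case (Suc a)
    have "poly_bounded (\<lambda>n. (g n + 2) * (g n + 2) ^ a)"
      by (intro poly_bounded_mult poly_bounded_add assms poly_bounded_const Suc)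
    then show ?case by simp
  qed (simp add: poly_bounded_const)
  then show ?thesis by (rule poly_bounded_mono) (use a in simp)
qed

lemmas poly_bounded_intros = poly_bounded_const poly_bounded_id poly_bounded_power
  poly_bounded_add poly_bounded_mult

section \<open>Programs at a base register and closure properties of polynomial time\<close>

text \<open>Registers below the base \<open>k\<close> survive and registers above it are scratch, so that
  programs at different bases compose.\<close>

definition runs :: "com \<Rightarrow> nat \<Rightarrow> store \<Rightarrow> val \<Rightarrow> nat \<Rightarrow> bool" where
  "runs c k s v b \<longleftrightarrow> (\<exists>t s'. exec c s t s' \<and> t \<le> b \<and> s' k = v \<and> (\<forall>i<k. s' i = s i))"

lemma runsI:
  "exec c s t s' \<Longrightarrow> t \<le> b \<Longrightarrow> s' k = v \<Longrightarrow> (\<And>i. i < k \<Longrightarrow> s' i = s i) \<Longrightarrow> runs c k s v b"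
  unfolding runs_def by blast

lemma runsE:
  assumes "runs c k s v b"
  obtains t s' where "exec c s t s'" "t \<le> b" "s' k = v" "\<forall>i<k. s' i = s i"
  using assms unfolding runs_def by blast

lemma runs_mono: "runs c k s v b \<Longrightarrow> b \<le> b' \<Longrightarrow> runs c k s v b'"
  unfolding runs_def using le_trans by blast

lemma exec_AssignI: "teval e s = v \<Longrightarrow> t = tcost e + 1 \<Longrightarrow> exec (Assign i e) s t (s(i := v))"
  using exec.Assign by blast

text \<open>The size bound is a separate clause because the time bound does not imply it:
  \<open>Cell x x\<close> doubles a tree at constant cost. A program is demanded for every base
  \<open>k\<close>, so that programs can be combined without clashes of registers.\<close>

definition PT :: "('a::enc \<Rightarrow> 'b::enc) \<Rightarrow> bool" where
  "PT f \<longleftrightarrow> (\<exists>d. (\<forall>x. size (enc (f x)) \<le> (size (enc x) + 2) ^ d) \<and>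
     (\<forall>k. \<exists>c. \<forall>s x. s k = enc x \<longrightarrow> runs c k s (enc (f x)) ((size (enc x) + 2) ^ d)))"

lemma PTI:
  assumes "poly_bounded b" "poly_bounded b'"
    and "\<And>x. size (enc (f x)) \<le> b (size (enc x))"
    and "\<And>k s x. s k = enc x \<Longrightarrow> runs (c k) k s (enc (f x)) (b' (size (enc x)))"
  shows "PT f"
proof -
  have "poly_bounded (\<lambda>n. b n + b' n)"
    using assms by (intro poly_bounded_add)
  then obtain d where d: "\<forall>n. b n + b' n \<le> (n + 2) ^ d"
    unfolding poly_bounded_def by blast
  then have d1: "b n \<le> (n + 2) ^ d" and d2: "b' n \<le> (n + 2) ^ d" for n
    using add_leD1 add_leD2 by blast+
  show ?thesis
    unfolding PT_def
  proof (intro exI[of _ d] conjI allI)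
    show "size (enc (f x)) \<le> (size (enc x) + 2) ^ d" for x
      using assms(3) d1 le_trans by blast
    fix k
    show "\<exists>c. \<forall>s x. s k = enc x \<longrightarrow> runs c k s (enc (f x)) ((size (enc x) + 2) ^ d)"
      by (intro exI[of _ "c k"] allI impI runs_mono[OF assms(4) d2])
  qed
qed

lemma PTE:
  assumes "PT f"
  obtains d c where
    "\<forall>x. size (enc (f x)) \<le> (size (enc x) + 2) ^ d"
    "\<forall>k s x. s k = enc x \<longrightarrow> runs (c k) k s (enc (f x)) ((size (enc x) + 2) ^ d)"
proof -
  obtain d where d: "\<forall>x. size (enc (f x)) \<le> (size (enc x) + 2) ^ d"
    "\<forall>k. \<exists>c. \<forall>s x. s k = enc x \<longrightarrow> runs c k s (enc (f x)) ((size (enc x) + 2) ^ d)"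
    using assms unfolding PT_def by blast
  from choice[OF d(2)] obtain c where
    "\<forall>k s x. s k = enc x \<longrightarrow> runs (c k) k s (enc (f x)) ((size (enc x) + 2) ^ d)" by blast
  with d(1) show thesis by (rule that)
qed

lemma PT_comp:
  assumes "PT f" "PT g"
  shows "PT (\<lambda>x. f (g x))"
proof -
  obtain a c where "\<forall>x. size (enc (f x)) \<le> (size (enc x) + 2) ^ a"
    "\<forall>k s x. s k = enc x \<longrightarrow> runs (c k) k s (enc (f x)) ((size (enc x) + 2) ^ a)"
    by (rule PTE[OF assms(1)])
  note f = this[rule_format]
  obtain b c' where "\<forall>x. size (enc (g x)) \<le> (size (enc x) + 2) ^ b"
    "\<forall>k s x. s k = enc x \<longrightarrow> runs (c' k) k s (enc (g x)) ((size (enc x) + 2) ^ b)"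
    by (rule PTE[OF assms(2)])
  note g = this[rule_format]
  have *: "(size (enc (g x)) + 2) ^ a \<le> ((size (enc x) + 2) ^ b + 2) ^ a" for x
    using g(1) by (intro power_mono) auto
  have pb: "poly_bounded (\<lambda>n. ((n + 2) ^ b + 2) ^ a)"
    using poly_bounded_comp[OF poly_bounded_power poly_bounded_power] .
  show ?thesis
  proof (rule PTI[OF pb poly_bounded_add[OF poly_bounded_power[of b] pb]])
    show "size (enc (f (g x))) \<le> ((size (enc x) + 2) ^ b + 2) ^ a" for x
      using f(1) * le_trans by blast
    fix k :: nat and s :: store and x :: 'c assume "s k = enc x"
    from g(2)[of s, OF this] obtain t s' where 1: "exec (c' k) s t s'" "t \<le> (size (enc x) + 2) ^ b"
      "s' k = enc (g x)" "\<forall>i<k. s' i = s i" by (rule runsE)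
    from f(2)[of s', OF 1(3)] obtain t' s'' where 2: "exec (c k) s' t' s''"
      "t' \<le> (size (enc (g x)) + 2) ^ a"
      "s'' k = enc (f (g x))" "\<forall>i<k. s'' i = s' i" by (rule runsE)
    show "runs (Seq (c' k) (c k)) k s (enc (f (g x)))
      ((size (enc x) + 2) ^ b + ((size (enc x) + 2) ^ b + 2) ^ a)"
      using 1 2 le_trans[OF 2(2) *] by (intro runsI[OF exec.Seq[OF 1(1) 2(1)]] add_mono) auto
  qed
qed

lemma PT_texp:
  assumes "\<And>k s x. s k = enc x \<Longrightarrow> teval (e k) s = enc (f x)" and "\<And>k. tcost (e k) \<le> m"
    and "poly_bounded b" "\<And>x. size (enc (f x)) \<le> b (size (enc x))"
  shows "PT f"
proof (rule PTI[OF assms(3) poly_bounded_const[of "m + 1"] assms(4)])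
  fix k :: nat and s :: store and x :: 'a assume "s k = enc x"
  then show "runs (Assign k (e k)) k s (enc (f x)) (m + 1)"
    using assms(1)[of s k x] assms(2)[of k] by (intro runsI[OF exec.Assign]) auto
qed

text \<open>Changing the type without changing the encoding costs one copy. This covers
  \<open>Cons\<close> on a pair and unary numbers read as lists.\<close>

lemma PT_recode: "(\<And>x. enc (f x) = enc x) \<Longrightarrow> PT f"
  by (rule PT_texp[where e = "\<lambda>k. Var k" and m = 1 and b = "\<lambda>n. n"]) (auto intro: poly_bounded_id)

lemma PT_id: "PT (\<lambda>x. x)"
  by (rule PT_recode) simp

fun const_exp :: "val \<Rightarrow> texp" where
  "const_exp Nl = NlE"
| "const_exp (Cell v w) = CellE (const_exp v) (const_exp w)"

lemma teval_const_exp [simp]: "teval (const_exp v) s = v"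
  by (induction v) auto

lemma PT_const: "PT (\<lambda>_. c)"
  by (rule PT_texp[where e = "\<lambda>k. const_exp (enc c)" and b = "\<lambda>n. size (enc c)"])
     (auto intro: poly_bounded_const)

lemma PT_fst: "PT f \<Longrightarrow> PT (\<lambda>x. fst (f x))"
  by (rule PT_comp[where f = fst], rule PT_texp[where e = "\<lambda>k. Hd (Var k)" and m = 2 and b = "\<lambda>n. n"])
     (auto intro: poly_bounded_id)

lemma PT_snd: "PT f \<Longrightarrow> PT (\<lambda>x. snd (f x))"
  by (rule PT_comp[where f = snd], rule PT_texp[where e = "\<lambda>k. Tl (Var k)" and m = 2 and b = "\<lambda>n. n"])
     (auto intro: poly_bounded_id)

lemma PT_Pair:
  assumes "PT f" "PT g"
  shows "PT (\<lambda>x. (f x, g x))"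
proof -
  obtain a c where "\<forall>x. size (enc (f x)) \<le> (size (enc x) + 2) ^ a"
    "\<forall>k s x. s k = enc x \<longrightarrow> runs (c k) k s (enc (f x)) ((size (enc x) + 2) ^ a)"
    by (rule PTE[OF assms(1)])
  note f = this[rule_format]
  obtain b c' where "\<forall>x. size (enc (g x)) \<le> (size (enc x) + 2) ^ b"
    "\<forall>k s x. s k = enc x \<longrightarrow> runs (c' k) k s (enc (g x)) ((size (enc x) + 2) ^ b)"
    by (rule PTE[OF assms(2)])
  note g = this[rule_format]
  have pb: "poly_bounded (\<lambda>n. (n + 2) ^ a + (n + 2) ^ b + m)" for m
    by (intro poly_bounded_intros)
  show ?thesis
  proof (rule PTI[OF pb[of 1] pb[of 8]])
    show "size (enc (f x, g x)) \<le> (size (enc x) + 2) ^ a + (size (enc x) + 2) ^ b + 1" for x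
      using f(1)[of x] g(1)[of x] by simp
    fix k :: nat and s :: store and x :: 'a assume s: "s k = enc x"
    \<comment> \<open>The input stays in \<open>k\<close>; \<open>g\<close> runs at base
      \<open>k + 1\<close> and then \<open>f\<close> at base \<open>k + 2\<close>, whose scratch
      registers cannot destroy the result of \<open>g\<close>.\<close>
    let ?P = "Seq (Assign (k + 1) (Var k)) (Seq (c' (k + 1)) (Seq (Assign (k + 2) (Var k))
      (Seq (c (k + 2)) (Assign k (CellE (Var (k + 2)) (Var (k + 1)))))))"
    let ?s1 = "s(k + 1 := s k)"
    have "?s1 (k + 1) = enc x" using s by simp
    from g(2)[of ?s1, OF this] obtain t1 s2 where 1: "exec (c' (k + 1)) ?s1 t1 s2"
      "t1 \<le> (size (enc x) + 2) ^ b" "s2 (k + 1) = enc (g x)" "\<forall>i<k + 1. s2 i = ?s1 i"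
      by (rule runsE)
    let ?s3 = "s2(k + 2 := s2 k)"
    have "?s3 (k + 2) = enc x" using 1(4) s by simp
    from f(2)[of ?s3, OF this] obtain t2 s4 where 2: "exec (c (k + 2)) ?s3 t2 s4"
      "t2 \<le> (size (enc x) + 2) ^ a" "s4 (k + 2) = enc (f x)" "\<forall>i<k + 2. s4 i = ?s3 i"
      by (rule runsE)
    let ?s5 = "s4(k := Cell (s4 (k + 2)) (s4 (k + 1)))"
    have A: "exec (Assign (k + 1) (Var k)) s 2 ?s1" "exec (Assign (k + 2) (Var k)) s2 2 ?s3"
      "exec (Assign k (CellE (Var (k + 2)) (Var (k + 1)))) s4 4 ?s5"
      by (auto intro!: exec_AssignI)
    have "exec ?P s (2 + (t1 + (2 + (t2 + 4)))) ?s5"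
      by (intro exec.Seq[OF A(1)] exec.Seq[OF 1(1)] exec.Seq[OF A(2)] exec.Seq[OF 2(1)] A(3))
    then show "runs ?P k s (enc (f x, g x)) ((size (enc x) + 2) ^ a + (size (enc x) + 2) ^ b + 8)"
      by (rule runsI) (use 1 2 in auto)
  qed
qed

lemma PT_if:
  assumes "PT b" "PT f" "PT g"
  shows "PT (\<lambda>x. if b x then f x else g x)"
proof -
  obtain a\<^sub>0 c\<^sub>0 where "\<forall>x. size (enc (b x)) \<le> (size (enc x) + 2) ^ a\<^sub>0"
    "\<forall>k s x. s k = enc x \<longrightarrow> runs (c\<^sub>0 k) k s (enc (b x)) ((size (enc x) + 2) ^ a\<^sub>0)"
    by (rule PTE[OF assms(1)])
  note b = this[rule_format]
  obtain a\<^sub>1 c\<^sub>1 where "\<forall>x. size (enc (f x)) \<le> (size (enc x) + 2) ^ a\<^sub>1"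
    "\<forall>k s x. s k = enc x \<longrightarrow> runs (c\<^sub>1 k) k s (enc (f x)) ((size (enc x) + 2) ^ a\<^sub>1)"
    by (rule PTE[OF assms(2)])
  note f = this[rule_format]
  obtain a\<^sub>2 c\<^sub>2 where "\<forall>x. size (enc (g x)) \<le> (size (enc x) + 2) ^ a\<^sub>2"
    "\<forall>k s x. s k = enc x \<longrightarrow> runs (c\<^sub>2 k) k s (enc (g x)) ((size (enc x) + 2) ^ a\<^sub>2)"
    by (rule PTE[OF assms(3)])
  note g = this[rule_format]
  have pb: "poly_bounded (\<lambda>n. (n + 2) ^ a\<^sub>0 + (n + 2) ^ a\<^sub>1 + (n + 2) ^ a\<^sub>2 + m)" for m
    by (intro poly_bounded_intros)
  show ?thesis
  proof (rule PTI[OF pb[of 0] pb[of 4]])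
    show "size (enc (if b x then f x else g x)) \<le>
      (size (enc x) + 2) ^ a\<^sub>0 + (size (enc x) + 2) ^ a\<^sub>1 + (size (enc x) + 2) ^ a\<^sub>2 + 0" for x
      using f(1)[of x] g(1)[of x] by simp
    fix k :: nat and s :: store and x :: 'a assume s: "s k = enc x"
    let ?P = "Seq (Assign (k + 1) (Var k)) (Seq (c\<^sub>0 (k + 1)) (Cond (Var (k + 1)) (c\<^sub>1 k) (c\<^sub>2 k)))"
    let ?s1 = "s(k + 1 := s k)"
    have "?s1 (k + 1) = enc x" using s by simp
    from b(2)[of ?s1, OF this] obtain t1 s2 where 1: "exec (c\<^sub>0 (k + 1)) ?s1 t1 s2"
      "t1 \<le> (size (enc x) + 2) ^ a\<^sub>0" "s2 (k + 1) = enc (b x)" "\<forall>i<k + 1. s2 i = ?s1 i"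
      by (rule runsE)
    have A: "exec (Assign (k + 1) (Var k)) s 2 ?s1"
      by (auto intro!: exec_AssignI)
    have s2: "s2 k = enc x" using 1(4) s by simp
    show "runs ?P k s (enc (if b x then f x else g x)) ((size (enc x) + 2) ^ a\<^sub>0 +
      (size (enc x) + 2) ^ a\<^sub>1 + (size (enc x) + 2) ^ a\<^sub>2 + 4)"
    proof (cases "b x")
      case True
      from f(2)[of s2, OF s2] obtain t2 s4 where 2: "exec (c\<^sub>1 k) s2 t2 s4"
        "t2 \<le> (size (enc x) + 2) ^ a\<^sub>1" "s4 k = enc (f x)" "\<forall>i<k. s4 i = s2 i"
        by (rule runsE)
      have "exec (Cond (Var (k + 1)) (c\<^sub>1 k) (c\<^sub>2 k)) s2 (tcost (Var (k + 1)) + 1 + t2) s4"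
        using True 1(3) by (intro exec.CondTrue 2(1)) simp
      from exec.Seq[OF A exec.Seq[OF 1(1) this]] show ?thesis
        by (rule runsI) (use 1 2 True in auto)
    next
      case False
      from g(2)[of s2, OF s2] obtain t2 s4 where 2: "exec (c\<^sub>2 k) s2 t2 s4"
        "t2 \<le> (size (enc x) + 2) ^ a\<^sub>2" "s4 k = enc (g x)" "\<forall>i<k. s4 i = s2 i"
        by (rule runsE)
      have "exec (Cond (Var (k + 1)) (c\<^sub>1 k) (c\<^sub>2 k)) s2 (tcost (Var (k + 1)) + 1 + t2) s4"
        using False 1(3) by (intro exec.CondFalse 2(1)) simp
      from exec.Seq[OF A exec.Seq[OF 1(1) this]] show ?thesis
        by (rule runsI) (use 1 2 False in auto)
    qed
  qed
qed

text \<open>The loop keeps the input in register \<open>k\<close>, the remaining list in \<open>k + 1\<close> and the accumulator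
  in \<open>k + 2\<close>; the body computes the next accumulator in \<open>k + 3\<close>.\<close>

lemma PT_fold:
  fixes l :: "'a::enc \<Rightarrow> 'b::enc list" and i :: "'a \<Rightarrow> 'c::enc"
  assumes "PT l" "PT i" and step: "PT (\<lambda>p. g (fst p) (fst (snd p)) (snd (snd p)))"
    and B: "poly_bounded B"
    and size: "\<And>x j. size (enc (fold (g x) (take j (l x)) (i x))) \<le> B (size (enc x))"
  shows "PT (\<lambda>x. fold (g x) (l x) (i x))"
proof -
  obtain a\<^sub>0 c\<^sub>0 where "\<forall>x. size (enc (l x)) \<le> (size (enc x) + 2) ^ a\<^sub>0"
    "\<forall>k s x. s k = enc x \<longrightarrow> runs (c\<^sub>0 k) k s (enc (l x)) ((size (enc x) + 2) ^ a\<^sub>0)"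
    by (rule PTE[OF assms(1)])
  note l = this[rule_format]
  obtain a\<^sub>1 c\<^sub>1 where "\<forall>x. size (enc (i x)) \<le> (size (enc x) + 2) ^ a\<^sub>1"
    "\<forall>k s x. s k = enc x \<longrightarrow> runs (c\<^sub>1 k) k s (enc (i x)) ((size (enc x) + 2) ^ a\<^sub>1)"
    by (rule PTE[OF assms(2)])
  note i = this[rule_format]
  obtain a\<^sub>2 c\<^sub>2 where "\<forall>p. size (enc (g (fst p) (fst (snd p)) (snd (snd p)))) \<le> (size (enc p) + 2) ^ a\<^sub>2"
    "\<forall>k s p. s k = enc p \<longrightarrow>
      runs (c\<^sub>2 k) k s (enc (g (fst p) (fst (snd p)) (snd (snd p)))) ((size (enc p) + 2) ^ a\<^sub>2)"
    by (rule PTE[OF step])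
  note g = this[rule_format]
  \<comment> \<open>Bounds one call of the body on the triple of input, list element and
    accumulator; the inner 2 counts the two cells of the triple.\<close>
  define T where "T n = ((n + (n + 2) ^ a\<^sub>0 + B n + 2) + 2) ^ a\<^sub>2" for n
  have T: "poly_bounded T" unfolding T_def
    by (intro poly_bounded_comp[OF poly_bounded_power] poly_bounded_intros B)
  define b where "b n = (n + 2) ^ a\<^sub>0 * (T n + 17) + (n + 2) ^ a\<^sub>0 + (n + 2) ^ a\<^sub>1 + 10" for n
  have b: "poly_bounded b" unfolding b_def by (intro poly_bounded_intros T)
  show ?thesis
  proof (rule PTI[OF B b])
    show "size (enc (fold (g x) (l x) (i x))) \<le> B (size (enc x))" for x
      using size[of x "length (l x)"] by simp
    fix k :: nat and s :: store and x :: 'a assume s: "s k = enc x"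
    let ?body = "Seq (Assign (k + 3) (CellE (Var k) (CellE (Hd (Var (k + 1))) (Var (k + 2)))))
      (Seq (c\<^sub>2 (k + 3)) (Seq (Assign (k + 2) (Var (k + 3))) (Assign (k + 1) (Tl (Var (k + 1))))))"
    let ?loop = "While (Var (k + 1)) ?body"
    \<comment> \<open>Stated for every suffix \<open>ys\<close> and every store. The position
      \<open>j\<close> ties the accumulator to the prefix already folded, whose result is bounded by
      \<open>size\<close>.\<close>
    have loop: "\<exists>t s'. exec ?loop s t s' \<and> t \<le> length ys * (T (size (enc x)) + 17) + 2 \<and>
        s' (k + 2) = enc (fold (g x) (l x) (i x)) \<and> (\<forall>i<k. s' i = s i)"
      if "drop j (l x) = ys" "s k = enc x" "s (k + 1) = enc ys"
        "s (k + 2) = enc (fold (g x) (take j (l x)) (i x))" for j ys s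
      using that
    proof (induction ys arbitrary: j s)
      case Nil
      have "take j (l x) = l x"
        using Nil.prems(1) by simp
      moreover have "exec ?loop s 2 s"
        using exec.WhileFalse[of "Var (k + 1)" s ?body] Nil.prems(3) by (simp add: numeral_2_eq_2)
      ultimately show ?case using Nil.prems(4)
        by (intro exI[of _ 2] exI[of _ s] conjI) simp_all
    next
      case (Cons y ys)
      let ?acc = "fold (g x) (take j (l x)) (i x)"
      let ?s1 = "s(k + 3 := enc (x, y, ?acc))"
      have y: "y \<in> set (l x)"
        using Cons.prems(1) set_drop_subset[of j "l x"] by auto
      have "?s1 (k + 3) = enc (x, y, ?acc)" by simp
      from g(2)[of ?s1 "k + 3" "(x, y, ?acc)", unfolded fst_conv snd_conv, OF this]
      obtain t1 s2 where 1: "exec (c\<^sub>2 (k + 3)) ?s1 t1 s2"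
        "t1 \<le> (size (enc (x, y, ?acc)) + 2) ^ a\<^sub>2" "s2 (k + 3) = enc (g x y ?acc)"
        "\<forall>i<k + 3. s2 i = ?s1 i"
        by (rule runsE) auto
      let ?s3 = "s2(k + 2 := enc (g x y ?acc))"
      let ?s4 = "?s3(k + 1 := enc ys)"
      have A: "exec (Assign (k + 3) (CellE (Var k) (CellE (Hd (Var (k + 1))) (Var (k + 2))))) s 7 ?s1"
        "exec (Assign (k + 2) (Var (k + 3))) s2 2 ?s3" "exec (Assign (k + 1) (Tl (Var (k + 1)))) ?s3 3 ?s4"
        using Cons.prems(2-4) 1(3,4) by (auto intro!: exec_AssignI)
      have body: "exec ?body s (7 + (t1 + (2 + 3))) ?s4"
        by (rule exec.Seq[OF A(1) exec.Seq[OF 1(1) exec.Seq[OF A(2) A(3)]]])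
      have j: "j < length (l x)"
        using Cons.prems(1) by (cases "j < length (l x)") auto
      have lj: "l x ! j = y"
        using Cons.prems(1) by (rule nth_via_drop)
      have "drop (Suc j) (l x) = ys"
        using Cons.prems(1) by (simp add: drop_Suc flip: tl_drop)
      moreover have "take (Suc j) (l x) = take j (l x) @ [y]"
        using j lj by (simp add: take_Suc_conv_app_nth)
      ultimately have "drop (Suc j) (l x) = ys" "?s4 k = enc x" "?s4 (k + 1) = enc ys"
        "?s4 (k + 2) = enc (fold (g x) (take (Suc j) (l x)) (i x))"
        using Cons.prems 1(4) by auto
      from Cons.IH[of "Suc j" ?s4, OF this] obtain t s' where 2: "exec ?loop ?s4 t s'"
        "t \<le> length ys * (T (size (enc x)) + 17) + 2"
        "s' (k + 2) = enc (fold (g x) (l x) (i x))" "\<forall>i<k. s' i = ?s4 i" by blast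
      have "size (enc y) \<le> (size (enc x) + 2) ^ a\<^sub>0"
        using size_enc_elem[OF y] l(1) le_trans by blast
      then have "size (enc (x, y, ?acc)) + 2 \<le> size (enc x) + (size (enc x) + 2) ^ a\<^sub>0 + B (size (enc x)) + 2 + 2"
        using size[of x j] by simp
      then have t1: "t1 \<le> T (size (enc x))"
        using 1(2) unfolding T_def by (meson le_trans power_mono zero_le)
      have "exec ?loop s (tcost (Var (k + 1)) + 1 + (7 + (t1 + (2 + 3))) + t) s'"
        using Cons.prems(3) by (intro exec.WhileTrue[OF _ body 2(1)]) simp
      moreover have "tcost (Var (k + 1)) + 1 + (7 + (t1 + (2 + 3))) + t \<le>
          length (y # ys) * (T (size (enc x)) + 17) + 2"
      proof -
        have "length (y # ys) * (T (size (enc x)) + 17) =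
            T (size (enc x)) + 17 + length ys * (T (size (enc x)) + 17)" by simp
        then show ?thesis using 2(2) t1 unfolding tcost.simps by linarith
      qed
      moreover have "\<forall>i<k. s' i = s i"
        using 2(4) 1(4) by simp
      ultimately show ?case
        using 2(3) by (intro exI conjI)
    qed
    let ?P = "Seq (Assign (k + 1) (Var k)) (Seq (c\<^sub>0 (k + 1)) (Seq (Assign (k + 2) (Var k))
      (Seq (c\<^sub>1 (k + 2)) (Seq ?loop (Assign k (Var (k + 2)))))))"
    let ?s1 = "s(k + 1 := s k)"
    have "?s1 (k + 1) = enc x" using s by simp
    from l(2)[of ?s1, OF this] obtain t1 s2 where 1: "exec (c\<^sub>0 (k + 1)) ?s1 t1 s2"
      "t1 \<le> (size (enc x) + 2) ^ a\<^sub>0" "s2 (k + 1) = enc (l x)" "\<forall>i<k + 1. s2 i = ?s1 i"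
      by (rule runsE)
    let ?s3 = "s2(k + 2 := s2 k)"
    have "?s3 (k + 2) = enc x" using 1(4) s by simp
    from i(2)[of ?s3, OF this] obtain t2 s4 where 2: "exec (c\<^sub>1 (k + 2)) ?s3 t2 s4"
      "t2 \<le> (size (enc x) + 2) ^ a\<^sub>1" "s4 (k + 2) = enc (i x)" "\<forall>i<k + 2. s4 i = ?s3 i"
      by (rule runsE)
    have "drop 0 (l x) = l x" "s4 k = enc x" "s4 (k + 1) = enc (l x)"
      "s4 (k + 2) = enc (fold (g x) (take 0 (l x)) (i x))"
      using 1 2 s by auto
    from loop[of 0 "l x" s4, OF this] obtain t3 s5 where 3: "exec ?loop s4 t3 s5"
      "t3 \<le> length (l x) * (T (size (enc x)) + 17) + 2"
      "s5 (k + 2) = enc (fold (g x) (l x) (i x))" "\<forall>i<k. s5 i = s4 i" by blast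
    let ?s6 = "s5(k := s5 (k + 2))"
    have A: "exec (Assign (k + 1) (Var k)) s 2 ?s1" "exec (Assign (k + 2) (Var k)) s2 2 ?s3"
      "exec (Assign k (Var (k + 2))) s5 2 ?s6"
      by (auto intro!: exec_AssignI)
    have P: "exec ?P s (2 + (t1 + (2 + (t2 + (t3 + 2))))) ?s6"
      by (intro exec.Seq[OF A(1)] exec.Seq[OF 1(1)] exec.Seq[OF A(2)] exec.Seq[OF 2(1)]
          exec.Seq[OF 3(1)] A(3))
    have "length (l x) * (T (size (enc x)) + 17) \<le> (size (enc x) + 2) ^ a\<^sub>0 * (T (size (enc x)) + 17)"
      using length_le_size_enc[of "l x"] l(1)[of x] by (intro mult_right_mono) auto
    then have "2 + (t1 + (2 + (t2 + (t3 + 2)))) \<le> b (size (enc x))"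
      using 1(2) 2(2) 3(2) unfolding b_def by linarith
    then show "runs ?P k s (enc (fold (g x) (l x) (i x))) (b (size (enc x)))"
      by (rule runsI[OF P]) (use 1 2 3 in auto)
  qed
qed

section \<open>Basic operations on numbers, truth values and lists\<close>

lemma PT_comp2: "PT (\<lambda>p. h (fst p) (snd p)) \<Longrightarrow> PT f \<Longrightarrow> PT g \<Longrightarrow> PT (\<lambda>x. h (f x) (g x))"
  using PT_comp[OF _ PT_Pair, of "\<lambda>p. h (fst p) (snd p)" f g] by simp

lemma PT_comp3:
  "PT (\<lambda>p. h (fst p) (fst (snd p)) (snd (snd p))) \<Longrightarrow> PT e \<Longrightarrow> PT f \<Longrightarrow> PT g \<Longrightarrow>
   PT (\<lambda>x. h (e x) (f x) (g x))"
  using PT_comp[OF _ PT_Pair[OF _ PT_Pair], of "\<lambda>p. h (fst p) (fst (snd p)) (snd (snd p))" e f g]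
  by simp

lemma PT_Cons: "PT f \<Longrightarrow> PT g \<Longrightarrow> PT (\<lambda>x. f x # g x)"
  by (rule PT_comp2[where h = Cons], rule PT_recode) auto

lemma PT_Suc: "PT f \<Longrightarrow> PT (\<lambda>x. Suc (f x))"
  by (rule PT_comp[where f = Suc], rule PT_texp[where e = "\<lambda>k. CellE NlE (Var k)" and m = 3 and b = "\<lambda>n. n + 1"])
     (use poly_bounded_Suc[OF poly_bounded_id] in auto)

lemma PT_pred: "PT f \<Longrightarrow> PT (\<lambda>x. f x - Suc 0)"
proof (rule PT_comp[where f = "\<lambda>x. x - Suc 0"])
  have "teval (Tl (Var k)) s = enc (n - Suc 0)" if "s k = enc n" for k s and n :: nat
    using that by (cases n) auto
  then show "PT (\<lambda>x. x - Suc 0)"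
    by (rule PT_texp[where e = "\<lambda>k. Tl (Var k)" and m = 2 and b = "\<lambda>n. n"]) (auto intro: poly_bounded_id)
qed

lemma size_enc_tl: "size (enc (tl xs)) \<le> size (enc xs)"
  by (cases xs) auto

lemma PT_tl: "PT f \<Longrightarrow> PT (\<lambda>x. tl (f x))"
proof (rule PT_comp[where f = tl])
  have "teval (Tl (Var k)) s = enc (tl xs)" if "s k = enc xs" for k s and xs :: "'b list"
    using that by (cases xs) auto
  then show "PT (tl :: 'b list \<Rightarrow> 'b list)"
    by (rule PT_texp[where e = "\<lambda>k. Tl (Var k)" and m = 2 and b = "\<lambda>n. n"])
       (auto intro: poly_bounded_id size_enc_tl)
qed

lemma PT_cong: "PT f \<Longrightarrow> (\<And>x. f x = g x) \<Longrightarrow> PT g"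
proof -
  assume "PT f" "\<And>x. f x = g x"
  moreover from this(2) have "f = g" by (rule HOL.ext)
  ultimately show "PT g" by simp
qed

lemma PT_not: "PT b \<Longrightarrow> PT (\<lambda>x. \<not> b x)"
  by (rule PT_cong[OF PT_if[OF _ PT_const[of False] PT_const[of True]]]) auto

lemma PT_conj: "PT a \<Longrightarrow> PT b \<Longrightarrow> PT (\<lambda>x. a x \<and> b x)"
  by (rule PT_cong[OF PT_if[OF _ _ PT_const, of a b False]]) auto

lemma PT_disj: "PT a \<Longrightarrow> PT b \<Longrightarrow> PT (\<lambda>x. a x \<or> b x)"
  by (rule PT_cong[OF PT_if[OF _ PT_const, of a b True]]) auto

lemma PT_imp: "PT a \<Longrightarrow> PT b \<Longrightarrow> PT (\<lambda>x. a x \<longrightarrow> b x)"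
  by (rule PT_cong[OF PT_if[OF _ _ PT_const, of a b True]]) auto

text \<open>Nonzero numbers and \<open>True\<close> are all different from \<open>Nl\<close> but in
  general encoded differently, so a conditional has to normalise the answer.\<close>

lemma PT_is_zero: "PT f \<Longrightarrow> PT (\<lambda>x. f x = (0 :: nat))"
proof -
  assume f: "PT f"
  have "PT (\<lambda>n. n \<noteq> (0 :: nat))"
  proof -
    have "PT (\<lambda>n. if n \<noteq> (0 :: nat) then True else False)"
    proof (rule PTI[OF poly_bounded_const[of 1] poly_bounded_const[of 6]])
      fix k :: nat and s :: store and n :: nat assume s: "s k = enc n"
      let ?P = "Cond (Var k) (Assign k (CellE NlE NlE)) (Assign k NlE)"
      show "runs ?P k s (enc (if n \<noteq> 0 then True else False)) 6"
      proof (cases n)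
        case 0
        then have "exec ?P s (tcost (Var k) + 1 + 2) (s(k := Nl))"
          using s by (intro exec.CondFalse exec_AssignI) auto
        then show ?thesis by (rule runsI) (use 0 in auto)
      next
        case (Suc m)
        then have "exec ?P s (tcost (Var k) + 1 + 4) (s(k := Cell Nl Nl))"
          using s by (intro exec.CondTrue exec_AssignI) auto
        then show ?thesis by (rule runsI) (use Suc in auto)
      qed
    qed (use size_enc_bool in simp)
    then show ?thesis by (rule PT_cong) auto
  qed
  from PT_not[OF PT_comp[OF this f]] show ?thesis by simp
qed

text \<open>A unary number is a list of units. Folding over this list turns \<open>PT_fold\<close>
  into a counted loop.\<close>

lemma PT_replicate_unit: "PT f \<Longrightarrow> PT (\<lambda>x. replicate (f x) ())"
proof (rule PT_comp[where f = "\<lambda>n. replicate n ()"], rule PT_recode)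
  show "enc (replicate n ()) = enc n" for n
    by (induction n) auto
qed

lemma PT_funpow:
  fixes g :: "'a::enc \<Rightarrow> 'b::enc \<Rightarrow> 'b"
  assumes "PT n" "PT i" "PT (\<lambda>p. g (fst p) (snd p))" "poly_bounded B"
    and "\<And>x j. j \<le> n x \<Longrightarrow> size (enc ((g x ^^ j) (i x))) \<le> B (size (enc x))"
  shows "PT (\<lambda>x. (g x ^^ n x) (i x))"
proof (rule PT_cong)
  show "PT (\<lambda>x. fold (\<lambda>_. g x) (replicate (n x) ()) (i x))"
  proof (rule PT_fold[OF PT_replicate_unit[OF assms(1)] assms(2) _ assms(4)])
    show "PT (\<lambda>p :: 'a \<times> unit \<times> 'b. g (fst p) (snd (snd p)))"
      by (rule PT_comp2[where h = g, OF assms(3) PT_fst[OF PT_id] PT_snd[OF PT_snd[OF PT_id]]])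
    show "size (enc (fold (\<lambda>_. g x) (take j (replicate (n x) ())) (i x))) \<le> B (size (enc x))" for x j
      using assms(5)[of "min j (n x)" x] by (simp add: take_replicate)
  qed
qed simp

lemma PT_rev: "PT f \<Longrightarrow> PT (\<lambda>x. rev (f x))"
proof (rule PT_comp[where f = rev])
  have "PT (\<lambda>xs :: 'b list. fold Cons xs [])"
  proof (rule PT_fold[OF PT_id PT_const _ poly_bounded_id])
    show "PT (\<lambda>p :: 'b list \<times> 'b \<times> 'b list. fst (snd p) # snd (snd p))"
      by (intro PT_Cons PT_fst PT_snd PT_id)
    fix xs :: "'b list" and j
    have "size (enc xs) = size (enc (take j xs)) + size (enc (drop j xs))"
      using size_enc_append[of "take j xs" "drop j xs"] by simp
    then show "size (enc (fold Cons (take j xs) [])) \<le> size (enc xs)"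
      by (simp add: fold_Cons_rev size_enc_rev)
  qed
  then show "PT (rev :: 'b list \<Rightarrow> 'b list)"
    by (rule PT_cong) (simp add: fold_Cons_rev)
qed

lemma PT_map:
  assumes "PT (l :: 'a::enc \<Rightarrow> 'b::enc list)" "PT (\<lambda>p. g (fst p) (snd p))"
  shows "PT (\<lambda>x. map (g x) (l x) :: 'c::enc list)"
proof (rule PT_cong)
  have *: "fold (\<lambda>y acc. g x y # acc) ys zs = rev (map (g x) ys) @ zs" for x ys zs
    by (induction ys arbitrary: zs) auto
  obtain a where a: "\<And>x. size (enc (l x)) \<le> (size (enc x) + 2) ^ a"
    using assms(1) unfolding PT_def by blast
  obtain b where b: "\<And>p. size (enc (g (fst p) (snd p))) \<le> (size (enc p) + 2) ^ b"
    using assms(2) unfolding PT_def by blast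
  let ?B = "\<lambda>n. (n + 2) ^ a * ((n + (n + 2) ^ a + 1 + 2) ^ b + 1)"
  show "PT (\<lambda>x. rev (fold (\<lambda>y acc. g x y # acc) (l x) []))"
  proof (intro PT_rev PT_fold[OF assms(1) PT_const])
    show "poly_bounded ?B"
      by (intro poly_bounded_comp[OF poly_bounded_power] poly_bounded_intros)
    show "PT (\<lambda>p :: 'a \<times> 'b \<times> 'c list. g (fst p) (fst (snd p)) # snd (snd p))"
      by (intro PT_Cons PT_comp2[OF assms(2)] PT_fst PT_snd PT_id)
    fix x j
    show "size (enc (fold (\<lambda>y acc. g x y # acc) (take j (l x)) [])) \<le> ?B (size (enc x))"
      unfolding *
    proof (rule size_enc_list_le)
      show "length (rev (map (g x) (take j (l x))) @ []) \<le> (size (enc x) + 2) ^ a"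
        using a[of x] length_le_size_enc[of "l x"] by simp
      fix z assume "z \<in> set (rev (map (g x) (take j (l x))) @ [])"
      then obtain y where y: "y \<in> set (l x)" "z = g x y"
        by (auto dest: in_set_takeD)
      have "size (enc z) \<le> (size (enc (x, y)) + 2) ^ b"
        using b[of "(x, y)"] y by simp
      also have "\<dots> \<le> (size (enc x) + (size (enc x) + 2) ^ a + 1 + 2) ^ b"
        using size_enc_elem[OF y(1)] a[of x] by (intro power_mono) auto
      finally show "size (enc z) \<le> (size (enc x) + (size (enc x) + 2) ^ a + 1 + 2) ^ b" .
    qed
  qed
  show "rev (fold (\<lambda>y acc. g x y # acc) (l x) []) = map (g x) (l x)" for x
    by (simp add: *)
qed

lemma PT_filter:
  assumes "PT (l :: 'a::enc \<Rightarrow> 'b::enc list)" "PT (\<lambda>p. P (fst p) (snd p))"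
  shows "PT (\<lambda>x. filter (P x) (l x))"
proof (rule PT_cong)
  have *: "fold (\<lambda>y acc. if P x y then y # acc else acc) ys zs = rev (filter (P x) ys) @ zs" for x ys zs
    by (induction ys arbitrary: zs) auto
  obtain a where a: "\<And>x. size (enc (l x)) \<le> (size (enc x) + 2) ^ a"
    using assms(1) unfolding PT_def by blast
  let ?B = "\<lambda>n. (n + 2) ^ a * ((n + 2) ^ a + 1)"
  show "PT (\<lambda>x. rev (fold (\<lambda>y acc. if P x y then y # acc else acc) (l x) []))"
  proof (intro PT_rev PT_fold[OF assms(1) PT_const])
    show "poly_bounded ?B"
      by (intro poly_bounded_comp[OF poly_bounded_power] poly_bounded_intros)
    show "PT (\<lambda>p :: 'a \<times> 'b \<times> 'b list. if P (fst p) (fst (snd p)) then fst (snd p) # snd (snd p) else snd (snd p))"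
      by (intro PT_if PT_Cons PT_comp2[OF assms(2)] PT_fst PT_snd PT_id)
    fix x j
    show "size (enc (fold (\<lambda>y acc. if P x y then y # acc else acc) (take j (l x)) [])) \<le> ?B (size (enc x))"
      unfolding *
    proof (rule size_enc_list_le)
      show "length (rev (filter (P x) (take j (l x))) @ []) \<le> (size (enc x) + 2) ^ a"
        using a[of x] length_le_size_enc[of "l x"] length_filter_le[of "P x" "take j (l x)"] by simp
      fix z assume "z \<in> set (rev (filter (P x) (take j (l x))) @ [])"
      then have "z \<in> set (l x)"
        by (auto dest: in_set_takeD)
      from size_enc_elem[OF this] a[of x]
      show "size (enc z) \<le> (size (enc x) + 2) ^ a" by linarith
    qed
  qed
  show "rev (fold (\<lambda>y acc. if P x y then y # acc else acc) (l x) []) = filter (P x) (l x)" for x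
    by (simp add: *)
qed

text \<open>Replacing all entries by \<open>()\<close> leaves the length in unary.\<close>

lemma PT_length: "PT f \<Longrightarrow> PT (\<lambda>x. length (f x))"
proof (rule PT_comp[where f = length])
  have u: "PT (\<lambda>us :: unit list. length us)"
  proof (rule PT_recode)
    show "enc (length us) = enc us" for us :: "unit list"
      by (induction us) auto
  qed
  have "PT (\<lambda>xs :: 'b list. map (\<lambda>_. ()) xs)"
    by (intro PT_map PT_id PT_const)
  from PT_comp[OF u this] show "PT (length :: 'b list \<Rightarrow> nat)"
    by simp
qed

lemma PT_null: "PT f \<Longrightarrow> PT (\<lambda>x. f x = [])"
  by (rule PT_cong[OF PT_is_zero[OF PT_length]]) auto

lemma PT_list_ex:
  assumes "PT l" "PT (\<lambda>p. P (fst p) (snd p))"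
  shows "PT (\<lambda>x. list_ex (P x) (l x))"
  by (rule PT_cong[OF PT_not[OF PT_null[OF PT_filter[OF assms]]]])
     (auto simp: filter_empty_conv list_ex_iff)

lemma PT_list_all:
  assumes "PT l" "PT (\<lambda>p. P (fst p) (snd p))"
  shows "PT (\<lambda>x. list_all (P x) (l x))"
  by (rule PT_cong[OF PT_not[OF PT_list_ex[OF assms(1) PT_not[OF assms(2)]]]])
     (auto simp: list_ex_iff list_all_iff)

lemma PT_diff:
  assumes "PT f" "PT g"
  shows "PT (\<lambda>x. f x - g x :: nat)"
proof (rule PT_comp2[where h = "\<lambda>a b. a - b", OF _ assms])
  have *: "((\<lambda>n. n - Suc 0) ^^ j) n = n - j" for j n
    by (induction j) auto
  have "PT (\<lambda>p :: nat \<times> nat. ((\<lambda>n. n - Suc 0) ^^ snd p) (fst p))"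
    by (rule PT_funpow[OF PT_snd[OF PT_id] PT_fst[OF PT_id] PT_pred[OF PT_snd[OF PT_id]] poly_bounded_id])
       (auto simp: *)
  then show "PT (\<lambda>p :: nat \<times> nat. fst p - snd p)"
    by (simp add: *)
qed

lemma PT_add:
  assumes "PT f" "PT g"
  shows "PT (\<lambda>x. f x + g x :: nat)"
proof (rule PT_comp2[where h = "\<lambda>a b. a + b", OF _ assms])
  have *: "(Suc ^^ j) n = n + j" for j n
    by (induction j) auto
  have "PT (\<lambda>p :: nat \<times> nat. (Suc ^^ snd p) (fst p))"
    by (rule PT_funpow[OF PT_snd[OF PT_id] PT_fst[OF PT_id] PT_Suc[OF PT_snd[OF PT_id]] poly_bounded_id])
       (auto simp: *)
  then show "PT (\<lambda>p :: nat \<times> nat. fst p + snd p)"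
    by (simp add: * add.commute)
qed

lemma PT_le: "PT f \<Longrightarrow> PT g \<Longrightarrow> PT (\<lambda>x. f x \<le> (g x :: nat))"
  by (rule PT_cong[OF PT_is_zero[OF PT_diff]]) auto

lemma PT_less: "PT f \<Longrightarrow> PT g \<Longrightarrow> PT (\<lambda>x. f x < (g x :: nat))"
  by (rule PT_cong[OF PT_not[OF PT_le[of g f]]]) auto

lemma PT_eq: "PT f \<Longrightarrow> PT g \<Longrightarrow> PT (\<lambda>x. f x = (g x :: nat))"
  by (rule PT_cong[OF PT_conj[OF PT_le[of f g] PT_le[of g f]]]) auto

lemma PT_upt: "PT f \<Longrightarrow> PT (\<lambda>x. [0..<f x])"
proof (rule PT_comp[where f = "\<lambda>n. [0..<n]"])
  \<comment> \<open>The list serves as its own counter: the next number is its current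
    length.\<close>
  have *: "((\<lambda>acc. length acc # acc) ^^ j) [] = rev [0..<j]" for j
    by (induction j) auto
  have "PT (\<lambda>n. rev (((\<lambda>acc. length acc # acc) ^^ n) []))"
  proof (intro PT_rev PT_funpow[OF PT_id PT_const])
    show "poly_bounded (\<lambda>n. n * (n + 1))" by (intro poly_bounded_intros)
    show "PT (\<lambda>p :: nat \<times> nat list. length (snd p) # snd p)"
      by (intro PT_Cons PT_length PT_snd PT_id)
    show "size (enc (((\<lambda>acc. length acc # acc) ^^ j) [])) \<le> size (enc n) * (size (enc n) + 1)"
      if "j \<le> n" for n j :: nat
      unfolding * using that by (intro size_enc_list_le) auto
  qed
  then show "PT (\<lambda>n. [0..<n])" by (simp add: *)
qed

definition hd_or :: "'a \<Rightarrow> 'a list \<Rightarrow> 'a" where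
  "hd_or d xs = (case xs of [] \<Rightarrow> d | x # _ \<Rightarrow> x)"

lemma hd_or_simps [simp]: "hd_or d [] = d" "hd_or d (x # xs) = x"
  by (simp_all add: hd_or_def)

lemma PT_hd_or: "PT f \<Longrightarrow> PT g \<Longrightarrow> PT (\<lambda>x. hd_or (f x) (g x))"
proof (rule PT_comp2[where h = hd_or])
  show "PT (\<lambda>p :: 'b \<times> 'b list. hd_or (fst p) (snd p))"
  proof (rule PTI[OF poly_bounded_id poly_bounded_const[of 9]])
    show "size (enc (hd_or (fst p) (snd p))) \<le> size (enc p)" for p :: "'b \<times> 'b list"
      by (cases p; cases "snd p") auto
    fix k :: nat and s :: store and p :: "'b \<times> 'b list" assume s: "s k = enc p"
    obtain d xs where p: "p = (d, xs)" by (cases p)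
    let ?P = "Cond (Tl (Var k)) (Assign k (Hd (Tl (Var k)))) (Assign k (Hd (Var k)))"
    show "runs ?P k s (enc (hd_or (fst p) (snd p))) 9"
    proof (cases xs)
      case Nil
      then have "exec ?P s (tcost (Tl (Var k)) + 1 + 3) (s(k := enc d))"
        using s p by (intro exec.CondFalse exec_AssignI) auto
      then show ?thesis by (rule runsI) (use p Nil in auto)
    next
      case (Cons y ys)
      then have "exec ?P s (tcost (Tl (Var k)) + 1 + 4) (s(k := enc y))"
        using s p by (intro exec.CondTrue exec_AssignI) auto
      then show ?thesis by (rule runsI) (use p Cons in auto)
    qed
  qed
qed

lemma PT_drop: "PT f \<Longrightarrow> PT g \<Longrightarrow> PT (\<lambda>x. drop (f x) (g x))"
proof (rule PT_comp2[where h = drop])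
  have *: "(tl ^^ j) xs = drop j xs" for j and xs :: "'b list"
    by (induction j arbitrary: xs) (auto simp: drop_Suc tl_drop)
  have "size (enc (drop j xs)) \<le> size (enc xs)" for j and xs :: "'b list"
    using size_enc_append[of "take j xs" "drop j xs"] by simp
  then have "PT (\<lambda>p :: nat \<times> 'b list. (tl ^^ fst p) (snd p))"
    by (intro PT_funpow[OF PT_fst[OF PT_id] PT_snd[OF PT_id] PT_tl[OF PT_snd[OF PT_id]] poly_bounded_id])
       (auto simp: * trans_le_add2 le_SucI)
  then show "PT (\<lambda>p :: nat \<times> 'b list. drop (fst p) (snd p))" by (simp add: *)
qed

definition nth_or :: "'a \<Rightarrow> 'a list \<Rightarrow> nat \<Rightarrow> 'a" where
  "nth_or d xs i = hd_or d (drop i xs)"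

lemma nth_or_eq: "nth_or d xs i = (if i < length xs then xs ! i else d)"
  by (auto simp: nth_or_def Cons_nth_drop_Suc[symmetric])

lemma PT_nth_or: "PT e \<Longrightarrow> PT f \<Longrightarrow> PT g \<Longrightarrow> PT (\<lambda>x. nth_or (e x) (f x) (g x))"
  unfolding nth_or_def by (intro PT_hd_or PT_drop)

lemma size_enc_nth_or: "size (enc (nth_or d xs i)) \<le> size (enc d) + size (enc xs)"
  using size_enc_elem[of "xs ! i" xs] by (auto simp: nth_or_eq)

lemmas PT_intros = PT_const PT_id PT_fst PT_snd PT_Pair PT_if PT_Cons PT_Suc PT_tl PT_not PT_conj
  PT_disj PT_imp PT_rev PT_map PT_filter PT_length PT_null PT_list_ex PT_list_all PT_diff PT_add
  PT_le PT_less PT_eq PT_upt PT_hd_or PT_drop PT_nth_or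

lemma PT_computes:
  assumes "PT f"
  shows "\<exists>c (q :: nat poly). \<forall>x. \<exists>t. computes_in c (enc x) t (enc (f x)) \<and> t \<le> poly q (size (enc x))"
proof -
  obtain d c where c: "\<forall>x. size (enc (f x)) \<le> (size (enc x) + 2) ^ d"
    "\<forall>k s x. s k = enc x \<longrightarrow> runs (c k) k s (enc (f x)) ((size (enc x) + 2) ^ d)"
    by (rule PTE[OF assms])
  show ?thesis
  \<comment> \<open>The base is register 0, where \<open>computes_in\<close> places input and
    output; \<open>[:2, 1:]\<close> is the polynomial X + 2.\<close>
  proof (intro exI[of _ "c 0"] exI[of _ "[:2, 1:] ^ d"] allI)
    fix x
    have "runs (c 0) 0 ((\<lambda>_. Nl)(0 := enc x)) (enc (f x)) ((size (enc x) + 2) ^ d)"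
      using c(2) by simp
    then show "\<exists>t. computes_in (c 0) (enc x) t (enc (f x)) \<and> t \<le> poly ([:2, 1:] ^ d) (size (enc x))"
      unfolding runs_def computes_in_def by (auto simp: poly_power add.commute)
  qed
qed

subsection \<open>The algorithm on lists\<close>

lemma PT_comp4:
  "PT (\<lambda>p. h (fst p) (fst (snd p)) (fst (snd (snd p))) (snd (snd (snd p)))) \<Longrightarrow>
   PT d \<Longrightarrow> PT e \<Longrightarrow> PT f \<Longrightarrow> PT g \<Longrightarrow> PT (\<lambda>x. h (d x) (e x) (f x) (g x))"
  using PT_comp[OF _ PT_Pair[OF _ PT_Pair[OF _ PT_Pair]],
      of "\<lambda>p. h (fst p) (fst (snd p)) (fst (snd (snd p))) (snd (snd (snd p)))" d e f g]
  by simp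

text \<open>A list of at most \<open>m\<close> numbers that are at most \<open>m\<close> has an
  encoding of size at most \<open>m * (m + 1)\<close>. This controls the growth in the loops for
  parents, labels and greedy sets.\<close>

lemma PT_funpow_nats:
  fixes g :: "'a::enc \<Rightarrow> nat list \<Rightarrow> nat list"
  assumes "PT n" "PT i" "PT (\<lambda>p. g (fst p) (snd p))" "PT m"
    and inv: "\<And>x j. j \<le> n x \<Longrightarrow>
      length ((g x ^^ j) (i x)) \<le> m x \<and> (\<forall>e\<in>set ((g x ^^ j) (i x)). e \<le> m x)"
  shows "PT (\<lambda>x. (g x ^^ n x) (i x))"
proof -
  obtain d where d: "\<forall>x. size (enc (m x)) \<le> (size (enc x) + 2) ^ d"
    using assms(4) unfolding PT_def by blast
  let ?b = "\<lambda>n. (n + 2) ^ d"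
  show ?thesis
  proof (rule PT_funpow[OF assms(1-3)])
    show "poly_bounded (\<lambda>n. ?b n * (?b n + 1))" by (intro poly_bounded_intros)
    fix x j assume j: "j \<le> n x"
    have m: "m x \<le> ?b (size (enc x))" using d by simp
    show "size (enc ((g x ^^ j) (i x))) \<le> ?b (size (enc x)) * (?b (size (enc x)) + 1)"
    proof (rule size_enc_list_le)
      show "length ((g x ^^ j) (i x)) \<le> ?b (size (enc x))" using inv[OF j] m by (meson le_trans)
      show "size (enc e) \<le> ?b (size (enc x))" if "e \<in> set ((g x ^^ j) (i x))" for e
        using inv[OF j] m that by (metis le_trans size_enc_nat)
    qed
  qed
qed

lemma hd_or_filter:
  assumes "filter P xs \<noteq> []"
  shows "hd_or d (filter P xs) \<in> set xs" "P (hd_or d (filter P xs))"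
proof -
  obtain y ys where "filter P xs = y # ys" using assms by (cases "filter P xs") auto
  then have "hd_or d (filter P xs) \<in> set (filter P xs)" by simp
  then show "hd_or d (filter P xs) \<in> set xs" "P (hd_or d (filter P xs))" by auto
qed

lemma hd_or_filter_upt_le: "hd_or 0 (filter P [0..<n]) \<le> n"
  using hd_or_filter(1)[of P "[0..<n]" 0] by (cases "filter P [0..<n] = []") auto

section \<open>The functions that make up the algorithm\<close>

definition adj :: "bool list list \<Rightarrow> nat \<Rightarrow> nat \<Rightarrow> bool" where
  "adj M i j = nth_or False (nth_or [] M i) j"

definition get :: "nat list \<Rightarrow> nat \<Rightarrow> nat" where
  "get xs i = nth_or 0 xs i"

definition mem :: "nat list \<Rightarrow> nat \<Rightarrow> bool" where
  "mem xs i = list_ex (\<lambda>x. x = i) xs"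

definition upd :: "nat list \<Rightarrow> nat \<Rightarrow> nat \<Rightarrow> nat list" where
  "upd xs y z = map (\<lambda>i. if i = y then z else get xs i) [0..<length xs]"

text \<open>In a list of parents, an entry that is not a vertex marks an unvisited vertex, and a root is
  its own parent.\<close>

definition cand :: "bool list list \<Rightarrow> nat list \<Rightarrow> nat list" where
  "cand M ps = filter (\<lambda>y. \<not> get ps y < length M \<and>
     list_ex (\<lambda>x. get ps x < length M \<and> adj M x y) [0..<length M]) [0..<length M]"

definition link :: "bool list list \<Rightarrow> nat list \<Rightarrow> nat \<Rightarrow> nat" where
  "link M ps y = hd_or 0 (filter (\<lambda>x. get ps x < length M \<and> adj M x y) [0..<length M])"

definition fresh :: "bool list list \<Rightarrow> nat list \<Rightarrow> nat list" where
  "fresh M ps = filter (\<lambda>y. \<not> get ps y < length M) [0..<length M]"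

text \<open>Attaching to a visited neighbour has priority. A new root is opened only when no edge
  leaves the visited set, so each component receives a single root.\<close>

definition grow_step :: "bool list list \<Rightarrow> nat list \<Rightarrow> nat list" where
  "grow_step M ps =
     (if cand M ps \<noteq> [] then upd ps (hd_or 0 (cand M ps)) (link M ps (hd_or 0 (cand M ps)))
      else if fresh M ps \<noteq> [] then upd ps (hd_or 0 (fresh M ps)) (hd_or 0 (fresh M ps))
      else ps)"

text \<open>Initially every entry is \<open>length M\<close>, the mark for unvisited vertices. Each
  iteration visits one vertex, so \<open>length M\<close> iterations are enough.\<close>

definition parents :: "bool list list \<Rightarrow> nat list" where
  "parents M = (grow_step M ^^ length M) (map (\<lambda>_. length M) [0..<length M])"

definition climb :: "nat list \<Rightarrow> nat \<Rightarrow> nat \<Rightarrow> nat" where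
  "climb ps k w = (get ps ^^ k) w"

definition below :: "nat list \<Rightarrow> nat \<Rightarrow> nat \<Rightarrow> bool" where
  "below ps u w = list_ex (\<lambda>k. climb ps k w = u) [0..<Suc (length ps)]"

definition root_of :: "nat list \<Rightarrow> nat \<Rightarrow> nat" where
  "root_of ps w = climb ps (length ps) w"

text \<open>In a list of labels, the entry \<open>length ps\<close> marks a vertex of the remaining forest; the vertices
  of a removed piece are labelled with the vertex \<open>u\<close> that was chosen for it.\<close>

definition subs :: "nat list \<Rightarrow> nat list \<Rightarrow> nat \<Rightarrow> nat list" where
  "subs ps lab u = filter (\<lambda>w. get lab w = length ps \<and> below ps u w) [0..<length ps]"

definition good :: "nat list \<Rightarrow> nat list \<Rightarrow> nat \<Rightarrow> bool" where
  "good ps lab u \<longleftrightarrow> get lab u = length ps \<and> 3 \<le> length (subs ps lab u) \<and>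
     list_all (\<lambda>x. get lab x = length ps \<and> get ps x = u \<and> x \<noteq> u \<longrightarrow> length (subs ps lab x) \<le> 2)
       [0..<length ps]"

definition piece :: "nat list \<Rightarrow> nat list \<Rightarrow> nat \<Rightarrow> nat list" where
  "piece ps lab u =
     (if 0 < length (subs ps lab (root_of ps u)) - length (subs ps lab u) \<and>
         length (subs ps lab (root_of ps u)) - length (subs ps lab u) < 3
      then subs ps lab (root_of ps u) else subs ps lab u)"

definition goods :: "nat list \<Rightarrow> nat list \<Rightarrow> nat list" where
  "goods ps lab = filter (\<lambda>u. good ps lab u) [0..<length ps]"

definition cut :: "nat list \<Rightarrow> nat list \<Rightarrow> nat \<Rightarrow> nat list" where
  "cut ps lab u = map (\<lambda>w. if mem (piece ps lab u) w then u else get lab w) [0..<length ps]"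

definition dec_step :: "nat list \<Rightarrow> nat list \<Rightarrow> nat list" where
  "dec_step ps lab = (if goods ps lab = [] then lab else cut ps lab (hd_or 0 (goods ps lab)))"

definition loop_labels :: "nat list \<Rightarrow> nat list" where
  "loop_labels ps = (dec_step ps ^^ length ps) (map (\<lambda>_. length ps) [0..<length ps])"

text \<open>Only vertices of trees with fewer than three vertices keep the mark
  \<open>length ps\<close> after the loop. Labelling them with their root makes each such tree a
  single piece.\<close>

definition labels :: "nat list \<Rightarrow> nat list" where
  "labels ps = map (\<lambda>w. if get (loop_labels ps) w = length ps then root_of ps w
     else get (loop_labels ps) w) [0..<length ps]"

definition hadj :: "nat list \<Rightarrow> nat list \<Rightarrow> nat \<Rightarrow> nat \<Rightarrow> bool" where
  "hadj ps lab x y \<longleftrightarrow> x \<noteq> y \<and> get lab x = get lab y \<and> (get ps x = y \<or> get ps y = x)"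

definition hmat :: "nat list \<Rightarrow> nat list \<Rightarrow> bool list list" where
  "hmat ps lab = map (\<lambda>x. map (\<lambda>y. hadj ps lab x y) [0..<length ps]) [0..<length ps]"

text \<open>In a member of \<open>S_{a,b}\<close> with hub \<open>u\<close> the two tests read 1 + a
  + 2b = 5 and a + b = 2, which holds exactly for a = 0 and b = 2.\<close>

definition cen :: "nat list \<Rightarrow> nat list \<Rightarrow> nat \<Rightarrow> nat" where
  "cen ps lab u =
     (if length (filter (\<lambda>w. get lab w = u) [0..<length ps]) = 5 \<and>
         length (filter (\<lambda>w. hadj ps lab u w) [0..<length ps]) = 2
      then hd_or 0 (filter (\<lambda>w. hadj ps lab u w) [0..<length ps]) else u)"

definition cens :: "nat list \<Rightarrow> nat list \<Rightarrow> bool list" where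
  "cens ps lab = map (\<lambda>v. list_ex (\<lambda>w. cen ps lab (get lab w) = v) [0..<length ps]) [0..<length ps]"

definition dom_test :: "bool list list \<Rightarrow> nat list \<Rightarrow> nat \<Rightarrow> bool" where
  "dom_test M A y = list_ex (\<lambda>z. z = y \<or> adj M y z) A"

definition dom_num :: "bool list list \<Rightarrow> nat list \<Rightarrow> nat" where
  "dom_num M A = length (filter (\<lambda>y. dom_test M A y) [0..<length M])"

text \<open>The key orders the vertices by gain, then centers first, then non-dominated vertices first.\<close>

definition key :: "bool list list \<Rightarrow> bool list \<Rightarrow> nat list \<Rightarrow> nat \<Rightarrow> nat" where
  "key M C A v = dom_num M (v # A) + dom_num M (v # A) + dom_num M (v # A) + dom_num M (v # A) +
     (if nth_or False C v then 2 else 0) + (if dom_test M A v then 0 else 1)"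

definition pick :: "bool list list \<Rightarrow> bool list \<Rightarrow> nat list \<Rightarrow> nat" where
  "pick M C A = hd_or 0 (filter (\<lambda>v. \<not> mem A v \<and>
     list_all (\<lambda>w. \<not> mem A w \<longrightarrow> key M C A w \<le> key M C A v) [0..<length M]) [0..<length M])"

definition greedy_run :: "bool list list \<Rightarrow> bool list \<Rightarrow> nat \<Rightarrow> nat list" where
  "greedy_run M C p = ((\<lambda>A. pick M C A # A) ^^ p) []"

text \<open>Comparing coverage amounts to comparing \<open>ext\<close>, since both greedy sets have
  \<open>p\<close> elements.\<close>

definition best :: "bool list list \<Rightarrow> nat list \<Rightarrow> nat list \<Rightarrow> bool list" where
  "best M A A' = map (\<lambda>i. mem (if dom_num M A' \<le> dom_num M A then A else A') i) [0..<length M]"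

definition dec_run :: "nat list \<Rightarrow> nat list \<Rightarrow> nat \<Rightarrow> nat list" where
  "dec_run ps lab p = greedy_run (hmat ps lab) (cens ps lab) p"

definition alg :: "nat \<Rightarrow> bool list list \<Rightarrow> bool list" where
  "alg p M = best M (greedy_run M [] p) (dec_run (parents M) (labels (parents M)) p)"

section \<open>Polynomial running time of the algorithm\<close>

lemma PT_adj: "PT f \<Longrightarrow> PT g \<Longrightarrow> PT h \<Longrightarrow> PT (\<lambda>x. adj (f x) (g x) (h x))"
  by (rule PT_comp3[where h = adj], unfold adj_def) (intro PT_intros)

lemma PT_get: "PT f \<Longrightarrow> PT g \<Longrightarrow> PT (\<lambda>x. get (f x) (g x))"
  by (rule PT_comp2[where h = get], unfold get_def) (intro PT_intros)

lemma PT_mem: "PT f \<Longrightarrow> PT g \<Longrightarrow> PT (\<lambda>x. mem (f x) (g x))"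
  by (rule PT_comp2[where h = mem], unfold mem_def) (intro PT_intros)

lemma PT_upd: "PT f \<Longrightarrow> PT g \<Longrightarrow> PT h \<Longrightarrow> PT (\<lambda>x. upd (f x) (g x) (h x))"
  by (rule PT_comp3[where h = upd], unfold upd_def) (intro PT_intros PT_get)

lemma PT_cand: "PT f \<Longrightarrow> PT g \<Longrightarrow> PT (\<lambda>x. cand (f x) (g x))"
  by (rule PT_comp2[where h = cand], unfold cand_def) (intro PT_intros PT_get PT_adj)

lemma PT_link: "PT f \<Longrightarrow> PT g \<Longrightarrow> PT h \<Longrightarrow> PT (\<lambda>x. link (f x) (g x) (h x))"
  by (rule PT_comp3[where h = link], unfold link_def) (intro PT_intros PT_get PT_adj)

lemma PT_fresh: "PT f \<Longrightarrow> PT g \<Longrightarrow> PT (\<lambda>x. fresh (f x) (g x))"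
  by (rule PT_comp2[where h = fresh], unfold fresh_def) (intro PT_intros PT_get)

lemma PT_grow_step: "PT f \<Longrightarrow> PT g \<Longrightarrow> PT (\<lambda>x. grow_step (f x) (g x))"
  by (rule PT_comp2[where h = grow_step], unfold grow_step_def)
     (intro PT_intros PT_cand PT_link PT_fresh PT_upd)

lemma get_le: "\<forall>e\<in>set xs. e \<le> m \<Longrightarrow> get xs i \<le> m"
  by (auto simp: get_def nth_or_eq)

lemma upd_bounded:
  "length xs \<le> m \<and> (\<forall>e\<in>set xs. e \<le> m) \<Longrightarrow> z \<le> m \<Longrightarrow>
   length (upd xs y z) \<le> m \<and> (\<forall>e\<in>set (upd xs y z). e \<le> m)"
  by (auto simp: upd_def get_le)

lemma grow_step_bounded:
  "length ps \<le> length M \<and> (\<forall>e\<in>set ps. e \<le> length M) \<Longrightarrow>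
   length (grow_step M ps) \<le> length M \<and> (\<forall>e\<in>set (grow_step M ps). e \<le> length M)"
proof -
  assume A: "length ps \<le> length M \<and> (\<forall>e\<in>set ps. e \<le> length M)"
  have l: "link M ps y \<le> length M" for y
    unfolding link_def by (rule hd_or_filter_upt_le)
  have f: "hd_or 0 (fresh M ps) \<le> length M"
    unfolding fresh_def by (rule hd_or_filter_upt_le)
  show ?thesis
    unfolding grow_step_def using A upd_bounded[OF A l] upd_bounded[OF A f]
    by (cases "cand M ps = []"; cases "fresh M ps = []") simp_all
qed

lemma funpow_inv: "P x \<Longrightarrow> (\<And>x. P x \<Longrightarrow> P (f x)) \<Longrightarrow> P ((f ^^ k) x)"
  by (induction k) auto

lemma PT_parents: "PT f \<Longrightarrow> PT (\<lambda>x. parents (f x))"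
proof (rule PT_comp[where f = parents])
  show "PT parents"
    unfolding parents_def
  proof (rule PT_funpow_nats)
    show "PT (\<lambda>p. grow_step (fst p) (snd p))" by (intro PT_grow_step PT_intros)
    show "PT (\<lambda>M :: bool list list. map (\<lambda>_. length M) [0..<length M])" by (intro PT_intros)
    show "PT (\<lambda>M :: bool list list. length M)" "PT (\<lambda>M :: bool list list. length M)" by (intro PT_intros)+
    show "length ((grow_step M ^^ j) (map (\<lambda>_. length M) [0..<length M])) \<le> length M \<and>
      (\<forall>e\<in>set ((grow_step M ^^ j) (map (\<lambda>_. length M) [0..<length M])). e \<le> length M)" for M j
    proof (rule funpow_inv[where P = "\<lambda>xs. length xs \<le> length M \<and> (\<forall>e\<in>set xs. e \<le> length M)"])
      show "length (map (\<lambda>_. length M) [0..<length M]) \<le> length M \<and>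
        (\<forall>e\<in>set (map (\<lambda>_. length M) [0..<length M]). e \<le> length M)" by simp
    qed (rule grow_step_bounded)
  qed
qed

lemma PT_climb: "PT f \<Longrightarrow> PT g \<Longrightarrow> PT h \<Longrightarrow> PT (\<lambda>x. climb (f x) (g x) (h x))"
proof (rule PT_comp3[where h = climb])
  show "PT (\<lambda>p. climb (fst p) (fst (snd p)) (snd (snd p)))"
    unfolding climb_def
  proof (rule PT_funpow)
    show "poly_bounded (\<lambda>n. n)" by (rule poly_bounded_id)
    show "PT (\<lambda>p. get (fst (fst p)) (snd p))" by (intro PT_intros PT_get)
    show "PT (\<lambda>p. fst (snd p))" "PT (\<lambda>p. snd (snd p))" by (intro PT_intros)+
    fix p :: "nat list \<times> nat \<times> nat" and j
    obtain ps k w where p: "p = (ps, k, w)" by (cases p)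
    have "get ps v \<le> size (enc ps)" for v
      using size_enc_nth_or[of 0 ps v] by (simp add: get_def)
    \<comment> \<open>After the first step the value is an entry of \<open>ps\<close> or the default
      0, whatever \<open>w\<close> was.\<close>
    then have "(get ps ^^ j) w \<le> w + size (enc ps)" by (cases j) (auto simp: trans_le_add2)
    then show "size (enc ((get (fst p) ^^ j) (snd (snd p)))) \<le> size (enc p)" unfolding p by simp
  qed
qed

lemma PT_below: "PT f \<Longrightarrow> PT g \<Longrightarrow> PT h \<Longrightarrow> PT (\<lambda>x. below (f x) (g x) (h x))"
  by (rule PT_comp3[where h = below], unfold below_def) (intro PT_intros PT_climb)

lemma PT_root_of: "PT f \<Longrightarrow> PT g \<Longrightarrow> PT (\<lambda>x. root_of (f x) (g x))"
  by (rule PT_comp2[where h = root_of], unfold root_of_def) (intro PT_intros PT_climb)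

lemma PT_subs: "PT f \<Longrightarrow> PT g \<Longrightarrow> PT h \<Longrightarrow> PT (\<lambda>x. subs (f x) (g x) (h x))"
  by (rule PT_comp3[where h = subs], unfold subs_def) (intro PT_intros PT_get PT_below)

lemma PT_good: "PT f \<Longrightarrow> PT g \<Longrightarrow> PT h \<Longrightarrow> PT (\<lambda>x. good (f x) (g x) (h x))"
  by (rule PT_comp3[where h = good], unfold good_def) (intro PT_intros PT_get PT_subs)

lemma PT_piece: "PT f \<Longrightarrow> PT g \<Longrightarrow> PT h \<Longrightarrow> PT (\<lambda>x. piece (f x) (g x) (h x))"
  by (rule PT_comp3[where h = piece], unfold piece_def) (intro PT_intros PT_root_of PT_subs)

lemma PT_goods: "PT f \<Longrightarrow> PT g \<Longrightarrow> PT (\<lambda>x. goods (f x) (g x))"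
  by (rule PT_comp2[where h = goods], unfold goods_def) (intro PT_intros PT_good)

lemma PT_cut: "PT f \<Longrightarrow> PT g \<Longrightarrow> PT h \<Longrightarrow> PT (\<lambda>x. cut (f x) (g x) (h x))"
  by (rule PT_comp3[where h = cut], unfold cut_def) (intro PT_intros PT_get PT_mem PT_piece)

lemma PT_dec_step: "PT f \<Longrightarrow> PT g \<Longrightarrow> PT (\<lambda>x. dec_step (f x) (g x))"
  by (rule PT_comp2[where h = dec_step], unfold dec_step_def) (intro PT_intros PT_goods PT_cut)

lemma dec_step_bounded:
  "length lab \<le> length ps \<and> (\<forall>e\<in>set lab. e \<le> length ps) \<Longrightarrow>
   length (dec_step ps lab) \<le> length ps \<and> (\<forall>e\<in>set (dec_step ps lab). e \<le> length ps)"
  unfolding dec_step_def cut_def goods_def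
  using hd_or_filter_upt_le by (auto simp: get_le)

lemma PT_loop_labels: "PT f \<Longrightarrow> PT (\<lambda>x. loop_labels (f x))"
proof (rule PT_comp[where f = loop_labels])
  show "PT loop_labels"
    unfolding loop_labels_def
  proof (rule PT_funpow_nats)
    show "PT (\<lambda>p. dec_step (fst p) (snd p))" by (intro PT_dec_step PT_intros)
    show "PT (\<lambda>ps :: nat list. map (\<lambda>_. length ps) [0..<length ps])" by (intro PT_intros)
    show "PT (\<lambda>ps :: nat list. length ps)" "PT (\<lambda>ps :: nat list. length ps)" by (intro PT_intros)+
    show "length ((dec_step ps ^^ j) (map (\<lambda>_. length ps) [0..<length ps])) \<le> length ps \<and>
      (\<forall>e\<in>set ((dec_step ps ^^ j) (map (\<lambda>_. length ps) [0..<length ps])). e \<le> length ps)" for ps j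
    proof (rule funpow_inv[where P = "\<lambda>xs. length xs \<le> length ps \<and> (\<forall>e\<in>set xs. e \<le> length ps)"])
      show "length (map (\<lambda>_. length ps) [0..<length ps]) \<le> length ps \<and>
        (\<forall>e\<in>set (map (\<lambda>_. length ps) [0..<length ps]). e \<le> length ps)" by simp
    qed (rule dec_step_bounded)
  qed
qed

lemma PT_labels: "PT f \<Longrightarrow> PT (\<lambda>x. labels (f x))"
  by (rule PT_comp[where f = labels], unfold labels_def)
     (intro PT_intros PT_get PT_root_of PT_loop_labels)

lemma PT_hadj: "PT e \<Longrightarrow> PT f \<Longrightarrow> PT g \<Longrightarrow> PT h \<Longrightarrow> PT (\<lambda>x. hadj (e x) (f x) (g x) (h x))"
  by (rule PT_comp4[where h = hadj], unfold hadj_def) (intro PT_intros PT_get)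

lemma PT_hmat: "PT f \<Longrightarrow> PT g \<Longrightarrow> PT (\<lambda>x. hmat (f x) (g x))"
  by (rule PT_comp2[where h = hmat], unfold hmat_def) (intro PT_intros PT_hadj)

lemma PT_cen: "PT f \<Longrightarrow> PT g \<Longrightarrow> PT h \<Longrightarrow> PT (\<lambda>x. cen (f x) (g x) (h x))"
  by (rule PT_comp3[where h = cen], unfold cen_def) (intro PT_intros PT_get PT_hadj)

lemma PT_cens: "PT f \<Longrightarrow> PT g \<Longrightarrow> PT (\<lambda>x. cens (f x) (g x))"
  by (rule PT_comp2[where h = cens], unfold cens_def) (intro PT_intros PT_get PT_cen)

lemma PT_dom_test: "PT f \<Longrightarrow> PT g \<Longrightarrow> PT h \<Longrightarrow> PT (\<lambda>x. dom_test (f x) (g x) (h x))"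
  by (rule PT_comp3[where h = dom_test], unfold dom_test_def) (intro PT_intros PT_adj)

lemma PT_dom_num: "PT f \<Longrightarrow> PT g \<Longrightarrow> PT (\<lambda>x. dom_num (f x) (g x))"
  by (rule PT_comp2[where h = dom_num], unfold dom_num_def) (intro PT_intros PT_dom_test)

lemma PT_key: "PT e \<Longrightarrow> PT f \<Longrightarrow> PT g \<Longrightarrow> PT h \<Longrightarrow> PT (\<lambda>x. key (e x) (f x) (g x) (h x))"
  by (rule PT_comp4[where h = key], unfold key_def) (intro PT_intros PT_dom_num PT_dom_test)

lemma PT_pick: "PT f \<Longrightarrow> PT g \<Longrightarrow> PT h \<Longrightarrow> PT (\<lambda>x. pick (f x) (g x) (h x))"
  by (rule PT_comp3[where h = pick], unfold pick_def) (intro PT_intros PT_mem PT_key)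

lemma PT_greedy_run: "PT f \<Longrightarrow> PT g \<Longrightarrow> PT h \<Longrightarrow> PT (\<lambda>x. greedy_run (f x) (g x) (h x))"
proof (rule PT_comp3[where h = greedy_run])
  show "PT (\<lambda>p. greedy_run (fst p) (fst (snd p)) (snd (snd p)))"
    unfolding greedy_run_def
  proof (rule PT_funpow_nats)
    show "PT (\<lambda>p. pick (fst (fst p)) (fst (snd (fst p))) (snd p) # snd p)" by (intro PT_intros PT_pick)
    show "PT (\<lambda>p. snd (snd p))" "PT (\<lambda>p. [])" by (intro PT_intros)+
    \<comment> \<open>The bound must hold for all inputs of the type, also when the number of
      iterations exceeds the number of vertices; hence the sum.\<close>
    show "PT (\<lambda>p. length (fst p) + snd (snd p))" by (intro PT_intros)
    show "length (((\<lambda>A. pick (fst p) (fst (snd p)) A # A) ^^ j) []) \<le> length (fst p) + snd (snd p) \<and>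
      (\<forall>e\<in>set (((\<lambda>A. pick (fst p) (fst (snd p)) A # A) ^^ j) []). e \<le> length (fst p) + snd (snd p))"
      if "j \<le> snd (snd p)" for p :: "bool list list \<times> bool list \<times> nat" and j
    proof -
      have "length (((\<lambda>A. pick (fst p) (fst (snd p)) A # A) ^^ j) []) = j" by (induction j) auto
      moreover have "pick M C A \<le> length M" for M C A
        unfolding pick_def by (rule hd_or_filter_upt_le)
      then have "\<forall>e\<in>set (((\<lambda>A. pick (fst p) (fst (snd p)) A # A) ^^ j) []). e \<le> length (fst p) + snd (snd p)"
        by (intro funpow_inv[where P = "\<lambda>xs. \<forall>e\<in>set xs. e \<le> length (fst p) + snd (snd p)"])
           (auto simp: trans_le_add1)
      ultimately show ?thesis using that by simp
    qed
  qed
qed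

lemma PT_best: "PT f \<Longrightarrow> PT g \<Longrightarrow> PT h \<Longrightarrow> PT (\<lambda>x. best (f x) (g x) (h x))"
  by (rule PT_comp3[where h = best], unfold best_def) (intro PT_intros PT_mem PT_dom_num)

lemma PT_dec_run: "PT f \<Longrightarrow> PT g \<Longrightarrow> PT h \<Longrightarrow> PT (\<lambda>x. dec_run (f x) (g x) (h x))"
  by (rule PT_comp3[where h = dec_run], unfold dec_run_def) (intro PT_intros PT_greedy_run PT_hmat PT_cens)

lemma PT_alg: "PT (\<lambda>x. alg (fst x) (snd x))"
  unfolding alg_def by (intro PT_intros PT_best PT_greedy_run PT_dec_run PT_parents PT_labels)

section \<open>Meaning of the list operations\<close>

lemma get_upd: "i < length xs \<Longrightarrow> get (upd xs y z) i = (if i = y then z else get xs i)"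
  by (simp add: upd_def get_def nth_or_eq)

lemma length_upd [simp]: "length (upd xs y z) = length xs"
  by (simp add: upd_def)

lemma get_map_upt: "i < n \<Longrightarrow> get (map f [0..<n]) i = f i"
  by (simp add: get_def nth_or_eq)

lemma mem_iff: "mem xs i \<longleftrightarrow> i \<in> set xs"
  by (auto simp: mem_def list_ex_iff)

lemma length_filter_upt: "length (filter P [0..<n]) = card {i. i < n \<and> P i}"
  by (simp add: distinct_length_filter Int_def conj_commute)

text \<open>Applied to the input graph and again to the computed graph \<open>H\<close>.\<close>

definition represents :: "nat \<Rightarrow> nat set set \<Rightarrow> bool list list \<Rightarrow> bool" where
  "represents n E M \<longleftrightarrow> length M = n \<and> (\<forall>i<n. \<forall>j<n. adj M i j \<longleftrightarrow> {i, j} \<in> E)"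

lemma represents_map:
  "(\<And>i j. i < n \<Longrightarrow> j < n \<Longrightarrow> f i j \<longleftrightarrow> {i, j} \<in> E) \<Longrightarrow>
   represents n E (map (\<lambda>i. map (\<lambda>j. f i j) [0..<n]) [0..<n])"
  by (simp add: represents_def adj_def nth_or_eq)

subsection \<open>The spanning forest\<close>

locale input_graph =
  fixes n :: nat and E :: "nat set set" and M :: "bool list list"
  assumes ug: "ugraph {0..<n} E" and rep: "represents n E M"
begin

lemma length_M: "length M = n"
  using rep by (simp add: represents_def)

lemma adj_M: "i < n \<Longrightarrow> j < n \<Longrightarrow> adj M i j \<longleftrightarrow> {i, j} \<in> E"
  using rep by (simp add: represents_def)

lemma E_V: "{x, y} \<in> E \<Longrightarrow> x < n \<and> y < n"
  using ug unfolding ugraph_def by (auto simp: doubleton_eq_iff)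

definition vis :: "nat list \<Rightarrow> nat set" where
  "vis ps = {y. y < n \<and> get ps y < n}"

definition forest :: "nat list \<Rightarrow> nat set set" where
  "forest ps = {{y, get ps y} |y. y \<in> vis ps \<and> get ps y \<noteq> y}"

text \<open>The rank exists only in the proof and is not computed. Bounding it by the number of
  visited vertices keeps it below \<open>n\<close> at the end, as \<open>rooted_forest\<close>
  requires with \<open>N = n\<close>.\<close>

definition ranked :: "nat list \<Rightarrow> (nat \<Rightarrow> nat) \<Rightarrow> bool" where
  "ranked ps rank \<longleftrightarrow> (\<forall>y\<in>vis ps. get ps y \<in> vis ps \<and> rank y < card (vis ps) \<and>
     (get ps y \<noteq> y \<longrightarrow> rank (get ps y) < rank y \<and> {get ps y, y} \<in> E))"

text \<open>The edges of the forest lie in \<open>E\<close> by \<open>ranked\<close>. Together with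
  the last clause this yields equal components as soon as all vertices are visited.\<close>

definition grow_inv :: "nat list \<Rightarrow> bool" where
  "grow_inv ps \<longleftrightarrow> length ps = n \<and> (\<exists>rank. ranked ps rank) \<and>
     (\<forall>x\<in>vis ps. \<forall>y\<in>vis ps. connects E x y \<longrightarrow> connects (forest ps) x y)"

lemma finite_vis: "finite (vis ps)"
  unfolding vis_def by simp

text \<open>A new root is connected to no visited vertex, so there is nothing to join. A new child
  reaches all visited vertices of its component through \<open>z\<close>.\<close>

lemma extend:
  assumes inv: "grow_inv ps" and y: "y < n" "y \<notin> vis ps"
    and z: "z = y \<and> (\<forall>x\<in>vis ps. \<not> connects E x y) \<or> z \<in> vis ps \<and> {z, y} \<in> E"
  shows "grow_inv (upd ps y z)" "vis (upd ps y z) = insert y (vis ps)"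
proof -
  let ?qs = "upd ps y z"
  have len: "length ps = n" using inv unfolding grow_inv_def by blast
  have zn: "z < n" using z y unfolding vis_def by auto
  have get: "get ?qs i = (if i = y then z else get ps i)" if "i < n" for i
    using get_upd[of i ps y z] len that by simp
  show vis: "vis ?qs = insert y (vis ps)" unfolding vis_def using get y zn by auto
  have gy: "get ?qs y = z" using get y by simp
  have gv: "get ?qs x = get ps x" if "x \<in> vis ps" for x using get[of x] that y unfolding vis_def by auto
  have sub: "forest ps \<subseteq> forest ?qs"
  proof
    fix e assume "e \<in> forest ps"
    then obtain x where x: "e = {x, get ps x}" "x \<in> vis ps" "get ps x \<noteq> x" unfolding forest_def by blast
    then have "e = {x, get ?qs x}" "x \<in> vis ?qs" "get ?qs x \<noteq> x" using gv[OF x(2)] vis by auto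
    then show "e \<in> forest ?qs" unfolding forest_def by blast
  qed
  obtain rank where rank: "ranked ps rank" using inv unfolding grow_inv_def by blast
  define rank' where "rank' = rank(y := if z = y then 0 else Suc (rank z))"
  have card: "card (vis ?qs) = Suc (card (vis ps))" unfolding vis using y finite_vis by simp
  have r: "ranked ?qs rank'"
    unfolding ranked_def
  proof
    fix x assume "x \<in> vis ?qs"
    then consider "x = y" | "x \<in> vis ps" "x \<noteq> y" using vis y by auto
    then show "get ?qs x \<in> vis ?qs \<and> rank' x < card (vis ?qs) \<and>
      (get ?qs x \<noteq> x \<longrightarrow> rank' (get ?qs x) < rank' x \<and> {get ?qs x, x} \<in> E)"
    proof cases
      case 1
      show ?thesis
      proof (cases "z = y")
        case True
        then show ?thesis using 1 gy vis card by (simp add: rank'_def)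
      next
        case False
        then have z': "z \<in> vis ps" "{z, y} \<in> E" using z by auto
        then have "rank z < card (vis ps)" using rank unfolding ranked_def by blast
        then show ?thesis using 1 gy vis card False z' by (simp add: rank'_def)
      qed
    next
      case 2
      have p: "get ps x \<in> vis ps" "rank x < card (vis ps)"
        "get ps x \<noteq> x \<longrightarrow> rank (get ps x) < rank x \<and> {get ps x, x} \<in> E"
        using rank 2 unfolding ranked_def by auto
      then have "get ps x \<noteq> y" using y by auto
      then show ?thesis using p 2 vis card gv[OF 2(1)] by (simp add: rank'_def)
    qed
  qed
  have to_y: "connects (forest ?qs) x y" if x: "x \<in> vis ps" "connects E x y" for x
  proof -
    have z': "z \<in> vis ps" "{z, y} \<in> E" using z x by auto
    have "connects E y z" using connects_sym[OF connects_edge[OF z'(2)]] .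
    then have "connects E x z" using connects_trans[OF x(2)] by blast
    then have "connects (forest ps) x z" using inv x(1) z'(1) unfolding grow_inv_def by blast
    then have 1: "connects (forest ?qs) x z" using connects_mono[OF _ sub] by blast
    have "z \<noteq> y" using z' y by auto
    then have "\<exists>x. {y, z} = {x, get ?qs x} \<and> x \<in> vis ?qs \<and> get ?qs x \<noteq> x"
      using gy vis by (intro exI[of _ y]) simp
    then have "{y, z} \<in> forest ?qs" unfolding forest_def by (rule CollectI)
    then have "connects (forest ?qs) z y" by (rule connects_sym[OF connects_edge])
    then show ?thesis using connects_trans[OF 1] by blast
  qed
  have "connects (forest ?qs) a b" if ab: "a \<in> vis ?qs" "b \<in> vis ?qs" "connects E a b" for a b
  proof -
    consider "a = b" | "a \<in> vis ps" "b = y" | "a = y" "b \<in> vis ps" | "a \<in> vis ps" "b \<in> vis ps"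
      using ab(1,2) unfolding vis by blast
    then show ?thesis
    proof cases
      case 1
      then show ?thesis by (simp add: connects_refl)
    next
      case 2
      then show ?thesis using to_y[of a] ab(3) by simp
    next
      case 3
      then have "connects (forest ?qs) b y" using to_y[of b] connects_sym[OF ab(3)] by simp
      then show ?thesis unfolding 3(1) by (rule connects_sym)
    next
      case 4
      then have "connects (forest ps) a b" using inv ab(3) unfolding grow_inv_def by blast
      then show ?thesis using connects_mono[OF _ sub] by blast
    qed
  qed
  then show "grow_inv ?qs" unfolding grow_inv_def using len r by auto
qed

lemma grow_step_inv:
  assumes inv: "grow_inv ps" and ne: "vis ps \<noteq> {0..<n}"
  shows "grow_inv (grow_step M ps)" "card (vis (grow_step M ps)) = Suc (card (vis ps))"
proof -
  have "\<exists>y z. grow_step M ps = upd ps y z \<and> y < n \<and> y \<notin> vis ps \<and>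
    (z = y \<and> (\<forall>x\<in>vis ps. \<not> connects E x y) \<or> z \<in> vis ps \<and> {z, y} \<in> E)"
  proof (cases "cand M ps = []")
    case False
    define y where "y = hd_or 0 (cand M ps)"
    define z where "z = link M ps y"
    have "y \<in> set [0..<length M]" "\<not> get ps y < length M \<and>
        list_ex (\<lambda>x. get ps x < length M \<and> adj M x y) [0..<length M]"
      unfolding y_def cand_def using False hd_or_filter[of _ "[0..<length M]" 0] unfolding cand_def by blast+
    then have y: "y < n" "y \<notin> vis ps" and "\<exists>x<n. get ps x < n \<and> adj M x y"
      unfolding length_M vis_def by (auto simp: list_ex_iff)
    then have fe: "filter (\<lambda>x. get ps x < length M \<and> adj M x y) [0..<length M] \<noteq> []"
      unfolding length_M filter_empty_conv by auto
    have "z < n" "get ps z < n" "adj M z y"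
      using hd_or_filter[OF fe, of 0] unfolding z_def link_def length_M by auto
    then have "z \<in> vis ps" "{z, y} \<in> E" using adj_M y unfolding vis_def by auto
    moreover have "grow_step M ps = upd ps y z" using False unfolding grow_step_def y_def z_def by simp
    ultimately show ?thesis using y by blast
  next
    case True
    \<comment> \<open>Without candidates no edge leaves the visited set, so an unvisited vertex lies
      in a component not met so far and may become a root.\<close>
    have cl: "b \<in> vis ps" if "a \<in> vis ps" "{a, b} \<in> E" for a b
    proof (rule ccontr)
      assume "b \<notin> vis ps"
      moreover have "a < n" "b < n" "get ps a < n" using E_V[OF that(2)] that(1) unfolding vis_def by auto
      ultimately have "b \<in> set (cand M ps)"
        unfolding cand_def length_M vis_def using adj_M[of a b] that by (auto simp: list_ex_iff)
      then show False using True by simp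
    qed
    have fresh: "fresh M ps \<noteq> []"
    proof -
      have "vis ps \<subseteq> {0..<n}" unfolding vis_def by auto
      then have "\<not> {0..<n} \<subseteq> vis ps" using ne by blast
      then obtain y where "y \<in> {0..<n}" "y \<notin> vis ps" by blast
      then have "y \<in> set (fresh M ps)" unfolding fresh_def length_M vis_def by auto
      then show ?thesis by auto
    qed
    define y where "y = hd_or 0 (fresh M ps)"
    have y: "y < n" "y \<notin> vis ps"
      using hd_or_filter[of _ "[0..<length M]" 0] fresh unfolding y_def fresh_def length_M vis_def by auto
    have "\<not> connects E x y" if "x \<in> vis ps" for x
    proof
      assume "connects E x y"
      then have "y \<in> vis ps" unfolding connects_iff_rtrancl
        by (induction rule: rtrancl_induct) (use that cl in auto)
      then show False using y by blast
    qed
    moreover have "grow_step M ps = upd ps y y" using True fresh unfolding grow_step_def y_def by simp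
    ultimately show ?thesis using y by blast
  qed
  then obtain y z where yz: "grow_step M ps = upd ps y z" "y < n" "y \<notin> vis ps"
    "z = y \<and> (\<forall>x\<in>vis ps. \<not> connects E x y) \<or> z \<in> vis ps \<and> {z, y} \<in> E" by blast
  show "grow_inv (grow_step M ps)" unfolding yz(1) by (rule extend(1)[OF inv yz(2-4)])
  show "card (vis (grow_step M ps)) = Suc (card (vis ps))"
    unfolding yz(1) extend(2)[OF inv yz(2-4)] using yz(3) finite_vis by simp
qed

lemma grow_step_full: "vis ps = {0..<n} \<Longrightarrow> grow_step M ps = ps"
proof -
  assume full: "vis ps = {0..<n}"
  have v: "get ps y < n" if "y < n" for y
  proof -
    have "y \<in> vis ps" using full that by simp
    then show ?thesis unfolding vis_def by blast
  qed
  have "cand M ps = []" unfolding cand_def length_M filter_empty_conv using v by auto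
  moreover have "fresh M ps = []" unfolding fresh_def length_M filter_empty_conv using v by auto
  ultimately show ?thesis unfolding grow_step_def by simp
qed

text \<open>After \<open>k\<close> iterations either all vertices are visited or exactly
  \<open>k\<close> of them; for \<open>k = n\<close> both alternatives mean the same.\<close>

lemma parents_inv: "grow_inv (parents M)" "vis (parents M) = {0..<n}"
proof -
  let ?ps = "\<lambda>k. (grow_step M ^^ k) (map (\<lambda>_. length M) [0..<length M])"
  have v0: "vis (?ps 0) = {}" unfolding vis_def length_M by (auto simp: get_map_upt)
  have *: "grow_inv (?ps k) \<and> (vis (?ps k) = {0..<n} \<or> card (vis (?ps k)) = k)" for k
  proof (induction k)
    case 0
    show ?case using v0 unfolding grow_inv_def ranked_def by (simp add: length_M)
  next
    case (Suc k)
    show ?case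
    proof (cases "vis (?ps k) = {0..<n}")
      case True
      then show ?thesis using Suc grow_step_full[OF True] by simp
    next
      case False
      then show ?thesis using Suc grow_step_inv[of "?ps k"] by simp
    qed
  qed
  have "vis (?ps n) \<subseteq> {0..<n}" unfolding vis_def by auto
  then have "vis (?ps n) = {0..<n}" using *[of n] card_subset_eq[of "{0..<n}" "vis (?ps n)"] by auto
  then show "grow_inv (parents M)" "vis (parents M) = {0..<n}"
    using *[of n] unfolding parents_def length_M by auto
qed

end

subsection \<open>The decomposition\<close>

locale list_forest = rooted_forest "{0..<n}" "get ps" rank n for n ps rank +
  assumes len: "length ps = n"
begin

definition rem :: "nat list \<Rightarrow> nat set" where
  "rem lab = {w. w < n \<and> get lab w = n}"

lemma root_of_eq: "root_of ps w = rt w"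
  unfolding root_of_def climb_def rt_def len ..

lemma below_iff: "w < n \<Longrightarrow> below ps u w \<longleftrightarrow> anc u w"
proof -
  assume "w < n"
  then have "anc u w \<longleftrightarrow> (\<exists>k\<le>n. (get ps ^^ k) w = u)" using anc_bounded[of w u] by simp
  also have "\<dots> \<longleftrightarrow> (\<exists>k\<in>set [0..<Suc n]. (get ps ^^ k) w = u)"
    unfolding set_upt by (simp add: Bex_def less_Suc_eq_le)
  finally show ?thesis unfolding below_def climb_def len list_ex_iff by simp
qed

lemma set_subs: "set (subs ps lab u) = sub (rem lab) u"
  unfolding subs_def sub_def rem_def len using below_iff by auto

lemma length_subs: "length (subs ps lab u) = card (sub (rem lab) u)"
proof -
  have "distinct (subs ps lab u)" unfolding subs_def by simp
  then show ?thesis using distinct_card set_subs by metis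
qed

lemma good_iff: "u < n \<Longrightarrow> good ps lab u \<longleftrightarrow> gd (rem lab) u"
  unfolding good_def gd_def length_subs len by (auto simp: rem_def list_all_iff)

text \<open>The program subtracts lengths where \<open>pc\<close> counts a set difference. The two
  agree because the subtree is contained in its tree.\<close>

lemma set_piece:
  assumes "par_closed (rem lab)" "u \<in> rem lab"
  shows "set (piece ps lab u) = pc (rem lab) u"
proof -
  have uV: "u \<in> {0..<n}" using assms(2) unfolding rem_def by auto
  have "card (sub (rem lab) (rt u) - sub (rem lab) u) = card (sub (rem lab) (rt u)) - card (sub (rem lab) u)"
    using sub_subset_tree[OF assms(1) uV] finite_subset[OF sub_subset finite_closed[OF assms(1)]]
    unfolding sub_rt[OF assms(1) uV] by (intro card_Diff_subset)
  then show ?thesis unfolding piece_def pc_def root_of_eq length_subs by (simp add: set_subs)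
qed

lemma cut_props:
  assumes "par_closed (rem lab)" "u \<in> rem lab"
  shows "length (cut ps lab u) = n"
    and "w < n \<Longrightarrow> get (cut ps lab u) w = (if w \<in> pc (rem lab) u then u else get lab w)"
    and "rem (cut ps lab u) = rem lab - pc (rem lab) u"
proof -
  show "length (cut ps lab u) = n" unfolding cut_def len by simp
  show get: "get (cut ps lab u) w = (if w \<in> pc (rem lab) u then u else get lab w)" if "w < n" for w
    unfolding cut_def len using that get_map_upt[of w n] by (simp add: mem_iff set_piece[OF assms])
  have un: "u < n" using assms(2) unfolding rem_def by blast
  define X where "X = pc (rem lab) u"
  have "w \<in> rem (cut ps lab u) \<longleftrightarrow> w \<in> rem lab \<and> w \<notin> X" for w
    using get[of w, folded X_def] un unfolding rem_def by (cases "w < n"; cases "w \<in> X") simp_all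
  then show "rem (cut ps lab u) = rem lab - pc (rem lab) u" unfolding X_def by blast
qed

text \<open>Each cut removes at least \<open>u\<close>, so \<open>card (rem lab)\<close> iterations
  suffice. Labels of removed vertices are never overwritten, so the label \<open>u\<close> given by
  a cut is still present at the end, as \<open>dec_ok_cut\<close> demands.\<close>

lemma dec_steps:
  assumes "length lab = n" "par_closed (rem lab)" "card (rem lab) \<le> k"
  shows "length ((dec_step ps ^^ k) lab) = n \<and>
    (\<forall>w<n. w \<notin> rem lab \<longrightarrow> get ((dec_step ps ^^ k) lab) w = get lab w) \<and>
    dec_ok n (rem lab) (get ((dec_step ps ^^ k) lab))"
  using assms
proof (induction k arbitrary: lab)
  case 0
  then have "rem lab = {}" using finite_closed by simp
  then have "dec_ok n (rem lab) (get lab)" using 0 by (intro dec_ok_stop) (auto simp: gd_def)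
  then show ?case using 0 by simp
next
  case (Suc k)
  show ?case
  proof (cases "goods ps lab = []")
    case True
    then have "dec_step ps lab = lab" unfolding dec_step_def by simp
    then have stay: "(dec_step ps ^^ j) lab = lab" for j by (induction j) auto
    have "\<not> gd (rem lab) u" for u
    proof
      assume g: "gd (rem lab) u"
      then have "u < n" unfolding gd_def rem_def by blast
      then have "u \<in> set (goods ps lab)" using good_iff g unfolding goods_def len by auto
      then show False using True by simp
    qed
    then have "dec_ok n (rem lab) (get lab)"
      using Suc.prems(2) by (intro dec_ok_stop) (auto simp: rem_def)
    then show ?thesis using Suc.prems stay[of "Suc k"] by simp
  next
    case False
    define u where "u = hd_or 0 (goods ps lab)"
    have "u < n" "good ps lab u"
      using hd_or_filter[of "good ps lab" "[0..<length ps]" 0] False unfolding u_def goods_def len by auto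
    then have g: "gd (rem lab) u" using good_iff by blast
    then have u: "u \<in> rem lab" unfolding gd_def by blast
    note cut = cut_props[OF Suc.prems(2) u] and pcp = pc_props[OF Suc.prems(2) u]
    have step: "(dec_step ps ^^ Suc k) lab = (dec_step ps ^^ k) (cut ps lab u)"
      using False unfolding funpow_Suc_right dec_step_def u_def by simp
    have "card (rem lab - pc (rem lab) u) < card (rem lab)"
      using u pcp(1) finite_closed[OF Suc.prems(2)] by (intro psubset_card_mono) auto
    then have "card (rem (cut ps lab u)) \<le> k" using Suc.prems(3) unfolding cut(3) by simp
    moreover have "par_closed (rem (cut ps lab u))" unfolding cut(3) by (rule pcp(3))
    ultimately have IH: "length ((dec_step ps ^^ k) (cut ps lab u)) = n"
      "\<forall>w<n. w \<notin> rem (cut ps lab u) \<longrightarrow> get ((dec_step ps ^^ k) (cut ps lab u)) w = get (cut ps lab u) w"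
      "dec_ok n (rem (cut ps lab u)) (get ((dec_step ps ^^ k) (cut ps lab u)))"
      using Suc.IH[of "cut ps lab u"] cut(1) by auto
    have pcr: "pc (rem lab) u \<subseteq> rem lab" using pcp(2) unfolding tree_def by blast
    have "dec_ok n (rem lab) (get ((dec_step ps ^^ k) (cut ps lab u)))"
    proof (rule dec_ok_cut[OF Suc.prems(2) g])
      show "dec_ok n (rem lab - pc (rem lab) u) (get ((dec_step ps ^^ k) (cut ps lab u)))"
        using IH(3) unfolding cut(3) .
      show "get ((dec_step ps ^^ k) (cut ps lab u)) w = u" if "w \<in> pc (rem lab) u" for w
      proof -
        have "w < n" using that pcr unfolding rem_def by blast
        then show ?thesis using IH(2) cut(2)[of w] cut(3) that by auto
      qed
    qed simp
    moreover have "get ((dec_step ps ^^ k) (cut ps lab u)) w = get lab w" if "w < n" "w \<notin> rem lab" for w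
      using IH(2) cut(2)[OF that(1)] that pcr unfolding cut(3) by auto
    ultimately show ?thesis unfolding step using IH(1) by blast
  qed
qed

abbreviation vert :: "nat set" where
  "vert \<equiv> {0..<n}"

abbreviation lb :: "nat \<Rightarrow> nat" where
  "lb \<equiv> get (labels ps)"

lemma dec_ok_loop: "dec_ok n vert (get (loop_labels ps))"
proof -
  let ?l = "map (\<lambda>_. n) [0..<n]"
  have r: "rem ?l = vert" unfolding rem_def by (auto simp: get_map_upt)
  have "par_closed (rem ?l)" unfolding r par_closed_def using par_V by blast
  then show ?thesis using dec_steps[of ?l n] unfolding r loop_labels_def len by simp
qed

lemma lb_eq: "w < n \<Longrightarrow> lb w = (if get (loop_labels ps) w = n then rt w else get (loop_labels ps) w)"
  unfolding labels_def len by (simp add: get_map_upt root_of_eq)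

lemma rt_lb:
  assumes "w < n"
  shows "rt (lb w) = rt w" "lb w < n"
proof -
  have w: "w \<in> vert" using assms by simp
  have ok: "get (loop_labels ps) w = n \<or> get (loop_labels ps) w \<in> vert \<and> rt (get (loop_labels ps) w) = rt w"
    using dec_ok_loop w unfolding dec_ok_def by blast
  show "rt (lb w) = rt w" using ok lb_eq[OF assms] rt_rt[OF w] by auto
  show "lb w < n" using ok lb_eq[OF assms] rt_V[OF w] by auto
qed

definition piece_of :: "nat \<Rightarrow> nat set" where
  "piece_of u = {w \<in> vert. lb w = u}"

lemma closed_vert: "par_closed vert"
  unfolding par_closed_def using par_V by blast

text \<open>Trees processed by the loop inherit both claims from \<open>dec_ok\<close>. A tree with
  fewer than three vertices carries its root as the only label, hence forms one piece, and is a
  spider because all its subtrees are small.\<close>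

lemma tree_decomposition:
  assumes r: "r = rt x" "x < n"
  shows "decomposition F r (tree vert r) (piece_of ` lb ` tree vert r)"
    and "\<And>u. u \<in> lb ` tree vert r \<Longrightarrow> spider F (piece_of u) u"
proof -
  let ?T = "tree vert r" and ?L = "get (loop_labels ps)"
  have xV: "x \<in> vert" using r by simp
  have rr: "par_closed ?T" "r \<in> ?T" "rt r = r" "get ps r = r"
    using closed_tree[OF closed_vert] rt_V[OF xV] rt_rt[OF xV] par_rt[OF xV] r(1) unfolding tree_def by auto
  have inT: "w \<in> ?T" if "w < n" "rt w = r" for w using that unfolding tree_def by simp
  have Tn: "w < n" "rt w = r" if "w \<in> ?T" for w using that unfolding tree_def by auto
  have "decomposition F r ?T (piece_of ` lb ` ?T) \<and> (\<forall>u\<in>lb ` ?T. spider F (piece_of u) u)"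
  proof (cases "card ?T < 3")
    case True
    then have "\<forall>w\<in>?T. ?L w = n" using dec_ok_loop unfolding dec_ok_def by blast
    then have l: "lb w = r" if "w \<in> ?T" for w using lb_eq[OF Tn(1)[OF that]] Tn(2)[OF that] that by simp
    then have im: "lb ` ?T = {r}" using rr(2) by auto
    have p: "piece_of r = ?T"
    proof
      show "piece_of r \<subseteq> ?T"
      proof
        fix w assume "w \<in> piece_of r"
        then have "w < n" "lb w = r" unfolding piece_of_def by auto
        then show "w \<in> ?T" using rt_lb(1)[of w] rr(3) inT by auto
      qed
      show "?T \<subseteq> piece_of r" using l Tn(1) unfolding piece_of_def by auto
    qed
    have T: "?T \<subseteq> vert" "\<forall>x\<in>?T. get ps x \<in> ?T" using rr(1) unfolding par_closed_def by auto
    have "anc r w" if "w \<in> ?T" for w using anc_rt[of w] Tn(2)[OF that] by simp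
    then have "sub ?T r = ?T" unfolding sub_def by blast
    moreover have "spider F (sub ?T r) r"
    proof (rule sub_spider[OF T rr(2)])
      have "card (sub ?T y) \<le> 2" for y
        using card_mono[OF finite_closed[OF rr(1)] sub_subset, of y] True by simp
      then show "\<forall>y\<in>?T. get ps y = r \<and> y \<noteq> r \<longrightarrow> card (sub ?T y) \<le> 2" by blast
    qed
    ultimately show ?thesis unfolding im decomposition_def using True p by simp
  next
    case False
    then have ok: "\<forall>w\<in>?T. ?L w \<noteq> n"
      "decomposition_loop F r ?T ((\<lambda>u. {w \<in> vert. ?L w = u}) ` ?L ` ?T)"
      "\<forall>u\<in>?L ` ?T. spider F {w \<in> vert. ?L w = u} u"
      using dec_ok_loop unfolding dec_ok_def by (meson not_le)+
    have l: "lb w = ?L w" if "w \<in> ?T" for w using lb_eq[OF Tn(1)[OF that]] ok(1) that by simp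
    then have im: "lb ` ?T = ?L ` ?T" by (intro image_cong) auto
    \<comment> \<open>\<open>piece_of\<close> ranges over all vertices, but by \<open>rt_lb\<close>
      a label determines the root, so no vertex of another tree enters.\<close>
    have p: "piece_of u = {w \<in> vert. ?L w = u}" if u: "u \<in> lb ` ?T" for u
    proof -
      obtain v where v: "v \<in> ?T" "u = lb v" using u by blast
      have un: "u < n" "rt u = r" using rt_lb[OF Tn(1)[OF v(1)]] v Tn(2)[OF v(1)] by auto
      have "lb w = u \<longleftrightarrow> ?L w = u" if "w < n" for w
      proof
        assume "lb w = u"
        then have "w \<in> ?T" using rt_lb(1)[OF that] un(2) inT[OF that] by simp
        then show "?L w = u" using l \<open>lb w = u\<close> by simp
      next
        assume "?L w = u"
        then show "lb w = u" using lb_eq[OF that] un(1) by simp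
      qed
      then show ?thesis unfolding piece_of_def by auto
    qed
    have "piece_of ` lb ` ?T = (\<lambda>u. {w \<in> vert. ?L w = u}) ` ?L ` ?T"
      unfolding im[symmetric] using p by (intro image_cong) auto
    moreover have "\<forall>u\<in>lb ` ?T. spider F (piece_of u) u" using ok(3) p unfolding im by auto
    ultimately show ?thesis unfolding decomposition_def using False ok(2) by simp
  qed
  then show "decomposition F r ?T (piece_of ` lb ` ?T)"
    "\<And>u. u \<in> lb ` ?T \<Longrightarrow> spider F (piece_of u) u" by blast+
qed

lemma piece_spider: "w < n \<Longrightarrow> spider F (piece_of (lb w)) (lb w)"
proof -
  assume w: "w < n"
  then have "w \<in> tree vert (rt w)" unfolding tree_def by simp
  then show ?thesis using tree_decomposition(2)[OF refl w, of "lb w"] by blast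
qed

lemma spider_mem: "spider F X u \<Longrightarrow> u \<in> X"
  unfolding spider_def in_S_def by auto

lemma lb_lb: "w < n \<Longrightarrow> lb (lb w) = lb w"
  using spider_mem[OF piece_spider] unfolding piece_of_def by blast

lemma hadj_iff:
  assumes "x < n" "y < n"
  shows "hadj ps (labels ps) x y \<longleftrightarrow> {x, y} \<in> induced_edges F (piece_of (lb x))"
  unfolding hadj_def induced_edges_def piece_of_def using F_edge[of x y] assms by auto

lemma degree_in_S:
  assumes S: "in_S a b f g X H"
  shows "{w. {f 0, w} \<in> H} = f ` {1..a+b}"
proof -
  note S' = S[unfolded in_S_def]
  have inj: "inj_on f {0..a+b}" and disj: "f ` {0..a+b} \<inter> g ` {1..b} = {}"
    and H: "H = {{f 0, f j} |j. 1 \<le> j \<and> j \<le> a+b} \<union> {{f (a+j), g j} |j. 1 \<le> j \<and> j \<le> b}"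
    using S' by blast+
  show ?thesis
  proof
    show "f ` {1..a+b} \<subseteq> {w. {f 0, w} \<in> H}" unfolding H by auto
    show "{w. {f 0, w} \<in> H} \<subseteq> f ` {1..a+b}"
    proof
      fix w assume "w \<in> {w. {f 0, w} \<in> H}"
      then consider j where "{f 0, w} = {f 0, f j}" "1 \<le> j" "j \<le> a+b"
        | j where "{f 0, w} = {f (a+j), g j}" "1 \<le> j" "j \<le> b" unfolding H by blast
      then show "w \<in> f ` {1..a+b}"
      proof cases
        case (1 j)
        then have "w = f j" by (auto simp: doubleton_eq_iff)
        then show ?thesis using 1 by auto
      next
        case (2 j)
        have "f 0 \<noteq> f (a + j)" using 2 by (simp add: inj_on_eq_iff[OF inj])
        moreover have "f 0 \<noteq> g j"
        proof -
          have "f 0 \<in> f ` {0..a+b}" "g j \<in> g ` {1..b}" using 2 by auto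
          then show ?thesis using disj by (metis disjoint_iff)
        qed
        ultimately show ?thesis using 2(1) by (auto simp: doubleton_eq_iff)
      qed
    qed
  qed
qed

lemma cen_is_center:
  assumes w: "w < n"
  shows "is_center (piece_of (lb w)) (induced_edges F (piece_of (lb w))) (cen ps (labels ps) (lb w))"
proof -
  define u where "u = lb w"
  let ?X = "piece_of u" and ?H = "induced_edges F (piece_of u)"
  obtain a b f g where S: "in_S a b f g ?X ?H" and f0: "f 0 = u"
    using piece_spider[OF w] unfolding spider_def u_def by blast
  have un: "u < n" using rt_lb(2)[OF w] unfolding u_def .
  have uu: "lb u = u" using lb_lb[OF w] unfolding u_def .
  have card: "card {i. i < n \<and> lb i = u} = 1 + a + 2 * b"
    using card_in_S[OF S] unfolding piece_of_def by simp
  have H: "hadj ps (labels ps) u v \<longleftrightarrow> {u, v} \<in> ?H" if "v < n" for v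
    using hadj_iff[OF un that] uu by simp
  have nb: "{v. v < n \<and> hadj ps (labels ps) u v} = f ` {1..a+b}"
  proof -
    have "v < n" if "{u, v} \<in> ?H" for v using that unfolding induced_edges_def piece_of_def by auto
    then have "{v. v < n \<and> hadj ps (labels ps) u v} = {v. {f 0, v} \<in> ?H}" unfolding f0 using H by blast
    then show ?thesis using degree_in_S[OF S] by simp
  qed
  have "inj_on f {1..a+b}" using S unfolding in_S_def by (auto intro: inj_on_subset)
  then have deg: "card {v. v < n \<and> hadj ps (labels ps) u v} = a + b" unfolding nb by (simp add: card_image)
  show ?thesis
  proof (cases "a = 0 \<and> b = 2")
    case True
    have ne: "filter (\<lambda>v. hadj ps (labels ps) u v) [0..<n] \<noteq> []"
      using deg True length_filter_upt[of "\<lambda>v. hadj ps (labels ps) u v" n] by auto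
    have c: "cen ps (labels ps) u = hd_or 0 (filter (\<lambda>v. hadj ps (labels ps) u v) [0..<n])"
      unfolding cen_def len length_filter_upt using card deg True by simp
    have "cen ps (labels ps) u \<in> {v. v < n \<and> hadj ps (labels ps) u v}"
      unfolding c using hd_or_filter[OF ne, of 0] by simp
    then have "cen ps (labels ps) u \<in> f ` {1..2}" unfolding nb using True by (metis add_0)
    moreover have "{1..2::nat} = {1, 2}" by auto
    ultimately have "cen ps (labels ps) u \<in> {f 1, f 2}" by (metis image_empty image_insert)
    then have "if a = 0 \<and> b = 2 then cen ps (labels ps) u \<in> {f 1, f 2} else cen ps (labels ps) u = f 0"
      using True by simp
    then show ?thesis unfolding is_center_def u_def[symmetric] using S by blast
  next
    case False
    then have "\<not> (1 + a + 2 * b = 5 \<and> a + b = 2)" by linarith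
    then have "cen ps (labels ps) u = u"
      unfolding cen_def len length_filter_upt card deg by (simp only: if_False)
    then have "if a = 0 \<and> b = 2 then cen ps (labels ps) u \<in> {f 1, f 2} else cen ps (labels ps) u = f 0"
      using f0 by (simp only: if_not_P[OF False])
    then show ?thesis unfolding is_center_def u_def[symmetric] using S by blast
  qed
qed

end

subsection \<open>The greedy runs\<close>

lemma dom_test_iff:
  assumes "represents n E M" "set A \<subseteq> {0..<n}" "y < n"
  shows "dom_test M A y \<longleftrightarrow> y \<in> dominated {0..<n} E (set A)"
  using assms unfolding dom_test_def dominated_def represents_def list_ex_iff by (auto simp: subset_iff)

lemma dom_num_eq:
  assumes "represents n E M" "set A \<subseteq> {0..<n}"
  shows "dom_num M A = dom_count {0..<n} E (set A)"
proof -
  have "{i. i < n \<and> dom_test M A i} = dominated {0..<n} E (set A)"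
    using dom_test_iff[OF assms] dominated_subset[of "{0..<n}" E "set A"] by auto
  then show ?thesis
    using assms(1) unfolding dom_num_def dom_count_def represents_def by (simp add: length_filter_upt)
qed

text \<open>As long as a vertex is left, some unchosen vertex has maximal key. So the filtered list
  is nonempty and the default 0 of \<open>hd_or\<close> does not occur.\<close>

lemma pick_props:
  assumes "length M = n" "set A \<subseteq> {0..<n}" "card (set A) < n"
  shows "pick M C A < n" "pick M C A \<notin> set A"
    and "\<And>w. w < n \<Longrightarrow> w \<notin> set A \<Longrightarrow> key M C A w \<le> key M C A (pick M C A)"
proof -
  let ?R = "{0..<n} - set A"
  let ?P = "\<lambda>v. \<not> mem A v \<and> list_all (\<lambda>w. \<not> mem A w \<longrightarrow> key M C A w \<le> key M C A v) [0..<length M]"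
  have "?R \<noteq> {}"
  proof
    assume "?R = {}"
    then have "{0..<n} \<subseteq> set A" by blast
    then have "card {0..<n} \<le> card (set A)" by (intro card_mono) auto
    then show False using assms(3) by simp
  qed
  then have "Max (key M C A ` ?R) \<in> key M C A ` ?R" by (intro Max_in) auto
  then obtain v where v: "v \<in> ?R" "key M C A v = Max (key M C A ` ?R)" by auto
  have "?P v" unfolding mem_iff list_all_iff assms(1) using v by auto
  then have "filter ?P [0..<length M] \<noteq> []" unfolding filter_empty_conv assms(1) using v(1) by auto
  from hd_or_filter[OF this, of 0] have "pick M C A \<in> set [0..<length M]" "?P (pick M C A)"
    unfolding pick_def by blast+
  then show "pick M C A < n" "pick M C A \<notin> set A"
    "\<And>w. w < n \<Longrightarrow> w \<notin> set A \<Longrightarrow> key M C A w \<le> key M C A (pick M C A)"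
    unfolding mem_iff list_all_iff assms(1) by auto
qed

text \<open>Serves both runs: a preference must show up as a strictly larger key among vertices of
  equal coverage, which is vacuous for \<open>no_preference\<close>.\<close>

lemma greedy_run_correct:
  assumes rep: "represents n E M" and "p \<le> n"
    and better: "\<And>A v w. \<lbrakk> set A \<subseteq> {0..<n}; v < n; w < n; better (set A) w v;
      dom_num M (w # A) = dom_num M (v # A) \<rbrakk> \<Longrightarrow> key M C A v < key M C A w"
  shows "set (greedy_run M C p) \<subseteq> {0..<n} \<and> card (set (greedy_run M C p)) = p \<and>
    greedy {0..<n} E better p (set (greedy_run M C p))"
  using assms(2)
proof (induction p)
  case 0
  show ?case by (simp add: greedy_run_def greedy.start)
next
  case (Suc p)
  define A where "A = greedy_run M C p"
  have A: "set A \<subseteq> {0..<n}" "card (set A) = p" "greedy {0..<n} E better p (set A)"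
    using Suc unfolding A_def by auto
  define v where "v = pick M C A"
  have run: "greedy_run M C (Suc p) = v # A" unfolding greedy_run_def A_def v_def by simp
  have "length M = n" using rep unfolding represents_def by blast
  from pick_props[OF this A(1), where C = C] A(2) Suc.prems
  have v: "v < n" "v \<notin> set A" "\<And>w. w < n \<Longrightarrow> w \<notin> set A \<Longrightarrow> key M C A w \<le> key M C A v"
    unfolding v_def by auto
  have dn: "dom_count {0..<n} E (insert w (set A)) = dom_num M (w # A)" if "w < n" for w
    using dom_num_eq[OF rep, of "w # A"] A(1) that by simp
  have arg: "is_arg_max (\<lambda>x. dom_count {0..<n} E (insert x (set A))) (\<lambda>x. x \<in> {0..<n} - set A) v"
    unfolding is_arg_max_def
  proof (intro conjI notI)
    show "v \<in> {0..<n} - set A" using v by simp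
    assume "\<exists>y. y \<in> {0..<n} - set A \<and>
      dom_count {0..<n} E (insert v (set A)) < dom_count {0..<n} E (insert y (set A))"
    then obtain y where y: "y < n" "y \<notin> set A" "dom_num M (v # A) < dom_num M (y # A)"
      using dn v(1) by auto
    \<comment> \<open>One more dominated vertex weighs 4 and exceeds the tie terms, which sum to at
      most 3.\<close>
    have "key M C A v < key M C A y" unfolding key_def using y(3) by (simp split: if_split)
    then show False using v(3)[OF y(1,2)] by simp
  qed
  have "\<not> better (set A) w v"
    if w: "is_arg_max (\<lambda>x. dom_count {0..<n} E (insert x (set A))) (\<lambda>x. x \<in> {0..<n} - set A) w" for w
  proof
    assume b: "better (set A) w v"
    have w': "w < n" "w \<notin> set A" using w unfolding is_arg_max_def by auto
    have "dom_count {0..<n} E (insert w (set A)) = dom_count {0..<n} E (insert v (set A))"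
      using w arg unfolding is_arg_max_def by (meson linorder_neqE_nat)
    then have "dom_num M (w # A) = dom_num M (v # A)" using dn w'(1) v(1) by simp
    from better[OF A(1) v(1) w'(1) b this] v(3)[OF w'] show False by simp
  qed
  then have "greedy {0..<n} E better (Suc p) (insert v (set A))"
    using greedy.pick[OF A(3) arg] by blast
  then show ?case unfolding run using A v by simp
qed

subsection \<open>The program\<close>

text \<open>The choices left open in \<open>algorithm_output\<close> are read off from the computed
  lists: the parents give the forest and the roots, the labels give the pieces, and
  \<open>cen\<close> gives the centers.\<close>

lemma alg_correct:
  assumes ug: "ugraph {0..<n} E" and p: "p \<le> n" and rep: "represents n E M"
  shows "\<exists>D. alg p M = map (\<lambda>i. i \<in> D) [0..<n] \<and> algorithm_output {0..<n} E p D"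
proof -
  interpret G: input_graph n E M using ug rep by unfold_locales
  let ?V = "{0..<n}"
  define ps where "ps = parents M"
  note inv = G.parents_inv[folded ps_def]
  have len: "length ps = n" using inv(1) unfolding G.grow_inv_def by blast
  obtain rank where rank: "G.ranked ps rank" using inv(1) unfolding G.grow_inv_def by blast
  interpret list_forest n ps rank
  proof
    show "finite ?V" by simp
    show "get ps y \<in> ?V" if "y \<in> ?V" for y using rank inv(2) that unfolding G.ranked_def by blast
    show "rank (get ps y) < rank y" if "y \<in> ?V" "get ps y \<noteq> y" for y
      using rank inv(2) that unfolding G.ranked_def by blast
    show "rank y \<le> n" if "y \<in> ?V" for y
    proof -
      have "rank y < card ?V" using rank inv(2) that unfolding G.ranked_def by metis
      then show ?thesis by simp
    qed
    show "length ps = n" by (rule len)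
  qed
  have Ff: "F = G.forest ps" unfolding F_def G.forest_def inv(2) ..
  have FE: "F \<subseteq> E"
  proof
    fix e assume "e \<in> F"
    then obtain y where y: "e = {y, get ps y}" "y \<in> ?V" "get ps y \<noteq> y" unfolding F_def by blast
    then have "{get ps y, y} \<in> E" using rank inv(2) unfolding G.ranked_def by blast
    then show "e \<in> E" using y(1) by (simp add: insert_commute)
  qed
  have conn: "connects F x y \<longleftrightarrow> connects E x y" if "x \<in> ?V" "y \<in> ?V" for x y
  proof
    show "connects E x y" if "connects F x y" by (rule connects_mono[OF that FE])
    show "connects F x y" if "connects E x y"
      using inv \<open>x \<in> ?V\<close> \<open>y \<in> ?V\<close> that unfolding G.grow_inv_def Ff by blast
  qed
  have "{y \<in> ?V. connects F x y} = {y \<in> ?V. connects E x y}" if "x \<in> ?V" for x using conn[OF that] by blast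
  then have comp: "components ?V F = components ?V E" unfolding components_def by blast
  have sf: "spanning_forest ?V E F" unfolding spanning_forest_def using FE acyclic comp by blast
  \<comment> \<open>\<open>rt\<close> is constant on a component, so an arbitrary member yields the
    root.\<close>
  define r where "r T = rt (SOME x. x \<in> T)" for T
  define P where "P T = piece_of ` lb ` T" for T
  have T: "r T \<in> T \<and> decomposition F (r T) T (P T)" if "T \<in> components ?V F" for T
  proof -
    define x where "x = (SOME x. x \<in> T)"
    have xT: "x \<in> T" unfolding x_def using component_nonempty[OF that] some_in_eq by blast
    then have x: "x < n" using component_subset[OF that] by auto
    have T: "T = tree ?V (rt x)" using component_rt[OF that xT] unfolding tree_def by simp
    have "rt x \<in> T" unfolding T tree_def using rt_V[of x] rt_rt[of x] x by simp
    moreover have "decomposition F (rt x) T (P T)" unfolding P_def T by (rule tree_decomposition(1)[OF refl x])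
    ultimately show ?thesis unfolding r_def x_def[symmetric] by blast
  qed
  define \<P> where "\<P> = (\<Union>T\<in>components ?V F. P T)"
  have \<P>: "\<P> = piece_of ` lb ` ?V"
    unfolding \<P>_def P_def using Union_components[of ?V F] by (metis image_UN image_image UN_simps(10) image_Union)
  \<comment> \<open>\<open>c\<close> has to be a function of the piece as a set; an arbitrary member
    gives back the label.\<close>
  define c where "c X = cen ps (labels ps) (lb (SOME w. w \<in> X))" for X
  have c: "c (piece_of (lb w)) = cen ps (labels ps) (lb w)" if w: "w < n" for w
  proof -
    have "w \<in> piece_of (lb w)" unfolding piece_of_def using w by simp
    then have "(SOME v. v \<in> piece_of (lb w)) \<in> piece_of (lb w)" by (rule someI)
    then have "lb (SOME v. v \<in> piece_of (lb w)) = lb w" unfolding piece_of_def[of "lb w"] by blast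
    then show ?thesis unfolding c_def by simp
  qed
  have center: "\<forall>X\<in>\<P>. is_center X (induced_edges F X) (c X)"
    unfolding \<P> using cen_is_center c by auto
  define H where "H = (\<Union>X\<in>\<P>. induced_edges F X)"
  have "{x, y} \<in> H \<longleftrightarrow> hadj ps (labels ps) x y" if xy: "x < n" "y < n" for x y
  proof
    assume "{x, y} \<in> H"
    then obtain w where w: "w < n" "{x, y} \<in> induced_edges F (piece_of (lb w))" unfolding H_def \<P> by auto
    then have "lb x = lb w" unfolding induced_edges_def piece_of_def by auto
    then show "hadj ps (labels ps) x y" using w(2) hadj_iff[OF xy] by simp
  next
    assume "hadj ps (labels ps) x y"
    then show "{x, y} \<in> H" using hadj_iff[OF xy] xy(1) unfolding H_def \<P> by auto
  qed
  then have repH: "represents n H (hmat ps (labels ps))"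
    unfolding hmat_def len by (intro represents_map) simp
  have cens: "nth_or False (cens ps (labels ps)) v \<longleftrightarrow> v \<in> c ` \<P>" if "v < n" for v
  proof -
    have "nth_or False (cens ps (labels ps)) v \<longleftrightarrow> (\<exists>w<n. cen ps (labels ps) (lb w) = v)"
      unfolding cens_def len using that by (auto simp: nth_or_eq list_ex_iff)
    also have "\<dots> \<longleftrightarrow> v \<in> c ` \<P>" unfolding \<P> using c by force
    finally show ?thesis .
  qed
  define A where "A = greedy_run M [] p"
  define A' where "A' = dec_run ps (labels ps) p"
  have A: "set A \<subseteq> ?V" "card (set A) = p" "greedy ?V E no_preference p (set A)"
    using greedy_run_correct[OF rep p, of no_preference "[]"] unfolding A_def no_preference_def by auto
  \<comment> \<open>Coverage being equal, the keys differ only in the tie terms, where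
    \<open>w\<close> is at least as good in both and better in one.\<close>
  have "key (hmat ps (labels ps)) (cens ps (labels ps)) B v < key (hmat ps (labels ps)) (cens ps (labels ps)) B w"
    if B: "set B \<subseteq> ?V" "v < n" "w < n" "center_preference ?V H (c ` \<P>) (set B) w v"
      "dom_num (hmat ps (labels ps)) (w # B) = dom_num (hmat ps (labels ps)) (v # B)" for B v w
    using B(4) unfolding key_def B(5) cens[OF B(2)] cens[OF B(3)]
      dom_test_iff[OF repH B(1,2)] dom_test_iff[OF repH B(1,3)] center_preference_def
    by (simp split: if_split) blast
  from greedy_run_correct[OF repH p this]
  have run: "set A' \<subseteq> ?V \<and> card (set A') = p \<and> greedy ?V H (center_preference ?V H (c ` \<P>)) p (set A')"
    unfolding A'_def dec_run_def .
  note A' = conjunct1[OF run] conjunct1[OF conjunct2[OF run]] conjunct2[OF conjunct2[OF run]]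
  define D where "D = set (if dom_num M A' \<le> dom_num M A then A else A')"
  have "alg p M = map (\<lambda>i. i \<in> D) [0..<n]"
    unfolding alg_def best_def D_def A_def A'_def ps_def mem_iff G.length_M ..
  moreover have "algorithm_output ?V E p D"
    unfolding algorithm_output_def
  proof (intro exI conjI)
    show "spanning_forest ?V E F" by (rule sf)
    show "\<forall>T\<in>components ?V F. r T \<in> T \<and> decomposition F (r T) T (P T)" using T by blast
    show "\<forall>X\<in>\<P>. is_center X (induced_edges F X) (c X)" by (rule center)
    show "greedy ?V E no_preference p (set A)" by (rule A)
    show "greedy ?V H (center_preference ?V H (c ` \<P>)) p (set A')" by (rule A')
    show "D \<in> {set A, set A'}" unfolding D_def by simp
    show "ext ?V E D = max (ext ?V E (set A)) (ext ?V E (set A'))"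
      unfolding ext_def D_def using dom_num_eq[OF rep A(1)] dom_num_eq[OF rep A'(1)] A(2) A'(2) by auto
  qed (simp_all add: \<P>_def H_def)
  ultimately show ?thesis by blast
qed

lemma enc_bools: "enc (map P [0..<n]) = enc_set n {i. P i}"
  unfolding enc_set_def enc_list_inst by (simp add: comp_def enc_bool_inst)

text \<open>Identifies the prescribed input format with the encoding by types, so that the program
  obtained from \<open>PT_alg\<close> runs on it.\<close>

lemma enc_instance_eq:
  "enc_instance n E p = enc (p, map (\<lambda>i. map (\<lambda>j. {i, j} \<in> E) [0..<n]) [0..<n])"
proof -
  have "enc_graph n E = enc (map (\<lambda>i. map (\<lambda>j. {i, j} \<in> E) [0..<n]) [0..<n])"
    unfolding enc_graph_def by (subst enc_list_inst) (simp add: comp_def enc_bools)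
  then show ?thesis unfolding enc_instance_def by (simp add: enc_nat_inst)
qed

theorem theorem2:
  shows
    "(\<forall>(V :: 'a set) E p D.
        ugraph V E \<and> p \<le> card V \<and> algorithm_output V E p D
        \<longrightarrow> approx_solution ((6 * exp 1 - 5) / (6 * exp 1 + 5)) V E p D) \<and>
     (\<exists>c (q :: nat poly). \<forall>n E p.
        ugraph {0..<n} E \<and> p \<le> n
        \<longrightarrow> (\<exists>D t. computes_in c (enc_instance n E p) t (enc_set n D) \<and>
              t \<le> poly q (size (enc_instance n E p)) \<and>
              algorithm_output {0..<n} E p D \<and>
              approx_solution ((6 * exp 1 - 5) / (6 * exp 1 + 5)) {0..<n} E p D))"
proof
  show "\<forall>(V :: 'a set) E p D.
        ugraph V E \<and> p \<le> card V \<and> algorithm_output V E p D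
        \<longrightarrow> approx_solution ((6 * exp 1 - 5) / (6 * exp 1 + 5)) V E p D"
    using algorithm_output_approx by blast
  obtain c and q :: "nat poly" where cq: "\<forall>x. \<exists>t. computes_in c (enc x) t (enc (alg (fst x) (snd x))) \<and>
      t \<le> poly q (size (enc x))"
    using PT_computes[OF PT_alg] by blast
  show "\<exists>c (q :: nat poly). \<forall>n E p.
        ugraph {0..<n} E \<and> p \<le> n
        \<longrightarrow> (\<exists>D t. computes_in c (enc_instance n E p) t (enc_set n D) \<and>
              t \<le> poly q (size (enc_instance n E p)) \<and>
              algorithm_output {0..<n} E p D \<and>
              approx_solution ((6 * exp 1 - 5) / (6 * exp 1 + 5)) {0..<n} E p D)"
  proof (intro exI[of _ c] exI[of _ q] allI impI)
    fix n p :: nat and E :: "nat set set"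
    assume np: "ugraph {0..<n} E \<and> p \<le> n"
    let ?M = "map (\<lambda>i. map (\<lambda>j. {i, j} \<in> E) [0..<n]) [0..<n]"
    obtain D where D: "alg p ?M = map (\<lambda>i. i \<in> D) [0..<n]" "algorithm_output {0..<n} E p D"
      using alg_correct[of n E p ?M] represents_map[of n "\<lambda>i j. {i, j} \<in> E" E] np by blast
    obtain t where t: "computes_in c (enc (p, ?M)) t (enc (alg p ?M))" "t \<le> poly q (size (enc (p, ?M)))"
      using cq[rule_format, of "(p, ?M)"] by (auto simp del: enc_simps)
    have "enc (alg p ?M) = enc_set n D" unfolding D(1) enc_bools by simp
    then show "\<exists>D t. computes_in c (enc_instance n E p) t (enc_set n D) \<and>
              t \<le> poly q (size (enc_instance n E p)) \<and>
              algorithm_output {0..<n} E p D \<and>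
              approx_solution ((6 * exp 1 - 5) / (6 * exp 1 + 5)) {0..<n} E p D"
      using t D(2) algorithm_output_approx[of "{0..<n}" E p D] np unfolding enc_instance_eq by metis
  qed
qed

end
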